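(* Let $G=(V,E)$ be an infinite, countable, connected, locally finite graph, let $K$ be a symmetric transition matrix on the edge set $E$, and let $p\in[0,1]$ with $p\neq p_c(G)$. Then almost surely there is no exceptional time for the $K$-exclusion dynamical (bond) percolation of parameter $p$ on $G$. (The same result also holds for site percolation, with $K$ a symmetric transition matrix on the set of sites $V$ and $p_c$ the critical point of site percolation.)
   Context: Bond percolation: $\Omega=\{-1,1\}^E$ with the product $\sigma$-algebra; $1$ means open and $-1$ means closed; $\mathbb{P}_p=(p\delta_1+(1-p)\delta_{-1})^{\otimes E}$. A cluster is a connected component of the graph obtained by keeping only the open edges. For site percolation, vertices rather than edges are open or closed, and clusters are connected components of the graph obtained by keeping only open sites. For each $p$, $\mathbb{P}_p[\exists\text{ an infinite cluster}]\in\{0,1\}$, and the critical point $p_c=p_c(G)\in[0,1]$ is the number such that this probability is $0$ for $p<p_c$ and $1$ for $p>p_c$. $K$-exclusion dynamical percolation of parameter $p$: let $K$ be a symmetric transition matrix ($K(e,f)=K(f,e)\ge 0$, $\sum_f K(e,f)=1$). Sample $\omega_K(0)\sim\mathbb{P}_p$. To each pair $\{e,f\}$ associate an exponential clock of parameter (rate) $K(e,f)$, independent of the other clocks and of $\omega_K(0)$. When the clock of $\{e,f\}$ rings, the states of $e$ and $f$ are exchanged. More precisely, almost surely for all $t\ge0$ following the successive exchanges starting from $e$ at time $0$ up to time $t$ defines a permutation $\pi_t$, and $\omega_K(t)_{\pi_t(e)}=\omega_K(0)_e$. This gives a càdlàg Markov process $(\omega_K(t))_{t\ge0}$ with $\mathbb{P}_p$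 as an invariant measure. Exceptional times: if $\mathbb{P}_p[\exists\text{ an infinite cluster}]=0$, an exceptional time is a time $t\ge 0$ at which $\omega_K(t)$ has an infinite cluster; if $\mathbb{P}_p[\exists\text{ an infinite cluster}]=1$, it is a time $t\ge0$ at which $\omega_K(t)$ has no infinite cluster. *)

theory Defs
  imports "HOL-Probability.Probability"
begin

section \<open>Graphs and clusters\<close>

text \<open>A graph is given by a vertex set and a set of edges, an edge being a two-element set of
  vertices.\<close>

definition simple_graph :: "'v set \<Rightarrow> 'v set set \<Rightarrow> bool" where
  "simple_graph V E \<longleftrightarrow> (\<forall>e\<in>E. e \<subseteq> V \<and> card e = 2)"

definition joined :: "'v set set \<Rightarrow> ('v \<times> 'v) set" where
  "joined E = {(u, v). {u, v} \<in> E}\<^sup>*"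

definition connected_graph :: "'v set \<Rightarrow> 'v set set \<Rightarrow> bool" where
  "connected_graph V E \<longleftrightarrow> (\<forall>u\<in>V. \<forall>v\<in>V. (u, v) \<in> joined E)"

definition locally_finite :: "'v set \<Rightarrow> 'v set set \<Rightarrow> bool" where
  "locally_finite V E \<longleftrightarrow> (\<forall>v\<in>V. finite {e\<in>E. v \<in> e})"

definition components_of_graph :: "'v set \<Rightarrow> 'v set set \<Rightarrow> 'v set set" where
  "components_of_graph V E = {{w\<in>V. (v, w) \<in> joined E} | v. v \<in> V}"

definition bond_clusters :: "'v set \<Rightarrow> 'v set set \<Rightarrow> ('v set \<Rightarrow> int) \<Rightarrow> 'v set set" where
  "bond_clusters V E \<omega> = components_of_graph V {e\<in>E. \<omega> e = 1}"

definition site_clusters :: "'v set \<Rightarrow> 'v set set \<Rightarrow> ('v \<Rightarrow> int) \<Rightarrow> 'v set set" where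
  "site_clusters V E \<omega> = components_of_graph {v\<in>V. \<omega> v = 1} {e\<in>E. \<forall>v\<in>e. \<omega> v = 1}"

definition bond_percolates :: "'v set \<Rightarrow> 'v set set \<Rightarrow> ('v set \<Rightarrow> int) \<Rightarrow> bool" where
  "bond_percolates V E \<omega> \<longleftrightarrow> (\<exists>C\<in>bond_clusters V E \<omega>. infinite C)"

definition site_percolates :: "'v set \<Rightarrow> 'v set set \<Rightarrow> ('v \<Rightarrow> int) \<Rightarrow> bool" where
  "site_percolates V E \<omega> \<longleftrightarrow> (\<exists>C\<in>site_clusters V E \<omega>. infinite C)"


section \<open>Bernoulli percolation and critical points\<close>

text \<open>From here on, \<open>S\<close> is the set of objects that are open (\<open>1\<close>) or closed (\<open>-1\<close>): the edges for
  bond percolation, the vertices for site percolation. The predicate \<open>A\<close> on configurations is the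
  corresponding event that there is an infinite cluster.\<close>

definition bernoulli_percolation :: "'i set \<Rightarrow> real \<Rightarrow> ('i \<Rightarrow> int) measure" where
  "bernoulli_percolation S p =
     (\<Pi>\<^sub>M i\<in>S. point_measure {- 1, 1} (\<lambda>s. ennreal (if s = 1 then p else 1 - p)))"

definition percolation_prob :: "'i set \<Rightarrow> (('i \<Rightarrow> int) \<Rightarrow> bool) \<Rightarrow> real \<Rightarrow> real" where
  "percolation_prob S A p =
     measure (bernoulli_percolation S p) {\<omega> \<in> space (bernoulli_percolation S p). A \<omega>}"

definition critical_point :: "'i set \<Rightarrow> (('i \<Rightarrow> int) \<Rightarrow> bool) \<Rightarrow> real" where
  "critical_point S A =
     (THE pc. pc \<in> {0..1} \<and>
        (\<forall>p\<in>{0..1}. (p < pc \<longrightarrow> percolation_prob S A p = 0) \<and>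
                    (pc < p \<longrightarrow> percolation_prob S A p = 1)))"

definition bond_critical_point :: "'v set \<Rightarrow> 'v set set \<Rightarrow> real" where
  "bond_critical_point V E = critical_point E (bond_percolates V E)"

definition site_critical_point :: "'v set \<Rightarrow> 'v set set \<Rightarrow> real" where
  "site_critical_point V E = critical_point V (site_percolates V E)"


section \<open>Exclusion dynamics\<close>

definition symmetric_transition_matrix :: "'i set \<Rightarrow> ('i \<Rightarrow> 'i \<Rightarrow> real) \<Rightarrow> bool" where
  "symmetric_transition_matrix S K \<longleftrightarrow>
     (\<forall>e\<in>S. \<forall>f\<in>S. K e f = K f e \<and> 0 \<le> K e f) \<and> (\<forall>e\<in>S. (K e has_sum 1) S)"

text \<open>Pairs \<open>{e, e}\<close> are left out, since exchanging \<open>e\<close> with itself does nothing, and so are pairs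
  with rate \<open>0\<close>, whose clock never rings.\<close>

definition clock_pairs :: "'i set \<Rightarrow> ('i \<Rightarrow> 'i \<Rightarrow> real) \<Rightarrow> 'i set set" where
  "clock_pairs S K = {{e, f} | e f. e \<in> S \<and> f \<in> S \<and> e \<noteq> f \<and> 0 < K e f}"

text \<open>\<open>W a n\<close> is the waiting time between the \<open>n\<close>-th and the \<open>(n+1)\<close>-st ring of the clock of
  the pair \<open>a\<close> (the clock being started at time \<open>0\<close>), and \<open>X0\<close> is the initial configuration.\<close>

locale exclusion_randomness = prob_space M
  for M :: "'m measure"
  and S :: "'i set"
  and K :: "'i \<Rightarrow> 'i \<Rightarrow> real"
  and p :: real
  and X0 :: "'m \<Rightarrow> 'i \<Rightarrow> int"
  and W :: "'i set \<Rightarrow> nat \<Rightarrow> 'm \<Rightarrow> real" +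
  assumes initial_measurable: "X0 \<in> measurable M (bernoulli_percolation S p)"
    and initial_distr:
      "distr M (bernoulli_percolation S p) X0 = bernoulli_percolation S p"
    and waiting_distributed:
      "\<And>e f n. e \<in> S \<Longrightarrow> f \<in> S \<Longrightarrow> e \<noteq> f \<Longrightarrow> 0 < K e f \<Longrightarrow>
         distributed M lborel (W {e, f} n) (exponential_density (K e f))"
    and waiting_indep:
      "indep_vars (\<lambda>_. borel) (\<lambda>(a, n). W a n) (clock_pairs S K \<times> UNIV)"
    and initial_indep_waiting:
      "indep_set (sets (vimage_algebra (space M) X0 (bernoulli_percolation S p)))
         (sets (vimage_algebra (space M)
            (\<lambda>x. \<lambda>(a, n)\<in>clock_pairs S K \<times> UNIV. W a n x)
            (\<Pi>\<^sub>M j\<in>clock_pairs S K \<times> UNIV. borel)))"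

definition ring_times ::
  "'i set \<Rightarrow> ('i \<Rightarrow> 'i \<Rightarrow> real) \<Rightarrow> ('i set \<Rightarrow> nat \<Rightarrow> 'm \<Rightarrow> real) \<Rightarrow> 'm \<Rightarrow> 'i set \<Rightarrow> real set" where
  "ring_times S K W x a =
     (if a \<in> clock_pairs S K then range (\<lambda>n. \<Sum>i\<le>n. W a i x) else {})"

text \<open>\<open>carried S R e t f\<close>: following the exchanges successively from \<open>e\<close> at time \<open>0\<close>
  leads to \<open>f\<close> at time \<open>t\<close>, where \<open>R {g, h}\<close> is the set of times at which \<open>g\<close> and \<open>h\<close> are
  exchanged. Only finitely many jumps are allowed before \<open>t\<close>.\<close>

inductive carried :: "'i set \<Rightarrow> ('i set \<Rightarrow> real set) \<Rightarrow> 'i \<Rightarrow> real \<Rightarrow> 'i \<Rightarrow> bool"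
  for S :: "'i set" and R :: "'i set \<Rightarrow> real set" and e :: 'i where
  start: "e \<in> S \<Longrightarrow> carried S R e 0 e"
| stay: "carried S R e s f \<Longrightarrow> s \<le> t \<Longrightarrow>
    (\<forall>h\<in>S - {f}. R {f, h} \<inter> {s<..t} = {}) \<Longrightarrow> carried S R e t f"
| exchange: "carried S R e s f \<Longrightarrow> s < t \<Longrightarrow>
    (\<forall>h\<in>S - {f}. R {f, h} \<inter> {s<..<t} = {}) \<Longrightarrow>
    g \<in> S - {f} \<Longrightarrow> t \<in> R {f, g} \<Longrightarrow> carried S R e t g"

text \<open>The permutation \<open>\<pi>\<^sub>t\<close>. The definite description and the inverse below are
  meaningful on the almost sure event that following the exchanges defines a permutation of \<open>S\<close>
  at all times.\<close>

definition exchange_perm :: "'i set \<Rightarrow> ('i set \<Rightarrow> real set) \<Rightarrow> real \<Rightarrow> 'i \<Rightarrow> 'i" where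
  "exchange_perm S R t e = (THE f. carried S R e t f)"

definition exclusion_process ::
  "'i set \<Rightarrow> ('i \<Rightarrow> 'i \<Rightarrow> real) \<Rightarrow> ('m \<Rightarrow> 'i \<Rightarrow> int) \<Rightarrow> ('i set \<Rightarrow> nat \<Rightarrow> 'm \<Rightarrow> real)
     \<Rightarrow> 'm \<Rightarrow> real \<Rightarrow> 'i \<Rightarrow> int" where
  "exclusion_process S K X0 W x t =
     (\<lambda>f\<in>S. X0 x (inv_into S (exchange_perm S (ring_times S K W x) t) f))"

definition exceptional_time ::
  "'i set \<Rightarrow> (('i \<Rightarrow> int) \<Rightarrow> bool) \<Rightarrow> real \<Rightarrow> (real \<Rightarrow> 'i \<Rightarrow> int) \<Rightarrow> real \<Rightarrow> bool" where
  "exceptional_time S A p \<omega> t \<longleftrightarrow> 0 \<le> t \<and>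
     (percolation_prob S A p = 0 \<and> A (\<omega> t) \<or> percolation_prob S A p = 1 \<and> \<not> A (\<omega> t))"

end

theory Submission
  imports Defs
begin

text \<open>Let \<open>p\<close> be below the critical point; the other case is symmetric, with closed sites in the place of
  open ones. (For bond percolation, sites are the edges.) Time is cut into slabs of a small length \<open>\<epsilon>\<close>.
  A site that is open at some time of a slab starting at \<open>s\<close> is open at time \<open>s\<close>, or one of its clocks
  rings during the slab. It suffices that the random set of all these sites is dominated by Bernoulli
  percolation with a parameter \<open>p'\<close> that still lies below the critical point: then, almost surely,
  it contains no infinite cluster, so there is none at any time of the slab, and there
  are countably many slabs.

  Two observations give the domination. First, for fixed \<open>s\<close>, the configuration at time \<open>s\<close> is Bernoulli
  and independent of all the clocks, including their rings before \<open>s\<close>, because given the clocks it is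
  the initial configuration moved by a fixed permutation (\<open>state_indep_clocks\<close>). Second, the
  conditional probability that a site belongs to the set, given which other sites do, is at most
  \<open>p + \<epsilon> / p\<close> (\<open>inclusion_prob_le_touched\<close>). This is not obvious, since a ring concerns two sites,
  so that the rings alone create strong correlations. But if a site \<open>g\<close> is known to
  belong to the set, the most plausible reason is that it is open at time \<open>s\<close>, and the conditional
  probability of a ring of \<open>{f, g}\<close> is at most \<open>\<epsilon> K(f, g) / p\<close> (\<open>pair_prob_given_trace\<close>); the sum over
  \<open>g\<close> is at most \<open>\<epsilon> / p\<close>. Such conditional bounds imply domination (\<open>domination\<close>). If \<open>p = 0\<close>, no
  site is ever open.

  That the dynamics defines a permutation at all times follows from Harris' argument: within a slab, the
  probability that a self-avoiding path of \<open>n\<close> ringing pairs starts at a given site is at most \<open>\<epsilon>\<^sup>n\<close>, so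
  that for \<open>\<epsilon> < 1\<close> the sites split into finite components on which the finitely many exchanges can be carried out in
  order (\<open>AE_exchange_flow\<close>, \<open>bijective_within_slab\<close>).

  Finally, the critical point, a definite description, is the threshold it should be
  (\<open>critical_point_threshold\<close>): the percolation probability is monotone, again by domination, and
  it only takes the values \<open>0\<close> and \<open>1\<close> by Kolmogorov's law, because finite modifications
  neither create nor destroy infinite clusters.\<close>


section \<open>Countable families of events\<close>

lemma (in finite_measure) measure_Union_le_finite_sums:
  assumes "countable I" and sets: "\<And>i. i \<in> I \<Longrightarrow> B i \<in> sets M"
    and sums: "\<And>F. finite F \<Longrightarrow> F \<subseteq> I \<Longrightarrow> (\<Sum>i\<in>F. measure M (B i)) \<le> c"
  shows "measure M (\<Union>i\<in>I. B i) \<le> c"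
proof (cases "I = {}")
  case True
  then show ?thesis using sums[of "{}"] by simp
next
  case False
  define F where "F n = from_nat_into I ` {..n}" for n
  have F: "finite (F n)" "F n \<subseteq> I" for n
    using from_nat_into[OF False] by (auto simp: F_def)
  have UN: "(\<Union>n. \<Union>i\<in>F n. B i) = (\<Union>i\<in>I. B i)"
  proof -
    have "(\<Union>n. F n) = I"
      using range_from_nat_into[OF False \<open>countable I\<close>] unfolding F_def by (simp add: UN_atMost_UNIV flip: image_UN)
    then show ?thesis by blast
  qed
  have "incseq F" by (auto simp: incseq_def F_def)
  then have "incseq (\<lambda>n. \<Union>i\<in>F n. B i)" by (fastforce simp: incseq_def)
  moreover have "range (\<lambda>n. \<Union>i\<in>F n. B i) \<subseteq> sets M"
    using F sets by (auto intro!: sets.finite_UN)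
  ultimately have "(\<lambda>n. measure M (\<Union>i\<in>F n. B i)) \<longlonglongrightarrow> measure M (\<Union>i\<in>I. B i)"
    using finite_Lim_measure_incseq[of "\<lambda>n. \<Union>i\<in>F n. B i"] UN by simp
  moreover have "measure M (\<Union>i\<in>F n. B i) \<le> c" for n
  proof -
    have "measure M (\<Union>i\<in>F n. B i) \<le> (\<Sum>i\<in>F n. measure M (B i))"
      using F sets by (intro measure_UNION_le) auto
    then show ?thesis using sums[OF F(1,2)[of n]] by simp
  qed
  ultimately show ?thesis by (intro LIMSEQ_le_const2) auto
qed

text \<open>The first Borel-Cantelli lemma over a countable index set; only finite partial sums are bounded,
  because the bounds available later are of this form.\<close>

lemma (in finite_measure) AE_finite_finite_sums:
  assumes "countable I" and sets: "\<And>i. i \<in> I \<Longrightarrow> B i \<in> sets M"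
    and sums: "\<And>F. finite F \<Longrightarrow> F \<subseteq> I \<Longrightarrow> (\<Sum>i\<in>F. measure M (B i)) \<le> c"
  shows "AE x in M. finite {i\<in>I. x \<in> B i}"
proof -
  define B' where "B' n = (if n \<in> to_nat_on I ` I then B (from_nat_into I n) else {})" for n
  have inj: "inj_on (to_nat_on I) I" using \<open>countable I\<close> by (rule inj_on_to_nat_on)
  have B': "B' (to_nat_on I i) = B i" if "i \<in> I" for i
    using that \<open>countable I\<close> by (simp add: B'_def)
  have "AE x in M. eventually (\<lambda>n. x \<in> space M - B' n) sequentially"
  proof (rule borel_cantelli_AE1)
    show setsB': "B' n \<in> sets M" for n
      using sets \<open>countable I\<close> by (auto simp: B'_def)
    show "emeasure M (B' n) < \<infinity>" for n
      by (simp add: emeasure_eq_measure)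
    show "summable (\<lambda>n. measure M (B' n))"
    proof (rule summableI_nonneg_bounded[where x=c])
      fix n
      define F where "F = {i\<in>I. to_nat_on I i < n}"
      have "to_nat_on I ` F \<subseteq> {..<n}" by (auto simp: F_def)
      moreover have "inj_on (to_nat_on I) F" using inj by (auto simp: F_def inj_on_def)
      ultimately have "finite F" using finite_imageD finite_subset by (metis finite_lessThan)
      have "(\<Sum>k<n. measure M (B' k)) = (\<Sum>k\<in>to_nat_on I ` F. measure M (B' k))"
        by (rule sum.mono_neutral_right) (auto simp: F_def B'_def)
      also have "\<dots> = (\<Sum>i\<in>F. measure M (B i))"
        using \<open>inj_on (to_nat_on I) F\<close> B' by (subst sum.reindex) (auto simp: F_def intro!: sum.cong)
      also have "\<dots> \<le> c" using \<open>finite F\<close> by (intro sums) (auto simp: F_def)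
      finally show "(\<Sum>k<n. measure M (B' k)) \<le> c" .
    qed auto
  qed
  then show ?thesis
  proof (rule AE_mp, intro AE_I2 impI)
    fix x assume "eventually (\<lambda>n. x \<in> space M - B' n) sequentially"
    then obtain N where N: "\<And>n. n \<ge> N \<Longrightarrow> x \<notin> B' n"
      by (auto simp: eventually_sequentially)
    have "to_nat_on I ` {i\<in>I. x \<in> B i} \<subseteq> {..<N}"
    proof safe
      fix i assume "i \<in> I" "x \<in> B i"
      then have "x \<in> B' (to_nat_on I i)" using B' by simp
      then show "to_nat_on I i < N" using N not_le by blast
    qed
    moreover have "inj_on (to_nat_on I) {i\<in>I. x \<in> B i}"
      using inj by (auto simp: inj_on_def)
    ultimately show "finite {i\<in>I. x \<in> B i}"
      using finite_imageD finite_subset by (metis finite_lessThan)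
  qed
qed

section \<open>Stochastic domination\<close>

text \<open>A configuration is viewed as the random set of its open (or of its closed) sites.\<close>

definition random_subset :: "'m measure \<Rightarrow> 'i set \<Rightarrow> ('m \<Rightarrow> 'i set) \<Rightarrow> bool" where
  "random_subset M S T \<longleftrightarrow> (\<forall>x\<in>space M. T x \<subseteq> S) \<and> (\<forall>f\<in>S. {x\<in>space M. f \<in> T x} \<in> sets M)"

text \<open>The conditional probability that \<open>f\<close> belongs to the random set, given the trace of the set
  on any finite set of other sites, is at most \<open>r\<close>. The inequality is multiplied out, so that traces
  of probability \<open>0\<close> need no convention. For Bernoulli fields both this bound and the reverse one hold
  with \<open>r\<close> the density.\<close>

definition inclusion_prob_le :: "'m measure \<Rightarrow> 'i set \<Rightarrow> ('m \<Rightarrow> 'i set) \<Rightarrow> real \<Rightarrow> bool" where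
  "inclusion_prob_le M S T r \<longleftrightarrow> (\<forall>F f B. finite F \<longrightarrow> F \<subseteq> S \<longrightarrow> f \<in> S - F \<longrightarrow> B \<subseteq> F \<longrightarrow>
     measure M {x\<in>space M. f \<in> T x \<and> T x \<inter> F = B} \<le> r * measure M {x\<in>space M. T x \<inter> F = B})"

definition inclusion_prob_ge :: "'m measure \<Rightarrow> 'i set \<Rightarrow> ('m \<Rightarrow> 'i set) \<Rightarrow> real \<Rightarrow> bool" where
  "inclusion_prob_ge M S T r \<longleftrightarrow> (\<forall>F f B. finite F \<longrightarrow> F \<subseteq> S \<longrightarrow> f \<in> S - F \<longrightarrow> B \<subseteq> F \<longrightarrow>
     r * measure M {x\<in>space M. T x \<inter> F = B} \<le> measure M {x\<in>space M. f \<in> T x \<and> T x \<inter> F = B})"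

lemma random_subset_trace_sets:
  assumes T: "random_subset M S T" and F: "finite F" "F \<subseteq> S"
  shows "{x\<in>space M. T x \<inter> F = B} \<in> sets M"
proof (cases "B \<subseteq> F")
  case True
  then have "{x\<in>space M. T x \<inter> F = B} = {x\<in>space M. \<forall>f\<in>F. (f \<in> T x) = (f \<in> B)}" by auto
  moreover have "{x\<in>space M. (f \<in> T x) = (f \<in> B)} \<in> sets M" if "f \<in> F" for f
  proof (cases "f \<in> B")
    case True then show ?thesis using T F that by (auto simp: random_subset_def)
  next
    case False
    then have "{x\<in>space M. (f \<in> T x) = (f \<in> B)} = space M - {x\<in>space M. f \<in> T x}" by auto
    then show ?thesis using T F that by (auto simp: random_subset_def)
  qed
  ultimately show ?thesis using F by (auto intro!: sets.sets_Collect_finite_All')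
next
  case False
  then have "{x\<in>space M. T x \<inter> F = B} = {}" by auto
  then show ?thesis by (simp only: sets.empty_sets)
qed

lemma random_subset_cylinder_sets:
  assumes T: "random_subset M S T" and F: "finite F" "F \<subseteq> S"
  shows "{x\<in>space M. Q (T x \<inter> F)} \<in> sets M"
proof -
  have "{x\<in>space M. Q (T x \<inter> F)} = (\<Union>B\<in>{B\<in>Pow F. Q B}. {x\<in>space M. T x \<inter> F = B})" by auto
  then show ?thesis using random_subset_trace_sets[OF T F] F by (auto intro!: sets.finite_UN)
qed

lemma random_subset_member_cylinder_sets:
  assumes T: "random_subset M S T" and F: "finite F" "F \<subseteq> S" "f \<in> S"
  shows "{x\<in>space M. f \<in> T x \<and> Q (T x \<inter> F)} \<in> sets M"
proof -
  have "{x\<in>space M. f \<in> T x \<and> Q (T x \<inter> F)}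
      = {x\<in>space M. f \<in> T x} \<inter> {x\<in>space M. Q (T x \<inter> F)}" by auto
  then show ?thesis using random_subset_cylinder_sets[OF T F(1,2)] T F
    by (auto simp: random_subset_def)
qed

lemma measure_cylinder_sum:
  assumes "finite_measure M" and T: "random_subset M S T" and F: "finite F" "F \<subseteq> S"
  shows "measure M {x\<in>space M. Q (T x \<inter> F)}
    = (\<Sum>B | B \<subseteq> F \<and> Q B. measure M {x\<in>space M. T x \<inter> F = B})"
proof -
  interpret finite_measure M by fact
  have "{x\<in>space M. Q (T x \<inter> F)} = (\<Union>B\<in>{B. B \<subseteq> F \<and> Q B}. {x\<in>space M. T x \<inter> F = B})" by auto
  then show ?thesis using random_subset_trace_sets[OF T F] F
    by (auto intro!: finite_measure_finite_Union simp: disjoint_family_on_def)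
qed

lemma measure_member_cylinder_sum:
  assumes "finite_measure M" and T: "random_subset M S T" and F: "finite F" "F \<subseteq> S" "f \<in> S"
  shows "measure M {x\<in>space M. f \<in> T x \<and> Q (T x \<inter> F)}
    = (\<Sum>B | B \<subseteq> F \<and> Q B. measure M {x\<in>space M. f \<in> T x \<and> T x \<inter> F = B})"
proof -
  interpret finite_measure M by fact
  have "{x\<in>space M. f \<in> T x \<and> Q (T x \<inter> F)}
    = (\<Union>B\<in>{B. B \<subseteq> F \<and> Q B}. {x\<in>space M. f \<in> T x \<and> T x \<inter> F = B})" by auto
  then show ?thesis using random_subset_member_cylinder_sets[OF T F] F
    by (auto intro!: finite_measure_finite_Union simp: disjoint_family_on_def)
qed

lemma inclusion_prob_le_cylinder:
  assumes "finite_measure M" "random_subset M S T" "finite F" "F \<subseteq> S" "f \<in> S - F"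
    and "inclusion_prob_le M S T r"
  shows "measure M {x\<in>space M. f \<in> T x \<and> Q (T x \<inter> F)} \<le> r * measure M {x\<in>space M. Q (T x \<inter> F)}"
  using assms(3-6)
  by (subst measure_cylinder_sum[OF assms(1-4)], subst measure_member_cylinder_sum[OF assms(1-4)])
    (auto simp: sum_distrib_left inclusion_prob_le_def intro!: sum_mono)

lemma inclusion_prob_ge_cylinder:
  assumes "finite_measure M" "random_subset M S T" "finite F" "F \<subseteq> S" "f \<in> S - F"
    and "inclusion_prob_ge M S T r"
  shows "r * measure M {x\<in>space M. Q (T x \<inter> F)} \<le> measure M {x\<in>space M. f \<in> T x \<and> Q (T x \<inter> F)}"
  using assms(3-6)
  by (subst measure_cylinder_sum[OF assms(1-4)], subst measure_member_cylinder_sum[OF assms(1-4)])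
    (auto simp: sum_distrib_left inclusion_prob_ge_def intro!: sum_mono)

text \<open>An increasing event that sees one more site \<open>f\<close> happens either already without \<open>f\<close>, or because
  \<open>f\<close> is present and pivotal. Pivotality depends only on the other sites, so the conditional bounds
  on \<open>f\<close> apply to it.\<close>

lemma measure_cylinder_insert:
  assumes "finite_measure M" "random_subset M S T" "finite F" "F \<subseteq> S" "f \<in> S - F" and "mono Q"
  shows "measure M {x\<in>space M. Q (T x \<inter> insert f F)}
    = measure M {x\<in>space M. Q (T x \<inter> F)}
      + measure M {x\<in>space M. f \<in> T x \<and> (Q (insert f (T x \<inter> F)) \<and> \<not> Q (T x \<inter> F))}"
proof -
  interpret finite_measure M by fact
  have Q: "Q B \<Longrightarrow> Q (insert f B)" for B
    using \<open>mono Q\<close> by (auto dest: monoD[of Q B "insert f B"])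
  have "{x\<in>space M. Q (T x \<inter> insert f F)} = {x\<in>space M. Q (T x \<inter> F)}
      \<union> {x\<in>space M. f \<in> T x \<and> (Q (insert f (T x \<inter> F)) \<and> \<not> Q (T x \<inter> F))}"
    using Q by (auto simp: Int_insert_right split: if_splits)
  moreover have "{x\<in>space M. Q (T x \<inter> F)} \<in> sets M"
    using assms by (intro random_subset_cylinder_sets) auto
  moreover have "{x\<in>space M. f \<in> T x \<and> (Q (insert f (T x \<inter> F)) \<and> \<not> Q (T x \<inter> F))} \<in> sets M"
    using assms by (intro random_subset_member_cylinder_sets[where Q="\<lambda>B. Q (insert f B) \<and> \<not> Q B"]) auto
  ultimately show ?thesis by (auto intro!: finite_measure_Union)
qed

lemma measure_cylinder_diff:
  assumes "finite_measure M" "random_subset M S T" "finite F" "F \<subseteq> S" and "mono Q"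
  shows "measure M {x\<in>space M. Q (insert f (T x \<inter> F)) \<and> \<not> Q (T x \<inter> F)}
    = measure M {x\<in>space M. Q (insert f (T x \<inter> F))} - measure M {x\<in>space M. Q (T x \<inter> F)}"
proof -
  interpret finite_measure M by fact
  have Q: "Q B \<Longrightarrow> Q (insert f B)" for B
    using \<open>mono Q\<close> by (auto dest: monoD[of Q B "insert f B"])
  have "{x\<in>space M. Q (insert f (T x \<inter> F)) \<and> \<not> Q (T x \<inter> F)}
     = {x\<in>space M. Q (insert f (T x \<inter> F))} - {x\<in>space M. Q (T x \<inter> F)}" by auto
  then show ?thesis
    using random_subset_cylinder_sets[OF assms(2-4), where Q="\<lambda>B. Q (insert f B)"]
      random_subset_cylinder_sets[OF assms(2-4), where Q=Q] Q
    by (auto intro!: finite_measure_Diff)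
qed

text \<open>Sites are revealed one at a time. With \<open>Q\<^sub>0\<close> and \<open>Q\<^sub>1\<close> the increasing events obtained from \<open>Q\<close> by
  fixing the state of the last site, the first field satisfies
  \<open>P(Q) \<le> (1 - r) P(Q\<^sub>0) + r P(Q\<^sub>1)\<close> and the second one the reverse inequality; both coefficients are
  nonnegative, so the induction hypothesis can be applied to \<open>Q\<^sub>0\<close> and to \<open>Q\<^sub>1\<close>.\<close>

lemma domination_cylinder:
  fixes S :: "'i set"
  assumes M1: "prob_space M1" and T1: "random_subset M1 S T1" and le: "inclusion_prob_le M1 S T1 r"
    and M2: "prob_space M2" and T2: "random_subset M2 S T2" and ge: "inclusion_prob_ge M2 S T2 r"
    and r: "0 \<le> r" "r \<le> 1"
    and F: "finite F" "F \<subseteq> S" and "mono Q"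
  shows "measure M1 {x\<in>space M1. Q (T1 x \<inter> F)} \<le> measure M2 {x\<in>space M2. Q (T2 x \<inter> F)}"
  using F \<open>mono Q\<close>
proof (induction F arbitrary: Q rule: finite_induct)
  case empty
  then show ?case using prob_space.prob_space[OF M1] prob_space.prob_space[OF M2] by (cases "Q {}") auto
next
  case (insert f F)
  interpret M1: prob_space M1 by fact
  interpret M2: prob_space M2 by fact
  have F: "finite F" "F \<subseteq> S" "f \<in> S - F" using insert by auto
  let ?Q = "\<lambda>B. Q (insert f B)"
  let ?R = "\<lambda>B. Q (insert f B) \<and> \<not> Q B"
  have "mono ?Q"
  proof (rule monoI)
    fix B B' :: "'i set" assume "B \<subseteq> B'"
    then have "insert f B \<subseteq> insert f B'" by auto
    then show "?Q B \<le> ?Q B'" using insert.prems(2) by (rule monoD[rotated])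
  qed
  have IH: "measure M1 {x\<in>space M1. Q (T1 x \<inter> F)} \<le> measure M2 {x\<in>space M2. Q (T2 x \<inter> F)}"
      "measure M1 {x\<in>space M1. ?Q (T1 x \<inter> F)} \<le> measure M2 {x\<in>space M2. ?Q (T2 x \<inter> F)}"
    using insert.IH[of Q, OF F(2) insert.prems(2)] insert.IH[of ?Q, OF F(2) \<open>mono ?Q\<close>] by simp_all
  have "measure M1 {x\<in>space M1. Q (T1 x \<inter> insert f F)}
      \<le> measure M1 {x\<in>space M1. Q (T1 x \<inter> F)} + r * measure M1 {x\<in>space M1. ?R (T1 x \<inter> F)}"
    using measure_cylinder_insert[OF M1.finite_measure_axioms T1 F insert.prems(2)]
      inclusion_prob_le_cylinder[OF M1.finite_measure_axioms T1 F le, of ?R] by simp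
  also have "\<dots> = (1 - r) * measure M1 {x\<in>space M1. Q (T1 x \<inter> F)} + r * measure M1 {x\<in>space M1. ?Q (T1 x \<inter> F)}"
    by (subst measure_cylinder_diff[OF M1.finite_measure_axioms T1 F(1,2) insert.prems(2)]) (simp add: algebra_simps)
  also have "\<dots> \<le> (1 - r) * measure M2 {x\<in>space M2. Q (T2 x \<inter> F)} + r * measure M2 {x\<in>space M2. ?Q (T2 x \<inter> F)}"
    using IH r by (intro add_mono mult_left_mono) auto
  also have "\<dots> = measure M2 {x\<in>space M2. Q (T2 x \<inter> F)} + r * measure M2 {x\<in>space M2. ?R (T2 x \<inter> F)}"
    by (subst measure_cylinder_diff[OF M2.finite_measure_axioms T2 F(1,2) insert.prems(2)]) (simp add: algebra_simps)
  also have "\<dots> \<le> measure M2 {x\<in>space M2. Q (T2 x \<inter> insert f F)}"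
    using measure_cylinder_insert[OF M2.finite_measure_axioms T2 F insert.prems(2)]
      inclusion_prob_ge_cylinder[OF M2.finite_measure_axioms T2 F ge, of ?R] by simp
  finally show ?case .
qed

text \<open>Increasing events that arise from increasing cylinder events by monotone limits. Domination passes
  to such limits by continuity of measures, and measurability comes for free; the existence of an
  infinite cluster is of this form.\<close>

inductive increasing_event :: "'i set \<Rightarrow> ('i set \<Rightarrow> bool) \<Rightarrow> bool" for S where
  cylinder: "finite F \<Longrightarrow> F \<subseteq> S \<Longrightarrow> mono Q \<Longrightarrow> increasing_event S (\<lambda>T. Q (T \<inter> F))"
| union: "(\<And>n::nat. increasing_event S (A n)) \<Longrightarrow> (\<And>n T. A n T \<Longrightarrow> A (Suc n) T) \<Longrightarrow>
    increasing_event S (\<lambda>T. \<exists>n. A n T)"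
| inter: "(\<And>n::nat. increasing_event S (A n)) \<Longrightarrow> (\<And>n T. A (Suc n) T \<Longrightarrow> A n T) \<Longrightarrow>
    increasing_event S (\<lambda>T. \<forall>n. A n T)"

lemma increasing_event_sets:
  assumes "increasing_event S A" and "random_subset M S T"
  shows "{x\<in>space M. A (T x)} \<in> sets M"
  using assms(1)
proof induction
  case (cylinder F Q)
  then show ?case using random_subset_cylinder_sets[OF assms(2)] by auto
next
  case (union A)
  then show ?case by (auto intro!: sets.sets_Collect_countable_Ex)
next
  case (inter A)
  then show ?case by (auto intro!: sets.sets_Collect_countable_All)
qed

lemma increasing_event_mono:
  assumes "increasing_event S A" and "T \<subseteq> T'" and "A T"
  shows "A T'"
  using assms(1,3)
proof induction
  case (cylinder F Q)
  have "T \<inter> F \<subseteq> T' \<inter> F" using \<open>T \<subseteq> T'\<close> by auto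
  then show ?case using cylinder monoD[of Q "T \<inter> F" "T' \<inter> F"] by simp
qed blast+

lemma domination:
  assumes M1: "prob_space M1" and T1: "random_subset M1 S T1" and le: "inclusion_prob_le M1 S T1 r"
    and M2: "prob_space M2" and T2: "random_subset M2 S T2" and ge: "inclusion_prob_ge M2 S T2 r"
    and r: "0 \<le> r" "r \<le> 1" and A: "increasing_event S A"
  shows "measure M1 {x\<in>space M1. A (T1 x)} \<le> measure M2 {x\<in>space M2. A (T2 x)}"
  using A
proof induction
  case (cylinder F Q)
  then show ?case using domination_cylinder[OF M1 T1 le M2 T2 ge r] by auto
next
  case (union A)
  interpret M1: prob_space M1 by fact
  interpret M2: prob_space M2 by fact
  have "(\<lambda>n. measure M1 {x\<in>space M1. A n (T1 x)}) \<longlonglongrightarrow> measure M1 (\<Union>n. {x\<in>space M1. A n (T1 x)})"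
    using increasing_event_sets[OF union(1) T1] union(2)
    by (intro M1.finite_Lim_measure_incseq) (auto intro!: incseq_SucI)
  moreover have "(\<lambda>n. measure M2 {x\<in>space M2. A n (T2 x)}) \<longlonglongrightarrow> measure M2 (\<Union>n. {x\<in>space M2. A n (T2 x)})"
    using increasing_event_sets[OF union(1) T2] union(2)
    by (intro M2.finite_Lim_measure_incseq) (auto intro!: incseq_SucI)
  ultimately have "measure M1 (\<Union>n. {x\<in>space M1. A n (T1 x)}) \<le> measure M2 (\<Union>n. {x\<in>space M2. A n (T2 x)})"
    using union by (intro LIMSEQ_le) auto
  moreover have "(\<Union>n. {x\<in>space M1. A n (T1 x)}) = {x\<in>space M1. \<exists>n. A n (T1 x)}"
    "(\<Union>n. {x\<in>space M2. A n (T2 x)}) = {x\<in>space M2. \<exists>n. A n (T2 x)}" by auto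
  ultimately show ?case by simp
next
  case (inter A)
  interpret M1: prob_space M1 by fact
  interpret M2: prob_space M2 by fact
  have "(\<lambda>n. measure M1 {x\<in>space M1. A n (T1 x)}) \<longlonglongrightarrow> measure M1 (\<Inter>n. {x\<in>space M1. A n (T1 x)})"
    using increasing_event_sets[OF inter(1) T1] inter(2)
    by (intro M1.finite_Lim_measure_decseq) (auto intro!: decseq_SucI)
  moreover have "(\<lambda>n. measure M2 {x\<in>space M2. A n (T2 x)}) \<longlonglongrightarrow> measure M2 (\<Inter>n. {x\<in>space M2. A n (T2 x)})"
    using increasing_event_sets[OF inter(1) T2] inter(2)
    by (intro M2.finite_Lim_measure_decseq) (auto intro!: decseq_SucI)
  ultimately have "measure M1 (\<Inter>n. {x\<in>space M1. A n (T1 x)}) \<le> measure M2 (\<Inter>n. {x\<in>space M2. A n (T2 x)})"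
    using inter by (intro LIMSEQ_le) auto
  moreover have "(\<Inter>n. {x\<in>space M1. A n (T1 x)}) = {x\<in>space M1. \<forall>n. A n (T1 x)}"
    "(\<Inter>n. {x\<in>space M2. A n (T2 x)}) = {x\<in>space M2. \<forall>n. A n (T2 x)}" by auto
  ultimately show ?case by simp
qed


section \<open>Bernoulli percolation and its critical point\<close>

abbreviation state_prob :: "real \<Rightarrow> int \<Rightarrow> real" where
  "state_prob p v \<equiv> if v = 1 then p else 1 - p"

abbreviation sites_in_state :: "'i set \<Rightarrow> int \<Rightarrow> ('i \<Rightarrow> int) \<Rightarrow> 'i set" where
  "sites_in_state S v \<omega> \<equiv> {i\<in>S. \<omega> i = v}"

lemma prob_space_single_site:
  assumes "p \<in> {0..1}"
  shows "prob_space (point_measure {- 1, 1} (\<lambda>s::int. ennreal (state_prob p s)))"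
proof (rule prob_spaceI)
  show "emeasure (point_measure {- 1, 1} (\<lambda>s::int. ennreal (state_prob p s)))
      (space (point_measure {- 1, 1} (\<lambda>s. ennreal (state_prob p s)))) = 1"
    using assms by (simp add: space_point_measure emeasure_point_measure_finite flip: ennreal_plus)
qed

lemma prob_space_bernoulli:
  assumes "p \<in> {0..1}" shows "prob_space (bernoulli_percolation S p)"
  unfolding bernoulli_percolation_def using prob_space_single_site[OF assms]
  by (rule prob_space_PiM)

lemma space_bernoulli: "space (bernoulli_percolation S p) = S \<rightarrow>\<^sub>E {- 1, 1}"
  by (simp add: bernoulli_percolation_def space_PiM space_point_measure)

lemma measure_bernoulli_cylinder:
  assumes p: "p \<in> {0..1}" and J: "finite J" "J \<subseteq> S" and X: "\<And>i. i \<in> J \<Longrightarrow> X i \<in> {- 1, 1}"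
  shows "measure (bernoulli_percolation S p) {\<omega>\<in>space (bernoulli_percolation S p). \<forall>i\<in>J. \<omega> i = X i}
    = (\<Prod>i\<in>J. state_prob p (X i))"
proof -
  let ?P = "\<lambda>_::'a. point_measure {- 1, 1} (\<lambda>s::int. ennreal (state_prob p s))"
  interpret product_prob_space ?P S
    using prob_space_single_site[OF p]
    by (simp add: product_prob_space_def product_prob_space_axioms_def product_sigma_finite_def
        prob_space_imp_sigma_finite)
  have "emeasure (bernoulli_percolation S p)
      {\<omega>\<in>space (bernoulli_percolation S p). \<forall>i\<in>J. \<omega> i \<in> {X i}}
    = (\<Prod>i\<in>J. emeasure (point_measure {- 1, 1} (\<lambda>s::int. ennreal (state_prob p s))) {X i})"
    unfolding bernoulli_percolation_def using J X
    by (intro emeasure_PiM_Collect) (auto simp: sets_point_measure)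
  also have "\<dots> = (\<Prod>i\<in>J. ennreal (state_prob p (X i)))"
    using X by (intro prod.cong) (auto simp: emeasure_point_measure_finite)
  also have "\<dots> = ennreal (\<Prod>i\<in>J. state_prob p (X i))"
    using p by (intro prod_ennreal) auto
  finally show ?thesis
    using p by (auto simp: measure_def intro!: enn2real_ennreal prod_nonneg)
qed

lemma single_site_sets:
  assumes "i \<in> S"
  shows "{\<omega>\<in>space (bernoulli_percolation S p). \<omega> i = v} \<in> sets (bernoulli_percolation S p)"
  unfolding bernoulli_percolation_def using assms
  by (intro sets_Collect_single') (auto simp: sets_point_measure space_point_measure)

lemma random_subset_bernoulli:
  "random_subset (bernoulli_percolation S p) S (sites_in_state S v)"
  using single_site_sets[of _ S p v] by (auto simp: random_subset_def)

lemma inclusion_prob_bernoulli: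
  assumes p: "p \<in> {0..1}" and F: "finite F" "F \<subseteq> S" "f \<in> S - F" "B \<subseteq> F"
  shows "measure (bernoulli_percolation S p)
      {\<omega>\<in>space (bernoulli_percolation S p). f \<in> sites_in_state S 1 \<omega> \<and> sites_in_state S 1 \<omega> \<inter> F = B}
    = p * measure (bernoulli_percolation S p)
      {\<omega>\<in>space (bernoulli_percolation S p). sites_in_state S 1 \<omega> \<inter> F = B}"
proof -
  let ?N = "bernoulli_percolation S p"
  define X :: "'a \<Rightarrow> int" where "X i = (if i \<in> insert f B then 1 else - 1)" for i
  have state: "\<omega> i = 1 \<or> \<omega> i = - 1" if "\<omega> \<in> space ?N" "i \<in> S" for \<omega> i
    using that by (auto simp: space_bernoulli dest: PiE_mem)
  have *: "(sites_in_state S 1 \<omega> \<inter> F = B) \<longleftrightarrow> (\<forall>i\<in>F. \<omega> i = X i)" if "\<omega> \<in> space ?N" for \<omega>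
    using state[OF that] F by (fastforce simp: X_def split: if_splits)
  have 1: "{\<omega>\<in>space ?N. sites_in_state S 1 \<omega> \<inter> F = B} = {\<omega>\<in>space ?N. \<forall>i\<in>F. \<omega> i = X i}"
    using * by auto
  have 2: "{\<omega>\<in>space ?N. f \<in> sites_in_state S 1 \<omega> \<and> sites_in_state S 1 \<omega> \<inter> F = B}
      = {\<omega>\<in>space ?N. \<forall>i\<in>insert f F. \<omega> i = X i}"
  proof -
    have "(\<forall>i\<in>insert f F. \<omega> i = X i) \<longleftrightarrow> f \<in> sites_in_state S 1 \<omega> \<and> (\<forall>i\<in>F. \<omega> i = X i)" for \<omega>
      using F by (simp add: X_def)
    then show ?thesis using * by (intro Collect_cong) (simp only: cong: conj_cong)
  qed
  have "measure ?N {\<omega>\<in>space ?N. \<forall>i\<in>insert f F. \<omega> i = X i} = p * (\<Prod>i\<in>F. state_prob p (X i))"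
    using F by (subst measure_bernoulli_cylinder[OF p]) (auto simp: X_def)
  moreover have "measure ?N {\<omega>\<in>space ?N. \<forall>i\<in>F. \<omega> i = X i} = (\<Prod>i\<in>F. state_prob p (X i))"
    using F by (subst measure_bernoulli_cylinder[OF p]) (auto simp: X_def)
  ultimately show ?thesis unfolding 1 2 by simp
qed

lemma inclusion_prob_le_bernoulli:
  assumes "p \<in> {0..1}" "p \<le> r"
  shows "inclusion_prob_le (bernoulli_percolation S p) S (sites_in_state S 1) r"
  unfolding inclusion_prob_le_def
proof (intro allI impI)
  fix F B :: "'a set" and f
  assume F: "finite F" "F \<subseteq> S" "f \<in> S - F" "B \<subseteq> F"
  show "measure (bernoulli_percolation S p)
      {\<omega>\<in>space (bernoulli_percolation S p). f \<in> sites_in_state S 1 \<omega> \<and> sites_in_state S 1 \<omega> \<inter> F = B}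
    \<le> r * measure (bernoulli_percolation S p)
      {\<omega>\<in>space (bernoulli_percolation S p). sites_in_state S 1 \<omega> \<inter> F = B}"
    unfolding inclusion_prob_bernoulli[OF assms(1) F] using assms(2) by (rule mult_right_mono) simp
qed

lemma inclusion_prob_ge_bernoulli:
  assumes "p \<in> {0..1}" "r \<le> p"
  shows "inclusion_prob_ge (bernoulli_percolation S p) S (sites_in_state S 1) r"
  unfolding inclusion_prob_ge_def
proof (intro allI impI)
  fix F B :: "'a set" and f
  assume F: "finite F" "F \<subseteq> S" "f \<in> S - F" "B \<subseteq> F"
  show "r * measure (bernoulli_percolation S p)
      {\<omega>\<in>space (bernoulli_percolation S p). sites_in_state S 1 \<omega> \<inter> F = B}
    \<le> measure (bernoulli_percolation S p)
      {\<omega>\<in>space (bernoulli_percolation S p). f \<in> sites_in_state S 1 \<omega> \<and> sites_in_state S 1 \<omega> \<inter> F = B}"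
    unfolding inclusion_prob_bernoulli[OF assms(1) F] using assms(2) by (rule mult_right_mono) simp
qed

text \<open>What the theory of the critical point has to know about the event that there is an infinite cluster.
  An increasing event that is insensitive to closing a single site is insensitive to all finite
  modifications.\<close>

locale percolation_event =
  fixes S :: "'i set" and A :: "'i set \<Rightarrow> bool"
  assumes countable_sites: "countable S"
    and increasing: "increasing_event S A"
    and remove_site: "\<And>T i. i \<in> S \<Longrightarrow> A T \<Longrightarrow> A (T - {i})"
    and empty_fails: "\<not> A {}"
begin

lemma remove_finite:
  assumes "finite F" "F \<subseteq> S"
  shows "A (T - F) \<longleftrightarrow> A T"
proof
  show "A (T - F) \<Longrightarrow> A T" using increasing_event_mono[OF increasing, of "T - F" T] by auto
  show "A T \<Longrightarrow> A (T - F)"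
    using assms
  proof (induction F rule: finite_induct)
    case (insert x F)
    then have "A (T - F - {x})" by (intro remove_site) auto
    moreover have "T - F - {x} = T - insert x F" by auto
    ultimately show ?case by simp
  qed simp
qed

abbreviation occurs :: "('i \<Rightarrow> int) \<Rightarrow> bool" where
  "occurs \<omega> \<equiv> A (sites_in_state S 1 \<omega>)"

text \<open>By invariance under finite modifications, the event can be read off the configuration with the
  first \<open>n\<close> sites closed, for every \<open>n\<close>: it is a tail event of the independent site states.\<close>

lemma zero_one_law:
  assumes p: "p \<in> {0..1}"
  shows "percolation_prob S occurs p = 0 \<or> percolation_prob S occurs p = 1"
proof -
  let ?N = "bernoulli_percolation S p"
  interpret N: prob_space ?N by (rule prob_space_bernoulli[OF p])
  define U where "U n = {\<omega>\<in>space ?N. \<exists>i\<in>S. to_nat_on S i = n \<and> \<omega> i = 1}" for n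
  \<comment> \<open>The sites are enumerated by natural numbers; a number that names no site gives the empty event.\<close>
  have inj: "inj_on (to_nat_on S) S" using countable_sites by (rule inj_on_to_nat_on)
  have U: "U (to_nat_on S i) = {\<omega>\<in>space ?N. \<omega> i = 1}" if "i \<in> S" for i
    using that inj by (auto simp: U_def inj_on_def)
  have U': "U n = {}" if "n \<notin> to_nat_on S ` S" for n
    using that by (auto simp: U_def)
  have Uev: "U n \<in> N.events" for n
    using U U' single_site_sets[of _ S p 1] by (cases "n \<in> to_nat_on S ` S") auto
  have "N.indep_events U UNIV"
  proof (rule N.indep_eventsI)
    fix J :: "nat set" assume J: "finite J" "J \<noteq> {}"
    show "N.prob (\<Inter>n\<in>J. U n) = (\<Prod>n\<in>J. N.prob (U n))"
    proof (cases "J \<subseteq> to_nat_on S ` S")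
      case True
      then obtain F where F: "F \<subseteq> S" "J = to_nat_on S ` F" by (auto simp: subset_image_iff)
      have injF: "inj_on (to_nat_on S) F" using inj F inj_on_subset by blast
      have finF: "finite F" using J F injF finite_imageD by blast
      have single: "N.prob (U (to_nat_on S i)) = p" if "i \<in> F" for i
        using measure_bernoulli_cylinder[OF p, of "{i}" S "\<lambda>_. 1"] that F U[of i] by auto
      have "(\<Inter>n\<in>J. U n) = {\<omega>\<in>space ?N. \<forall>i\<in>F. \<omega> i = 1}"
        using J F U by (auto simp: subset_iff)
      then have "N.prob (\<Inter>n\<in>J. U n) = (\<Prod>i\<in>F. p)"
        using measure_bernoulli_cylinder[OF p finF F(1), of "\<lambda>_. 1"] by simp
      also have "\<dots> = (\<Prod>n\<in>J. N.prob (U n))"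
        unfolding F(2) using single by (subst prod.reindex[OF injF]) simp
      finally show ?thesis .
    next
      case False
      then obtain n where "n \<in> J" "U n = {}" using U' by blast
      then have "(\<Inter>n\<in>J. U n) = {}" "\<exists>n\<in>J. N.prob (U n) = 0"
        by (auto intro!: bexI[of _ n])
      then have "(\<Prod>n\<in>J. N.prob (U n)) = 0" using J(1) by (intro prod_zero)
      then show ?thesis unfolding \<open>(\<Inter>n\<in>J. U n) = {}\<close> by simp
    qed
  qed (rule Uev)
  then have ind: "N.indep_sets (\<lambda>i. sigma_sets (space ?N) {U i}) UNIV"
    unfolding N.indep_events_def_alt by (rule N.indep_sets_sigma) (simp add: Int_stable_def)
  have "{\<omega>\<in>space ?N. occurs \<omega>} \<in> N.tail_events (\<lambda>i. sigma_sets (space ?N) {U i})"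
    unfolding N.tail_events_def
  proof
    fix n
    let ?G = "\<Union>i\<in>{n..}. sigma_sets (space ?N) {U i}"
    have sub: "?G \<subseteq> Pow (space ?N)"
    proof (rule UN_least)
      fix i
      have "{U i} \<subseteq> Pow (space ?N)" by (auto simp: U_def)
      show "sigma_sets (space ?N) {U i} \<subseteq> Pow (space ?N)"
        by (intro subsetI PowI sigma_sets_into_sp[OF \<open>{U i} \<subseteq> _\<close>])
    qed
    define F where "F = {i\<in>S. to_nat_on S i < n}"
    have "to_nat_on S ` F \<subseteq> {..<n}" "inj_on (to_nat_on S) F"
      using inj by (auto simp: F_def inj_on_def)
    then have finF: "finite F" using finite_imageD finite_subset by (metis finite_lessThan)
    have "random_subset (sigma (space ?N) ?G) S (\<lambda>\<omega>. sites_in_state S 1 \<omega> - F)"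
      unfolding random_subset_def
    proof safe
      fix i assume i: "i \<in> S"
      show "{\<omega> \<in> space (sigma (space ?N) ?G). i \<in> sites_in_state S 1 \<omega> - F}
          \<in> sets (sigma (space ?N) ?G)"
      proof (cases "i \<in> F")
        case False
        then have "{\<omega> \<in> space (sigma (space ?N) ?G). i \<in> sites_in_state S 1 \<omega> - F} = U (to_nat_on S i)"
          using i U by (auto simp: space_measure_of_conv)
        moreover have "U (to_nat_on S i) \<in> ?G"
          using False i by (auto simp: F_def intro!: bexI[of _ "to_nat_on S i"] sigma_sets.Basic)
        ultimately show ?thesis using sub by (auto simp: sets_measure_of)
      qed auto
    qed
    from increasing_event_sets[OF increasing this]
    have "{\<omega>\<in>space ?N. A (sites_in_state S 1 \<omega> - F)} \<in> sigma_sets (space ?N) ?G"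
      using sub by (simp add: space_measure_of_conv sets_measure_of)
    moreover have "A (sites_in_state S 1 \<omega> - F) = occurs \<omega>" for \<omega>
      by (rule remove_finite[OF finF]) (auto simp: F_def)
    ultimately show "{\<omega>\<in>space ?N. occurs \<omega>} \<in> sigma_sets (space ?N) ?G" by simp
  qed
  then show ?thesis
    unfolding percolation_prob_def
    using ind Uev sets.sets_into_space
    by (intro N.kolmogorov_0_1_law[where A="\<lambda>i. sigma_sets (space ?N) {U i}"])
      (auto intro!: sigma_algebra_sigma_sets)
qed

lemma percolation_prob_mono:
  assumes "p \<in> {0..1}" "p' \<in> {0..1}" "p \<le> p'"
  shows "percolation_prob S occurs p \<le> percolation_prob S occurs p'"
  unfolding percolation_prob_def
  using assms
  by (intro domination[where r=p, OF _ _ _ _ _ _ _ _ increasing]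
      prob_space_bernoulli random_subset_bernoulli inclusion_prob_le_bernoulli inclusion_prob_ge_bernoulli) auto

lemma percolation_prob_0: "percolation_prob S occurs 0 = 0"
proof -
  let ?N = "bernoulli_percolation S 0"
  interpret N: prob_space ?N by (rule prob_space_bernoulli) simp
  have "AE \<omega> in ?N. \<forall>i\<in>S. \<omega> i \<noteq> 1"
  proof (subst AE_ball_countable[OF countable_sites], intro ballI)
    fix i assume i: "i \<in> S"
    have "N.prob {\<omega>\<in>space ?N. \<omega> i = 1} = 0"
      using measure_bernoulli_cylinder[of 0 "{i}" S "\<lambda>_. 1"] i by simp
    then have "AE \<omega> in ?N. \<omega> \<notin> {\<omega>\<in>space ?N. \<omega> i = 1}"
      using N.prob_eq_0[OF single_site_sets[OF i]] by simp
    then show "AE \<omega> in ?N. \<omega> i \<noteq> 1" by (rule AE_mp) (auto intro!: AE_I2)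
  qed
  then have "AE \<omega> in ?N. \<not> occurs \<omega>"
  proof (rule AE_mp, intro AE_I2 impI)
    fix \<omega> :: "'i \<Rightarrow> int" assume "\<forall>i\<in>S. \<omega> i \<noteq> 1"
    then have "sites_in_state S 1 \<omega> = {}" by auto
    then show "\<not> occurs \<omega>" using empty_fails by (simp only: not_False_eq_True)
  qed
  then have "AE \<omega> in ?N. \<omega> \<notin> {\<omega>\<in>space ?N. occurs \<omega>}"
    by (rule AE_mp) (auto intro!: AE_I2)
  then show ?thesis
    unfolding percolation_prob_def
    using N.prob_eq_0[OF increasing_event_sets[OF increasing random_subset_bernoulli]] by simp
qed

text \<open>The percolation probability is nondecreasing in \<open>p\<close> by domination, takes only the values \<open>0\<close> and \<open>1\<close>,
  and vanishes at \<open>0\<close>. The supremum of its zeros is therefore a threshold, and a threshold is unique because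
  between two different ones the probability would have to be both \<open>0\<close> and \<open>1\<close>.\<close>

lemma critical_point_threshold:
  assumes p: "p \<in> {0..1}"
  shows "p < critical_point S occurs \<Longrightarrow> percolation_prob S occurs p = 0"
    and "critical_point S occurs < p \<Longrightarrow> percolation_prob S occurs p = 1"
    and "critical_point S occurs \<in> {0..1}"
proof -
  let ?\<theta> = "percolation_prob S occurs"
  define C where "C pc \<longleftrightarrow> pc \<in> {0..1} \<and>
    (\<forall>p\<in>{0..1}. (p < pc \<longrightarrow> ?\<theta> p = 0) \<and> (pc < p \<longrightarrow> ?\<theta> p = 1))" for pc
  let ?Z = "{p\<in>{0..1}. ?\<theta> p = 0}"
  have "0 \<in> ?Z" using percolation_prob_0 by simp
  then have Z: "?Z \<noteq> {}" "bdd_above ?Z" by blast (rule bdd_aboveI[of _ 1], simp)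
  define z where "z = Sup ?Z"
  have z_upper: "p \<le> z" if "p \<in> ?Z" for p using cSup_upper[OF that Z(2)] by (simp add: z_def)
  have "z \<le> 1" unfolding z_def by (rule cSup_least[OF Z(1)]) simp
  have below: "?\<theta> p = 0" if p: "p \<in> {0..1}" "p < z" for p
  proof -
    obtain p' where p': "p' \<in> ?Z" "p < p'"
      using less_cSup_iff[OF Z] p(2) unfolding z_def by blast
    then have "?\<theta> p \<le> ?\<theta> p'" using p by (intro percolation_prob_mono) auto
    moreover have "0 \<le> ?\<theta> p" by (simp add: percolation_prob_def)
    ultimately show ?thesis using p' by simp
  qed
  have above: "?\<theta> p = 1" if p: "p \<in> {0..1}" "z < p" for p
  proof -
    have "p \<notin> ?Z" using z_upper[of p] p(2) by linarith
    then show ?thesis using p zero_one_law[OF p(1)] by blast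
  qed
  have "0 \<le> z" by (rule z_upper) fact
  then have "C z" unfolding C_def using \<open>z \<le> 1\<close> below above by simp
  moreover have "x = y" if xy: "C x" "C y" for x y
  proof -
    have False if ab: "C a" "C b" "a < b" for a b
    proof -
      define m where "m = (a + b) / 2"
      have "m \<in> {0..1}" "a < m" "m < b" using ab by (auto simp: m_def C_def)
      then have "?\<theta> m = 0" "?\<theta> m = 1" using ab unfolding C_def by blast+
      then show False by simp
    qed
    then show ?thesis using xy linorder_neqE by blast
  qed
  ultimately have "C (THE pc. C pc)" by (metis theI)
  moreover have "(THE pc. C pc) = critical_point S occurs"
    unfolding critical_point_def C_def ..
  ultimately have C: "C (critical_point S occurs)" by (simp only:)
  from C p show "p < critical_point S occurs \<Longrightarrow> ?\<theta> p = 0" unfolding C_def by blast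
  from C p show "critical_point S occurs < p \<Longrightarrow> ?\<theta> p = 1" unfolding C_def by blast
  from C show "critical_point S occurs \<in> {0..1}" unfolding C_def by blast
qed

text \<open>Away from the critical point the parameter can be worsened a little without changing the value of the
  percolation probability. The room gained here absorbs the changes that happen during a short time.\<close>

lemma subcritical_margin:
  assumes p: "p \<in> {0..1}" "p \<noteq> critical_point S occurs" and 0: "percolation_prob S occurs p = 0"
  obtains p' where "p < p'" "p' \<le> 1" "percolation_prob S occurs p' = 0"
proof -
  let ?c = "critical_point S occurs"
  have "p < ?c" using critical_point_threshold(2)[OF p(1)] 0 p(2) by force
  then show thesis
    using critical_point_threshold(1)[of "(p + ?c) / 2"] critical_point_threshold(3)[OF p(1)] p(1)
    by (intro that[of "(p + ?c) / 2"]) auto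
qed

lemma supercritical_margin:
  assumes p: "p \<in> {0..1}" "p \<noteq> critical_point S occurs" and 1: "percolation_prob S occurs p = 1"
  obtains p' where "0 \<le> p'" "p' < p" "percolation_prob S occurs p' = 1"
proof -
  let ?c = "critical_point S occurs"
  have "?c < p" using critical_point_threshold(1)[OF p(1)] 1 p(2) by force
  then show thesis
    using critical_point_threshold(2)[of "(p + ?c) / 2"] critical_point_threshold(3)[OF p(1)] p(1)
    by (intro that[of "(p + ?c) / 2"]) auto
qed

end


section \<open>Clusters of bond and site percolation\<close>

text \<open>A common frame for bond and site percolation: \<open>cl T v\<close> is the cluster of the vertex \<open>v\<close> when the open
  objects are those in \<open>T\<close>. Closing one object breaks a cluster into finitely many pieces; the finite
  set \<open>D\<close> collects what is lost and one vertex of each piece.\<close>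

locale cluster_system =
  fixes S :: "'i set" and V :: "'v set" and cl :: "'i set \<Rightarrow> 'v \<Rightarrow> 'v set"
  assumes countable_S: "countable S" and countable_V: "countable V"
    and cl_mono: "\<And>T T' v. T \<subseteq> T' \<Longrightarrow> cl T v \<subseteq> cl T' v"
    and cl_finite_character: "\<And>T v w. w \<in> cl T v \<Longrightarrow> \<exists>B. finite B \<and> B \<subseteq> T \<inter> S \<and> w \<in> cl B v"
    and cl_remove: "\<And>i. i \<in> S \<Longrightarrow> \<exists>D. finite D \<and> D \<subseteq> V \<and>
      (\<forall>T. \<forall>v\<in>V. cl T v \<subseteq> D \<union> (\<Union>y\<in>insert v D. cl (T - {i}) y))"
    and cl_empty: "\<And>v. finite (cl {} v)"
begin

definition has_infinite_cluster :: "'i set \<Rightarrow> bool" where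
  "has_infinite_cluster T \<longleftrightarrow> (\<exists>v\<in>V. infinite (cl T v))"

text \<open>There is an infinite cluster iff for some \<open>k\<close> and all \<open>n\<close>, one of the first \<open>k\<close> vertices has at least \<open>n\<close>
  vertices in its cluster, and the latter is already visible in a finite window. The existential
  quantifier over the vertices is restricted to finitely many of them so that it can be exchanged with
  the one over \<open>n\<close>, which makes every limit monotone.\<close>

lemma increasing_event_has_infinite_cluster: "increasing_event S has_infinite_cluster"
proof -
  define F where "F m = {i\<in>S. to_nat_on S i < m}" for m
  define U where "U k = {v\<in>V. to_nat_on V v < k}" for k
  have fin: "finite {i\<in>X. to_nat_on X i < m}" if "countable X" for m and X :: "'x set"
  proof -
    have "inj_on (to_nat_on X) {i\<in>X. to_nat_on X i < m}"
      using inj_on_to_nat_on[OF that] by (auto simp: inj_on_def)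
    moreover have "to_nat_on X ` {i\<in>X. to_nat_on X i < m} \<subseteq> {..<m}" by auto
    ultimately show ?thesis using finite_imageD finite_subset by (metis finite_lessThan)
  qed
  have finF: "finite (F m)" and subF: "F m \<subseteq> S" for m using fin[OF countable_S] by (auto simp: F_def)
  have finU: "finite (U k)" for k using fin[OF countable_V] by (auto simp: U_def)
  define Q where "Q k n B \<longleftrightarrow> (\<exists>v\<in>U k. \<exists>X. X \<subseteq> cl B v \<and> finite X \<and> card X = n)" for k n B
  have Qmono: "Q k n B'" if Q: "Q k n B" "B \<subseteq> B'" for k n B B'
  proof -
    obtain v X where "v \<in> U k" "X \<subseteq> cl B v" "finite X" "card X = n" using Q(1) by (auto simp: Q_def)
    moreover from this have "X \<subseteq> cl B' v" using cl_mono[OF Q(2), of v] by (meson order_trans)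
    ultimately show ?thesis by (auto simp: Q_def)
  qed
  have "increasing_event S (\<lambda>T. \<exists>k. \<forall>n. \<exists>m. Q k n (T \<inter> F m))"
  proof (intro increasing_event.union increasing_event.inter)
    show "increasing_event S (\<lambda>T. Q k n (T \<inter> F m))" for k n m
      using finF subF Qmono by (intro increasing_event.cylinder) (auto intro!: monoI)
    show "Q k n (T \<inter> F m) \<Longrightarrow> Q k n (T \<inter> F (Suc m))" for k n m T
      by (erule Qmono) (auto simp: F_def)
    show "\<exists>m. Q k n (T \<inter> F m)" if Q: "\<exists>m. Q k (Suc n) (T \<inter> F m)" for k n T
    proof -
      obtain m v X where X: "v \<in> U k" "X \<subseteq> cl (T \<inter> F m) v" "finite X" "card X = Suc n"
        using Q by (auto simp: Q_def)
      then obtain x Y where "X = insert x Y" "card Y = n" by (meson card_Suc_eq)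
      then have "Y \<subseteq> cl (T \<inter> F m) v" "finite Y" "card Y = n" using X by auto
      then show ?thesis using X(1) unfolding Q_def by blast
    qed
    show "\<forall>n. \<exists>m. Q (Suc k) n (T \<inter> F m)" if "\<forall>n. \<exists>m. Q k n (T \<inter> F m)" for k T
    proof -
      have "U k \<subseteq> U (Suc k)" by (auto simp: U_def)
      then show ?thesis using that unfolding Q_def by (meson subsetD)
    qed
  qed
  moreover have "(\<exists>k. \<forall>n. \<exists>m. Q k n (T \<inter> F m)) \<longleftrightarrow> has_infinite_cluster T" for T
  proof
    assume "\<exists>k. \<forall>n. \<exists>m. Q k n (T \<inter> F m)"
    then obtain k where k: "\<And>n. \<exists>m. Q k n (T \<inter> F m)" by blast
    have "\<exists>v\<in>U k. infinite (cl T v)"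
    proof (rule ccontr)
      \<comment> \<open>If all of these finitely many clusters were finite, none could have more vertices than their sizes add up to.\<close>
      assume "\<not> ?thesis"
      then have finite_cl: "\<And>v. v \<in> U k \<Longrightarrow> finite (cl T v)" by blast
      obtain m where "Q k (Suc (\<Sum>v\<in>U k. card (cl T v))) (T \<inter> F m)" using k by blast
      then have "Q k (Suc (\<Sum>v\<in>U k. card (cl T v))) T" by (rule Qmono) auto
      then obtain v X where v: "v \<in> U k" "X \<subseteq> cl T v" "card X = Suc (\<Sum>v\<in>U k. card (cl T v))"
        unfolding Q_def by blast
      have "card X \<le> card (cl T v)" using v finite_cl by (intro card_mono) auto
      also have "\<dots> \<le> (\<Sum>v\<in>U k. card (cl T v))" using v finU by (intro member_le_sum) auto
      finally show False using v by simp
    qed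
    then show "has_infinite_cluster T" unfolding has_infinite_cluster_def by (auto simp: U_def)
  next
    assume "has_infinite_cluster T"
    then obtain v where v: "v \<in> V" "infinite (cl T v)" unfolding has_infinite_cluster_def by blast
    have "\<exists>m. Q (Suc (to_nat_on V v)) n (T \<inter> F m)" for n
    proof -
      obtain X where X: "X \<subseteq> cl T v" "finite X" "card X = n"
        using infinite_arbitrarily_large[OF v(2)] by metis
      have "\<forall>w\<in>X. \<exists>B. finite B \<and> B \<subseteq> T \<inter> S \<and> w \<in> cl B v"
        using X(1) by (intro ballI cl_finite_character) (rule subsetD)
      from bchoice[OF this]
      obtain B where B: "\<And>w. w \<in> X \<Longrightarrow> finite (B w) \<and> B w \<subseteq> T \<inter> S \<and> w \<in> cl (B w) v" by blast
      define C where "C = (\<Union>w\<in>X. B w)"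
      have C: "finite C" "C \<subseteq> T" "C \<subseteq> S" using B X by (auto simp: C_def)
      define m where "m = Suc (Max (insert 0 (to_nat_on S ` C)))"
      have "C \<subseteq> F m" using C by (auto simp: F_def m_def less_Suc_eq_le)
      have "X \<subseteq> cl (T \<inter> F m) v"
      proof
        fix w assume w: "w \<in> X"
        then have "B w \<subseteq> T \<inter> F m" using C \<open>C \<subseteq> F m\<close> by (auto simp: C_def)
        from cl_mono[OF this, of v] show "w \<in> cl (T \<inter> F m) v" using B[OF w] by blast
      qed
      moreover have "v \<in> U (Suc (to_nat_on V v))" using v by (simp add: U_def)
      ultimately show ?thesis using X unfolding Q_def by blast
    qed
    then show "\<exists>k. \<forall>n. \<exists>m. Q k n (T \<inter> F m)" by blast
  qed
  then have "(\<lambda>T. \<exists>k. \<forall>n. \<exists>m. Q k n (T \<inter> F m)) = has_infinite_cluster" by (rule ext)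
  ultimately show ?thesis by (simp only:)
qed

sublocale percolation_event S has_infinite_cluster
proof
  show "countable S" by (rule countable_S)
  show "increasing_event S has_infinite_cluster" by (rule increasing_event_has_infinite_cluster)
  show "\<not> has_infinite_cluster {}" using cl_empty by (simp add: has_infinite_cluster_def)
  fix T i assume i: "i \<in> S" and "has_infinite_cluster T"
  then obtain v where v: "v \<in> V" "infinite (cl T v)" by (auto simp: has_infinite_cluster_def)
  obtain D where D: "finite D" "D \<subseteq> V" "cl T v \<subseteq> D \<union> (\<Union>y\<in>insert v D. cl (T - {i}) y)"
    using cl_remove[OF i] v by meson
  then have "\<exists>y\<in>insert v D. infinite (cl (T - {i}) y)"
    using v finite_subset by (metis finite_UN_I finite_Un finite_insert)
  then show "has_infinite_cluster (T - {i})" using v D by (auto simp: has_infinite_cluster_def)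
qed

end

lemma joined_mono: "E \<subseteq> E' \<Longrightarrow> joined E \<subseteq> joined E'"
  unfolding joined_def by (intro rtrancl_mono) auto

lemma joined_finite_subset:
  assumes "(v, w) \<in> joined E"
  shows "\<exists>B. finite B \<and> B \<subseteq> E \<and> (v, w) \<in> joined B"
  using assms unfolding joined_def
proof (induction rule: rtrancl_induct)
  case base
  then show ?case by (intro exI[of _ "{}"]) auto
next
  case (step y z)
  then obtain B where B: "finite B" "B \<subseteq> E" "(v, y) \<in> joined B" by (auto simp: joined_def)
  have "(v, y) \<in> joined (insert {y, z} B)" using B joined_mono[of B "insert {y, z} B"] by auto
  then have "(v, z) \<in> joined (insert {y, z} B)"
    unfolding joined_def by (rule rtrancl.rtrancl_into_rtrancl) simp
  then show ?case using B step(2) unfolding joined_def by (intro exI[of _ "insert {y, z} B"]) auto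
qed

text \<open>The last part of a path, after its last use of the removed edge, starts at an end of that edge.\<close>

lemma joined_remove_edge:
  assumes "(v, w) \<in> joined E"
  shows "\<exists>y\<in>insert v e. (y, w) \<in> joined (E - {e})"
  using assms unfolding joined_def
proof (induction rule: rtrancl_induct)
  case (step y z)
  show ?case
  proof (cases "{y, z} = e")
    case True then show ?thesis by (intro bexI[of _ z]) auto
  next
    case False then show ?thesis using step by (auto intro: rtrancl.rtrancl_into_rtrancl)
  qed
qed auto

text \<open>Intersecting with \<open>E\<close> makes the cluster depend only on the part of \<open>T\<close> inside the graph, as a cluster
  system requires.\<close>

definition bond_cluster :: "'v set \<Rightarrow> 'v set set \<Rightarrow> 'v set set \<Rightarrow> 'v \<Rightarrow> 'v set" where
  "bond_cluster V E T v = {w\<in>V. (v, w) \<in> joined (T \<inter> E)}"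

lemma countable_edges:
  assumes "simple_graph V E" "countable V" shows "countable E"
proof -
  have "E \<subseteq> {F. finite F \<and> F \<subseteq> V}"
    using assms(1) by (auto simp: simple_graph_def intro: card_ge_0_finite)
  then show ?thesis using countable_Collect_finite_subset[OF assms(2)] countable_subset by blast
qed

lemma cluster_system_bond:
  assumes "simple_graph V E" "countable V"
  shows "cluster_system E V (bond_cluster V E)"
proof
  show "countable E" by (rule countable_edges[OF assms])
  show "countable V" by fact
  show "bond_cluster V E T v \<subseteq> bond_cluster V E T' v" if "T \<subseteq> T'" for T T' v
    using joined_mono[of "T \<inter> E" "T' \<inter> E"] that by (auto simp: bond_cluster_def)
  show "\<exists>B. finite B \<and> B \<subseteq> T \<inter> E \<and> w \<in> bond_cluster V E B v" if w: "w \<in> bond_cluster V E T v" for T v w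
  proof -
    obtain B where "finite B" "B \<subseteq> T \<inter> E" "(v, w) \<in> joined B"
      using w joined_finite_subset[of v w "T \<inter> E"] by (auto simp: bond_cluster_def)
    moreover from this have "B \<inter> E = B" by auto
    ultimately show ?thesis using w by (intro exI[of _ B]) (simp add: bond_cluster_def)
  qed
  show "finite (bond_cluster V E {} v)" for v
    by (rule finite_subset[of _ "{v}"]) (auto simp: bond_cluster_def joined_def)
  fix e assume e: "e \<in> E"
  have "bond_cluster V E T v \<subseteq> (\<Union>y\<in>insert v e. bond_cluster V E (T - {e}) y)" for T v
  proof
    fix w assume "w \<in> bond_cluster V E T v"
    moreover have "T \<inter> E - {e} = (T - {e}) \<inter> E" by auto
    ultimately show "w \<in> (\<Union>y\<in>insert v e. bond_cluster V E (T - {e}) y)"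
      using joined_remove_edge[of v w "T \<inter> E" e] by (auto simp: bond_cluster_def)
  qed
  then show "\<exists>D. finite D \<and> D \<subseteq> V \<and>
      (\<forall>T. \<forall>v\<in>V. bond_cluster V E T v \<subseteq> D \<union> (\<Union>y\<in>insert v D. bond_cluster V E (T - {e}) y))"
    using e assms by (intro exI[of _ e]) (auto simp: simple_graph_def intro: card_ge_0_finite)
qed

lemma bond_percolates_iff:
  "bond_percolates V E \<omega> \<longleftrightarrow> (\<exists>v\<in>V. infinite (bond_cluster V E (sites_in_state E 1 \<omega>) v))"
proof -
  have "sites_in_state E 1 \<omega> \<inter> E = {e\<in>E. \<omega> e = 1}" by auto
  then show ?thesis
    by (auto simp: bond_percolates_def bond_clusters_def components_of_graph_def bond_cluster_def)
qed

definition site_cluster :: "'v set \<Rightarrow> 'v set set \<Rightarrow> 'v set \<Rightarrow> 'v \<Rightarrow> 'v set" where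
  "site_cluster V E T v = {w\<in>T \<inter> V. v \<in> T \<inter> V \<and> (v, w) \<in> joined {e\<in>E. e \<subseteq> T}}"

lemma site_cluster_step:
  assumes "w \<in> site_cluster V E T v" "{w, z} \<in> E" "z \<in> T" "z \<in> V"
  shows "z \<in> site_cluster V E T v"
proof -
  have "(w, z) \<in> {(u, v). {u, v} \<in> {e\<in>E. e \<subseteq> T}}"
    using assms by (auto simp: site_cluster_def)
  then show ?thesis
    using assms unfolding site_cluster_def joined_def by (auto intro: rtrancl.rtrancl_into_rtrancl)
qed

lemma site_cluster_mono:
  assumes "T \<subseteq> T'" shows "site_cluster V E T v \<subseteq> site_cluster V E T' v"
proof -
  have "joined {e\<in>E. e \<subseteq> T} \<subseteq> joined {e\<in>E. e \<subseteq> T'}" by (rule joined_mono) (use assms in auto)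
  then show ?thesis using assms by (auto simp: site_cluster_def)
qed

lemma site_cluster_induct [consumes 2, case_names start step]:
  assumes "w \<in> site_cluster V E T v" and "simple_graph V E"
    and "v \<in> T \<Longrightarrow> v \<in> V \<Longrightarrow> P v"
    and "\<And>y z. y \<in> T \<Longrightarrow> z \<in> T \<Longrightarrow> y \<in> V \<Longrightarrow> z \<in> V \<Longrightarrow> {y, z} \<in> E \<Longrightarrow> P y \<Longrightarrow> P z"
  shows "P w"
proof -
  have "(v, w) \<in> joined {e\<in>E. e \<subseteq> T}" "v \<in> T" "v \<in> V" using assms(1) by (auto simp: site_cluster_def)
  then show ?thesis
    unfolding joined_def
  proof (induction rule: rtrancl_induct)
    case (step y z)
    then show ?case using assms(2,4) by (auto simp: simple_graph_def)
  qed (use assms(3) in auto)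
qed

text \<open>Removing a vertex splits its cluster into at most as many pieces as it has neighbours, each piece
  containing one of them. Local finiteness makes their number finite.\<close>

lemma cluster_system_site:
  assumes G: "simple_graph V E" and "countable V" and "locally_finite V E"
  shows "cluster_system V V (site_cluster V E)"
proof
  show "countable V" by fact
  show "site_cluster V E T v \<subseteq> site_cluster V E T' v" if "T \<subseteq> T'" for T T' v
    using that by (rule site_cluster_mono)
  show "\<exists>B. finite B \<and> B \<subseteq> T \<inter> V \<and> w \<in> site_cluster V E B v" if "w \<in> site_cluster V E T v" for T v w
    using that G
  proof (induction rule: site_cluster_induct)
    case start
    then show ?case by (intro exI[of _ "{v}"]) (auto simp: site_cluster_def joined_def)
  next
    case (step y z)
    then obtain B where B: "finite B" "B \<subseteq> T \<inter> V" "y \<in> site_cluster V E B v" by blast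
    then have "y \<in> site_cluster V E (insert z B) v" using site_cluster_mono[of B "insert z B" V E v] by blast
    then show ?case using B step site_cluster_step[of y V E "insert z B" v z]
      by (intro exI[of _ "insert z B"]) auto
  qed
  show "finite (site_cluster V E {} v)" for v by (simp add: site_cluster_def)
  fix i assume i: "i \<in> V"
  define D where "D = insert i (\<Union>{e\<in>E. i \<in> e})"
  have "finite (\<Union>{e\<in>E. i \<in> e})"
    using assms i by (auto simp: locally_finite_def simple_graph_def intro!: finite_Union intro: card_ge_0_finite)
  then have "finite D" by (simp add: D_def)
  moreover have "D \<subseteq> V" using G i by (auto simp: D_def simple_graph_def)
  moreover have "site_cluster V E T v \<subseteq> D \<union> (\<Union>y\<in>insert v D. site_cluster V E (T - {i}) y)" for T v
  proof
    fix w assume "w \<in> site_cluster V E T v"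
    then show "w \<in> D \<union> (\<Union>y\<in>insert v D. site_cluster V E (T - {i}) y)"
      using G
    proof (induction rule: site_cluster_induct)
      case start
      then show ?case by (cases "v = i") (auto simp: D_def site_cluster_def joined_def)
    next
      case (step y z)
      show ?case
      proof (cases "z \<in> D")
        case False
        then have 3: "z \<noteq> i" "y \<noteq> i" using step(5) by (auto simp: D_def)
        show ?thesis
        proof (cases "y \<in> D")
          case True
          have y: "y \<in> site_cluster V E (T - {i}) y"
            using step.hyps 3 by (simp add: site_cluster_def joined_def)
          have "z \<in> site_cluster V E (T - {i}) y"
            by (rule site_cluster_step[OF y]) (use step.hyps 3 in auto)
          then show ?thesis using True by blast
        next
          case False
          then obtain u where u: "u \<in> insert v D" "y \<in> site_cluster V E (T - {i}) u"
            using step.IH by blast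
          have "z \<in> site_cluster V E (T - {i}) u"
            by (rule site_cluster_step[OF u(2)]) (use step.hyps 3 in auto)
          then show ?thesis using u(1) by blast
        qed
      qed simp
    qed
  qed
  ultimately show "\<exists>D. finite D \<and> D \<subseteq> V \<and>
      (\<forall>T. \<forall>v\<in>V. site_cluster V E T v \<subseteq> D \<union> (\<Union>y\<in>insert v D. site_cluster V E (T - {i}) y))"
    by (intro exI[of _ D] conjI allI ballI)
qed

lemma site_percolates_iff:
  assumes "simple_graph V E"
  shows "site_percolates V E \<omega> \<longleftrightarrow> (\<exists>v\<in>V. infinite (site_cluster V E (sites_in_state V 1 \<omega>) v))"
proof -
  let ?T = "sites_in_state V 1 \<omega>"
  have "{e\<in>E. e \<subseteq> ?T} = {e\<in>E. \<forall>v\<in>e. \<omega> v = 1}"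
    using assms by (auto simp: simple_graph_def)
  then have *: "site_cluster V E ?T v = {w\<in>?T. v \<in> ?T \<and> (v, w) \<in> joined {e\<in>E. \<forall>v\<in>e. \<omega> v = 1}}" for v
    by (auto simp: site_cluster_def)
  show ?thesis
    unfolding site_percolates_def site_clusters_def components_of_graph_def *
    by (auto intro: rev_finite_subset)
qed

section \<open>Following the exchanges\<close>

text \<open>Uniqueness of the exchange dynamics is a local matter: it holds as soon as no site takes part in two
  exchanges at the same time. At every time \<open>carried\<close> is then a partial injection, even if infinitely
  many exchanges accumulate. Existence, in contrast, requires a global argument.\<close>

locale exchange_times =
  fixes S :: "'i set" and R :: "'i set \<Rightarrow> real set"
  assumes times_pos: "\<And>f g t. f \<in> S \<Longrightarrow> g \<in> S - {f} \<Longrightarrow> t \<in> R {f, g} \<Longrightarrow> 0 < t"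
    and no_coincidence: "\<And>f g h t. f \<in> S \<Longrightarrow> g \<in> S - {f} \<Longrightarrow> h \<in> S - {f} \<Longrightarrow>
      t \<in> R {f, g} \<Longrightarrow> t \<in> R {f, h} \<Longrightarrow> g = h"
begin

abbreviation quiet :: "'i \<Rightarrow> real set \<Rightarrow> bool" where
  "quiet f I \<equiv> \<forall>h\<in>S - {f}. R {f, h} \<inter> I = {}"

lemma quietD: "quiet f I \<Longrightarrow> g \<in> S - {f} \<Longrightarrow> t \<in> R {f, g} \<Longrightarrow> t \<notin> I"
  by blast

lemma quiet_subset: "quiet f I \<Longrightarrow> J \<subseteq> I \<Longrightarrow> quiet f J"
  by blast

lemma carried_sites:
  assumes "carried S R e t f" shows "e \<in> S" "f \<in> S" "0 \<le> t"
  using assms by induction auto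

lemma carried_stay: "carried S R e s f \<Longrightarrow> s \<le> t \<Longrightarrow> quiet f {s<..t} \<Longrightarrow> carried S R e t f"
  by (rule carried.stay)

lemma carried_back_quiet:
  assumes "carried S R e t f" "0 \<le> s" "s \<le> t" "quiet f {s<..t}"
  shows "carried S R e s f"
  using assms
proof induction
  case start
  then show ?case using carried.start[of e S R] by simp
next
  case (stay u f t)
  show ?case
  proof (cases "u \<le> s")
    case True
    then show ?thesis using stay by (intro carried_stay[OF stay.hyps(1)] quiet_subset[OF stay.hyps(3)]) auto
  next
    case False
    then show ?thesis using stay by (intro stay.IH quiet_subset[OF stay.prems(3)]) auto
  qed
next
  case (exchange u f t g)
  show ?case
  proof (cases "s = t")
    case True then show ?thesis using exchange carried.exchange[of S R e u f t g] by blast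
  next
    case False
    then have "t \<in> R {g, f} \<inter> {s<..t}" using exchange by (auto simp: insert_commute)
    moreover have "f \<in> S - {g}" using exchange carried_sites by blast
    ultimately show ?thesis using exchange.prems by blast
  qed
qed

lemma carried_before_exchange:
  assumes "carried S R e t g" "f \<in> S - {g}" "t \<in> R {f, g}"
  shows "\<exists>s<t. carried S R e s f \<and> quiet f {s<..<t}"
  using assms
proof induction
  case start
  then show ?case using times_pos[of f e 0] by auto
next
  case (stay u g t)
  have "t \<in> R {g, f}" using stay by (simp add: insert_commute)
  then have "u = t" using stay.hyps(2,3) stay.prems by force
  then show ?case using stay by blast
next
  case (exchange u h t g)
  then have "g \<in> S" "h \<in> S" "h \<in> S - {g}" using carried_sites by blast+
  then have "h = f" using exchange no_coincidence[of g h f t] by (simp add: insert_commute)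
  then show ?case using exchange by blast
qed

text \<open>Both derivations are run backwards in parallel: the last exchange at the common position is
  the same for both, so both come from the same site just before it.\<close>

lemma carried_inj:
  assumes "carried S R e t f" "carried S R e' t f"
  shows "e = e'"
  using assms
proof (induction arbitrary: e')
  case start
  have "carried S R e' t f \<Longrightarrow> t = 0 \<Longrightarrow> f = e'" for t f
  proof (induction rule: carried.induct)
    case (stay s f t)
    then show ?case using carried_sites(3)[of e' s f] by auto
  next
    case (exchange s f t g)
    then show ?case using carried_sites(3)[of e' s f] by auto
  qed simp
  then show ?case using start by blast
next
  case (stay s f t)
  have "carried S R e' s f"
    by (rule carried_back_quiet[OF stay.prems carried_sites(3)[OF stay.hyps(1)] stay.hyps(2,3)])
  then show ?case by (rule stay.IH)
next
  case (exchange s f t g)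
  have f: "f \<in> S - {g}" using exchange carried_sites by blast
  obtain s' where s': "s' < t" "carried S R e' s' f" "quiet f {s'<..<t}"
    using carried_before_exchange[OF exchange.prems f] exchange by blast
  have "carried S R e' (max s s') f"
    using s'(1) exchange.hyps(2) by (intro carried_stay[OF s'(2)] quiet_subset[OF s'(3)]) auto
  then have "carried S R e' s f"
  proof (rule carried_back_quiet)
    show "quiet f {s<..max s s'}"
      using s'(1) exchange.hyps(2) by (intro quiet_subset[OF exchange.hyps(3)]) auto
  qed (use carried_sites(3)[OF exchange.hyps(1)] in auto)
  then show ?case by (rule exchange.IH)
qed

lemma carried_forward_quiet:
  assumes "carried S R e t f'" "s \<le> t" "\<And>g. carried S R e s g \<Longrightarrow> g = f" "0 \<le> s" "quiet f {s<..t}"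
  shows "f' = f"
  using assms
proof induction
  case start
  then have "carried S R e s e" using carried.start[of e S R] by simp
  then show ?case by (rule start.prems(2))
next
  case (stay u g t)
  show ?case
  proof (cases "s \<le> u")
    case True
    then show ?thesis using stay by (intro stay.IH quiet_subset[OF stay.prems(4)]) auto
  next
    case False
    then have "carried S R e s g"
      using stay by (intro carried_stay[OF stay.hyps(1)] quiet_subset[OF stay.hyps(3)]) auto
    then show ?thesis by (rule stay.prems(2))
  qed
next
  case (exchange u h t g)
  show ?case
  proof (cases "s = t")
    case True
    then show ?thesis using exchange carried.exchange[of S R e u h t g] by blast
  next
    case False
    then have "s < t" using exchange by auto
    have "h = f"
    proof (cases "s \<le> u")
      case True
      then show ?thesis using exchange by (intro exchange.IH quiet_subset[OF exchange.prems(4)]) auto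
    next
      case False
      then have "carried S R e s h"
        using exchange \<open>s < t\<close> by (intro carried_stay[OF exchange.hyps(1)] quiet_subset[OF exchange.hyps(3)]) auto
      then show ?thesis by (rule exchange.prems(2))
    qed
    then have "t \<notin> {s<..t}" using exchange by (intro quietD[OF exchange.prems(4)]) auto
    then show ?thesis using \<open>s < t\<close> by simp
  qed
qed

lemma carried_after_exchange:
  assumes "carried S R e t g'" "s < t" "\<And>g. carried S R e s g \<Longrightarrow> g = f" "0 \<le> s" "quiet f {s<..<t}"
    and "f \<in> S" "g \<in> S - {f}" "t \<in> R {f, g}"
  shows "g' = g"
  using assms
proof induction
  case (stay u h t)
  show ?case
  proof (cases "u = t")
    case True then show ?thesis using stay by blast
  next
    case False
    then have "carried S R e (max u s) h"
      using stay by (intro carried_stay[OF stay.hyps(1)] quiet_subset[OF stay.hyps(3)]) auto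
    then have "h = f"
      using stay False by (intro carried_forward_quiet[of e "max u s" h s f] quiet_subset[OF stay.prems(4)]) auto
    then have "t \<notin> {u<..t}" using stay by (intro quietD[OF stay.hyps(3), of g]) auto
    then show ?thesis using stay False by auto
  qed
next
  case (exchange u h t g')
  have "carried S R e (max u s) h"
    using exchange by (intro carried_stay[OF exchange.hyps(1)] quiet_subset[OF exchange.hyps(3)]) auto
  then have "h = f"
    using exchange by (intro carried_forward_quiet[of e "max u s" h s f] quiet_subset[OF exchange.prems(4)]) auto
  then show ?case using exchange no_coincidence[of f g' g t] by blast
qed auto

text \<open>The same comparison forwards in time: as long as the current position is quiet, a path cannot leave
  it, and when it rings there is only one possible partner.\<close>

lemma carried_unique:
  assumes "carried S R e t f" "carried S R e t f'"
  shows "f' = f"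
  using assms
proof (induction arbitrary: f')
  case start
  have "carried S R e t f \<Longrightarrow> t = 0 \<Longrightarrow> f = e" for t f
  proof (induction rule: carried.induct)
    case (stay s f t)
    then show ?case using carried_sites(3)[of e s f] by auto
  next
    case (exchange s f t g)
    then show ?case using carried_sites(3)[of e s f] by auto
  qed simp
  then show ?case using start by blast
next
  case (stay s f t)
  show ?case
    by (rule carried_forward_quiet[OF stay.prems stay.hyps(2) stay.IH carried_sites(3)[OF stay.hyps(1)] stay.hyps(3)])
next
  case (exchange s f t g)
  show ?case
    by (rule carried_after_exchange[OF exchange.prems exchange.hyps(2) exchange.IH
        carried_sites(3)[OF exchange.hyps(1)] exchange.hyps(3) carried_sites(2)[OF exchange.hyps(1)]
        exchange.hyps(4,5)])
qed

text \<open>Within a finite set \<open>C\<close> of sites that nothing can leave, only finitely many exchange times are ahead, and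
  following the exchanges terminates because each exchange uses up one of them.\<close>

lemma carried_total_in_component:
  assumes C: "finite C" "C \<subseteq> S" "u \<le> t"
    and closed: "\<And>g h. g \<in> C \<Longrightarrow> h \<in> S - {g} \<Longrightarrow> R {g, h} \<inter> {u<..t} \<noteq> {} \<Longrightarrow> h \<in> C"
    and fin: "\<And>g h. g \<in> C \<Longrightarrow> h \<in> C - {g} \<Longrightarrow> finite (R {g, h} \<inter> {u<..t})"
    and c: "carried S R e u c" "c \<in> C"
  shows "\<exists>g\<in>C. carried S R e t g"
proof -
  define Q where "Q = (\<Union>g\<in>C. \<Union>h\<in>C - {g}. R {g, h} \<inter> {u<..t})"
  have finQ: "finite Q" unfolding Q_def by (intro finite_UN_I finite_Diff fin C(1))
  have from_any: "\<exists>g\<in>C. carried S R e t g" if "u \<le> s" "s \<le> t" "carried S R e s d" "d \<in> C" for s d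
    using that
  proof (induction "card (Q \<inter> {s<..t})" arbitrary: s d rule: less_induct)
    case less
    define J where "J = (\<Union>h\<in>S - {d}. R {d, h} \<inter> {s<..t})"
    have su: "{s<..t} \<subseteq> {u<..t}" using less.prems(1) by auto
    have "R {d, h} \<inter> {s<..t} \<subseteq> Q \<inter> {s<..t}" if h: "h \<in> S - {d}" for h
    proof (cases "R {d, h} \<inter> {u<..t} = {}")
      case True
      then show ?thesis using su by blast
    next
      case False
      then have "h \<in> C - {d}" using closed[OF less.prems(4) h] h by blast
      then have "R {d, h} \<inter> {u<..t} \<subseteq> Q" unfolding Q_def using less.prems(4) by blast
      then show ?thesis using su by blast
    qed
    then have "J \<subseteq> Q \<inter> {s<..t}" unfolding J_def by blast
    then have finJ: "finite J" using finQ finite_subset by blast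
    show ?case
    proof (cases "J = {}")
      case True
      then have "quiet d {s<..t}" unfolding J_def by blast
      then show ?thesis using less.prems carried_stay by blast
    next
      case False
      define r where "r = Min J"
      have "r \<in> J" and r: "\<And>x. x \<in> J \<Longrightarrow> r \<le> x" using finJ False by (auto simp: r_def)
      then obtain h where h: "h \<in> S - {d}" "r \<in> R {d, h}" "s < r" "r \<le> t" by (auto simp: J_def)
      have "quiet d {s<..<r}"
      proof (rule ballI, rule ccontr)
        fix h' assume "h' \<in> S - {d}" "R {d, h'} \<inter> {s<..<r} \<noteq> {}"
        then obtain x where x: "x \<in> R {d, h'}" "s < x" "x < r" by auto
        then have "x \<in> J" unfolding J_def using \<open>h' \<in> S - {d}\<close> h(4) by auto
        then show False using r[of x] x by simp
      qed
      then have "carried S R e r h"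
        using h less.prems(3) by (intro carried.exchange[of S R e s d r h]) auto
      moreover have "h \<in> C" using closed[OF less.prems(4) h(1)] h su by force
      moreover have "card (Q \<inter> {r<..t}) < card (Q \<inter> {s<..t})"
      proof (rule psubset_card_mono)
        show "finite (Q \<inter> {s<..t})" using finQ by simp
        show "Q \<inter> {r<..t} \<subset> Q \<inter> {s<..t}"
          using \<open>r \<in> J\<close> \<open>J \<subseteq> Q \<inter> {s<..t}\<close> h by auto
      qed
      moreover have "u \<le> r" using h less.prems(1) by simp
      ultimately show ?thesis using less.hyps[of r h] h(4) by blast
    qed
  qed
  show ?thesis by (rule from_any[OF order_refl C(3) c])
qed

end

text \<open>Harris' construction: time is cut into slabs of length \<open>\<epsilon>\<close> in each of which the sites decompose into finite
  sets that do not interact.\<close>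

locale exchange_flow = exchange_times +
  fixes \<epsilon> :: real
  assumes eps_pos: "0 < \<epsilon>"
    and finite_components: "\<And>k::nat. \<And>f. f \<in> S \<Longrightarrow> \<exists>C. finite C \<and> C \<subseteq> S \<and> f \<in> C \<and>
      (\<forall>g\<in>C. \<forall>h\<in>S - {g}. R {g, h} \<inter> {k * \<epsilon><..Suc k * \<epsilon>} \<noteq> {} \<longrightarrow> h \<in> C) \<and>
      (\<forall>g\<in>C. \<forall>h\<in>C - {g}. finite (R {g, h} \<inter> {k * \<epsilon><..Suc k * \<epsilon>}))"
begin

definition bijective_at :: "real \<Rightarrow> bool" where
  "bijective_at t \<longleftrightarrow> (\<forall>e\<in>S. \<exists>f\<in>S. carried S R e t f) \<and> (\<forall>f\<in>S. \<exists>e\<in>S. carried S R e t f)"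

text \<open>In a finite component the exchanges can be followed up to time \<open>t\<close>; the resulting map of the component
  into itself is injective, hence onto, which gives a preimage for every site.\<close>

lemma bijective_within_slab:
  fixes k :: nat
  assumes bij: "bijective_at (k * \<epsilon>)" and t: "k * \<epsilon> \<le> t" "t \<le> Suc k * \<epsilon>"
  shows "bijective_at t"
proof -
  let ?u = "k * \<epsilon>"
  have comp: "\<exists>C. finite C \<and> C \<subseteq> S \<and> f \<in> C \<and> (\<forall>e. \<forall>c\<in>C. carried S R e ?u c \<longrightarrow> (\<exists>g\<in>C. carried S R e t g))"
    if f: "f \<in> S" for f
  proof -
    obtain C where C: "finite C" "C \<subseteq> S" "f \<in> C"
      "\<forall>g\<in>C. \<forall>h\<in>S - {g}. R {g, h} \<inter> {?u<..Suc k * \<epsilon>} \<noteq> {} \<longrightarrow> h \<in> C"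
      "\<forall>g\<in>C. \<forall>h\<in>C - {g}. finite (R {g, h} \<inter> {?u<..Suc k * \<epsilon>})"
      using finite_components[OF f, of k] by (elim exE conjE) (rule that)
    have sub: "{?u<..t} \<subseteq> {?u<..Suc k * \<epsilon>}" using t by auto
    have "\<exists>g\<in>C. carried S R e t g" if "c \<in> C" "carried S R e ?u c" for e c
    proof (rule carried_total_in_component[OF C(1,2) t(1) _ _ that(2,1)])
      show "h \<in> C" if "g \<in> C" "h \<in> S - {g}" "R {g, h} \<inter> {?u<..t} \<noteq> {}" for g h
      proof -
        have "R {g, h} \<inter> {?u<..Suc k * \<epsilon>} \<noteq> {}" using that(3) sub by blast
        then show ?thesis using C(4) that(1,2) by simp
      qed
      show "finite (R {g, h} \<inter> {?u<..t})" if "g \<in> C" "h \<in> C - {g}" for g h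
        by (rule finite_subset[OF _ C(5)[rule_format, OF that]]) (use sub in auto)
    qed
    then show ?thesis using C(1-3) by (intro exI[of _ C]) simp
  qed
  show ?thesis
    unfolding bijective_at_def
  proof safe
    fix e assume "e \<in> S"
    then obtain c where "c \<in> S" "carried S R e ?u c" using bij by (auto simp: bijective_at_def)
    then obtain g where "carried S R e t g" using comp[of c] by metis
    then show "\<exists>f\<in>S. carried S R e t f" using carried_sites(2) by blast
  next
    fix f assume "f \<in> S"
    then obtain C where C: "finite C" "C \<subseteq> S" "f \<in> C"
      "\<And>e c. c \<in> C \<Longrightarrow> carried S R e ?u c \<Longrightarrow> \<exists>g\<in>C. carried S R e t g" using comp by metis
    have "\<forall>c\<in>C. \<exists>e\<in>S. carried S R e ?u c" using C bij by (auto simp: bijective_at_def)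
    then obtain pre where pre: "\<And>c. c \<in> C \<Longrightarrow> pre c \<in> S \<and> carried S R (pre c) ?u c" by metis
    have "\<forall>c\<in>C. \<exists>g\<in>C. carried S R (pre c) t g"
    proof
      fix c assume "c \<in> C"
      then show "\<exists>g\<in>C. carried S R (pre c) t g" using C(4) pre by simp
    qed
    then obtain \<phi> where \<phi>: "\<And>c. c \<in> C \<Longrightarrow> \<phi> c \<in> C \<and> carried S R (pre c) t (\<phi> c)" by metis
    have "inj_on \<phi> C"
    proof (rule inj_onI)
      fix c d assume cd: "c \<in> C" "d \<in> C" "\<phi> c = \<phi> d"
      then have "pre c = pre d" using \<phi>[of c] \<phi>[of d] carried_inj by metis
      then show "c = d" using pre[OF cd(1)] pre[OF cd(2)] carried_unique by metis
    qed
    moreover have "\<phi> ` C \<subseteq> C" using \<phi> by blast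
    ultimately have "\<phi> ` C = C" using C(1) endo_inj_surj by blast
    then have "f \<in> \<phi> ` C" using C(3) by simp
    then obtain c where "c \<in> C" "f = \<phi> c" by (rule imageE)
    then show "\<exists>e\<in>S. carried S R e t f" using \<phi>[of c] pre[of c] by (intro bexI[of _ "pre c"]) simp_all
  qed
qed

lemma bijective_at_grid: "bijective_at (real k * \<epsilon>)"
proof (induction k)
  case 0
  then show ?case using carried.start[of _ S R] by (auto simp: bijective_at_def)
next
  case (Suc k)
  show ?case
    by (rule bijective_within_slab[OF Suc.IH]) (use eps_pos in \<open>auto simp: algebra_simps\<close>)
qed

lemma slab_of_time:
  assumes "0 \<le> t" obtains k :: nat where "k * \<epsilon> \<le> t" "t \<le> Suc k * \<epsilon>"
proof
  have *: "0 \<le> t / \<epsilon>" using assms eps_pos by simp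
  show "real (nat \<lfloor>t / \<epsilon>\<rfloor>) * \<epsilon> \<le> t"
    using eps_pos * by (subst pos_le_divide_eq[symmetric]) auto
  show "t \<le> real (Suc (nat \<lfloor>t / \<epsilon>\<rfloor>)) * \<epsilon>"
  proof -
    have "t / \<epsilon> \<le> 1 + real_of_int \<lfloor>t / \<epsilon>\<rfloor>" by linarith
    then show ?thesis using eps_pos * by (subst pos_divide_le_eq[symmetric]) auto
  qed
qed

lemma bijective_at_all:
  assumes "0 \<le> t" shows "bijective_at t"
proof -
  obtain k :: nat where "k * \<epsilon> \<le> t" "t \<le> Suc k * \<epsilon>" using slab_of_time[OF assms] .
  then show ?thesis by (rule bijective_within_slab[OF bijective_at_grid])
qed

text \<open>The definite description and the inverse function in the definition of the process have the intended
  meaning whenever all components are finite.\<close>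

lemma inv_exchange_perm:
  assumes "carried S R e t f"
  shows "inv_into S (exchange_perm S R t) f = e"
proof -
  have perm: "exchange_perm S R t e' = f'" if "carried S R e' t f'" for e' f'
    unfolding exchange_perm_def
  proof (rule the_equality)
    show "carried S R e' t f'" by (rule that)
    show "g = f'" if "carried S R e' t g" for g by (rule carried_unique[OF \<open>carried S R e' t f'\<close> that])
  qed
  have t: "0 \<le> t" "e \<in> S" using carried_sites assms by auto
  have "inj_on (exchange_perm S R t) S"
  proof (rule inj_onI)
    fix x y assume xy: "x \<in> S" "y \<in> S" "exchange_perm S R t x = exchange_perm S R t y"
    obtain f' where "carried S R x t f'"
      using bijective_at_all[OF t(1)] xy(1) unfolding bijective_at_def by blast
    moreover obtain g' where "carried S R y t g'"
      using bijective_at_all[OF t(1)] xy(2) unfolding bijective_at_def by blast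
    ultimately show "x = y" using perm[of x f'] perm[of y g'] xy(3) carried_inj[of x t f' y] by simp
  qed
  then show ?thesis using perm[OF assms] t(2) by (metis inv_into_f_f)
qed

end


section \<open>Bernoulli sites touched by sparse random pairs\<close>

lemma (in prob_space) indep_events_disjoint_sigma:
  assumes ind: "indep_events Ev I" and AB: "A \<subseteq> I" "B \<subseteq> I" "A \<inter> B = {}"
    and a: "a \<in> sigma_sets (space M) (Ev ` A)" and b: "b \<in> sigma_sets (space M) (Ev ` B)"
  shows "prob (a \<inter> b) = prob a * prob b"
proof -
  have eq: "(\<Union>i\<in>X. {Ev i}) = Ev ` X" for X by auto
  have "indep_sets (\<lambda>i. {Ev i}) (\<Union>j\<in>UNIV. case_bool A B j)"
    using ind AB unfolding indep_events_def_alt by (rule_tac indep_sets_mono_index) (auto split: bool.splits)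
  then have "indep_sets (\<lambda>j. sigma_sets (space M) (\<Union>i\<in>case_bool A B j. {Ev i})) UNIV"
    using AB by (intro indep_sets_collect_sigma)
      (auto simp: Int_stable_def disjoint_family_on_def split: bool.split)
  moreover have "(\<lambda>j. sigma_sets (space M) (\<Union>i\<in>case_bool A B j. {Ev i}))
      = case_bool (sigma_sets (space M) (Ev ` A)) (sigma_sets (space M) (Ev ` B))"
    by (auto simp: fun_eq_iff eq split: bool.split)
  ultimately have "indep_set (sigma_sets (space M) (Ev ` A)) (sigma_sets (space M) (Ev ` B))"
    by (simp add: indep_set_def)
  then show ?thesis using a b by (rule indep_setD)
qed

text \<open>An independent family consisting of an event for each site, of probability \<open>q\<close>, and an event for each
  pair of sites. Later the site event says that the site has a given state at the beginning of a slab, and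
  the pair event that the clock of the pair rings during the slab. A site is touched if its own event or
  that of a pair containing it happens.\<close>

locale site_and_pair_events = prob_space M for M :: "'m measure" +
  fixes S :: "'i set" and P :: "'i set set" and Ev :: "'i + 'i set \<Rightarrow> 'm set"
    and q :: real and c :: "'i \<Rightarrow> 'i \<Rightarrow> real" and \<epsilon> :: real
  assumes countable_S: "countable S"
    and indep: "indep_events Ev (Inl ` S \<union> Inr ` P)"
    and site_prob: "\<And>f. f \<in> S \<Longrightarrow> prob (Ev (Inl f)) = q"
    and pair_empty: "\<And>f g. f \<in> S \<Longrightarrow> g \<in> S - {f} \<Longrightarrow> {f, g} \<notin> P \<Longrightarrow> Ev (Inr {f, g}) = {}"
    and pair_prob: "\<And>f g. f \<in> S \<Longrightarrow> g \<in> S - {f} \<Longrightarrow> prob (Ev (Inr {f, g})) \<le> c f g"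
    and pair_sum: "\<And>f F. f \<in> S \<Longrightarrow> finite F \<Longrightarrow> F \<subseteq> S - {f} \<Longrightarrow> (\<Sum>g\<in>F. c f g) \<le> \<epsilon>"
    and q_pos: "0 < q" "q \<le> 1"
begin

definition touched :: "'m \<Rightarrow> 'i set" where
  "touched x = {f\<in>S. x \<in> Ev (Inl f) \<or> (\<exists>g\<in>S - {f}. x \<in> Ev (Inr {f, g}))}"

lemma site_events [measurable]: "f \<in> S \<Longrightarrow> Ev (Inl f) \<in> events"
  using indep by (auto simp: indep_events_def)

lemma pair_events [measurable]: "f \<in> S \<Longrightarrow> g \<in> S - {f} \<Longrightarrow> Ev (Inr {f, g}) \<in> events"
  using indep pair_empty[of f g] by (cases "{f, g} \<in> P") (auto simp: indep_events_def)

lemma site_event_in_space: "f \<in> S \<Longrightarrow> x \<in> Ev (Inl f) \<Longrightarrow> x \<in> space M"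
  by (rule subsetD[OF sets.sets_into_space[OF site_events]])

lemma pair_event_in_space: "f \<in> S \<Longrightarrow> g \<in> S - {f} \<Longrightarrow> x \<in> Ev (Inr {f, g}) \<Longrightarrow> x \<in> space M"
  by (rule subsetD[OF sets.sets_into_space[OF pair_events]])

lemma c_nonneg: "f \<in> S \<Longrightarrow> g \<in> S - {f} \<Longrightarrow> 0 \<le> c f g"
  using pair_prob[of f g] measure_nonneg[of M "Ev (Inr {f, g})"] by linarith

lemma random_subset_touched: "random_subset M S touched"
  unfolding random_subset_def
proof (intro conjI ballI)
  show "touched x \<subseteq> S" for x by (auto simp: touched_def)
  fix f assume f: "f \<in> S"
  have "{x\<in>space M. f \<in> touched x} = Ev (Inl f) \<union> (\<Union>g\<in>S - {f}. Ev (Inr {f, g}))"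
    using f by (auto simp: touched_def site_event_in_space pair_event_in_space)
  also have "\<dots> \<in> events"
    using f countable_S by (intro sets.Un sets.countable_UN'' site_events pair_events) auto
  finally show "{x\<in>space M. f \<in> touched x} \<in> events" .
qed

lemma touched_trace_sigma:
  assumes F: "finite F" "F \<subseteq> S"
  shows "{x\<in>space M. touched x \<inter> F = B} \<in> sigma_sets (space M) (Ev ` (Inl ` F \<union> Inr ` {a\<in>P. a \<inter> F \<noteq> {}}))"
proof -
  let ?A = "Inl ` F \<union> Inr ` {a\<in>P. a \<inter> F \<noteq> {}}"
  let ?N = "sigma (space M) (Ev ` ?A)"
  have "Ev ` ?A \<subseteq> events" using indep F by (auto simp: indep_events_def)
  then have sub: "Ev ` ?A \<subseteq> Pow (space M)" using sets.space_closed by (rule subset_trans)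
  have spN: "space ?N = space M" by (simp add: space_measure_of_conv)
  have setsN: "sets ?N = sigma_sets (space M) (Ev ` ?A)" using sub by (rule sets_measure_of)
  have site: "Ev (Inl f) \<in> sets ?N" if "f \<in> F" for f
    unfolding setsN using that by (intro sigma_sets.Basic) auto
  have pair: "Ev (Inr {f, g}) \<in> sets ?N" if "f \<in> F" "g \<in> S - {f}" for f g
  proof (cases "{f, g} \<in> P")
    case True
    then show ?thesis unfolding setsN using that by (intro sigma_sets.Basic) auto
  next
    case False
    then have "Ev (Inr {f, g}) = {}" using that F by (intro pair_empty) auto
    then show ?thesis by simp
  qed
  have "random_subset ?N F (\<lambda>x. touched x \<inter> F)"
    unfolding random_subset_def
  proof (intro conjI ballI)
    fix f assume f: "f \<in> F"
    have "{x\<in>space ?N. f \<in> touched x \<inter> F} = Ev (Inl f) \<union> (\<Union>g\<in>S - {f}. Ev (Inr {f, g}))"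
      using f F unfolding spN by (auto simp: touched_def site_event_in_space pair_event_in_space)
    also have "\<dots> \<in> sets ?N"
      using f F countable_S by (intro sets.Un sets.countable_UN'' site pair) auto
    finally show "{x\<in>space ?N. f \<in> touched x \<inter> F} \<in> sets ?N" .
  qed auto
  from random_subset_trace_sets[OF this F(1) order_refl, of B]
  have "{x\<in>space M. touched x \<inter> F = B} \<in> sets ?N" by (simp add: spN Int_assoc)
  then show ?thesis unfolding setsN .
qed

lemma site_indep_trace:
  assumes F: "finite F" "F \<subseteq> S" "f \<in> S - F"
  shows "prob (Ev (Inl f) \<inter> {x\<in>space M. touched x \<inter> F = B}) = q * prob {x\<in>space M. touched x \<inter> F = B}"
proof -
  have "prob (Ev (Inl f) \<inter> {x\<in>space M. touched x \<inter> F = B})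
      = prob (Ev (Inl f)) * prob {x\<in>space M. touched x \<inter> F = B}"
    using F by (intro indep_events_disjoint_sigma[OF indep, of "{Inl f}" "Inl ` F \<union> Inr ` {a\<in>P. a \<inter> F \<noteq> {}}"]
        touched_trace_sigma) (auto intro: sigma_sets.Basic)
  then show ?thesis using F site_prob by simp
qed

lemma pair_indep_trace:
  assumes F: "finite F" "F \<subseteq> S" "f \<in> S - F" "g \<in> S - F" "f \<noteq> g"
  shows "prob (Ev (Inr {f, g}) \<inter> {x\<in>space M. touched x \<inter> F = B})
    \<le> c f g * prob {x\<in>space M. touched x \<inter> F = B}"
proof (cases "{f, g} \<in> P")
  case True
  have "prob (Ev (Inr {f, g}) \<inter> {x\<in>space M. touched x \<inter> F = B})
      = prob (Ev (Inr {f, g})) * prob {x\<in>space M. touched x \<inter> F = B}"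
    using F True by (intro indep_events_disjoint_sigma[OF indep, of "{Inr {f, g}}" "Inl ` F \<union> Inr ` {a\<in>P. a \<inter> F \<noteq> {}}"]
        touched_trace_sigma) (auto intro: sigma_sets.Basic)
  then show ?thesis using F pair_prob[of f g] by (auto intro!: mult_right_mono)
next
  case False
  then have "Ev (Inr {f, g}) = {}" using F by (intro pair_empty) auto
  moreover have "0 \<le> c f g" using F by (intro c_nonneg) auto
  ultimately show ?thesis by simp
qed

text \<open>This is the heart of the proof. A pair event touches two sites, so pair events
  alone would create strong correlations: seeing one site touched can make a particular other one very
  likely to be touched as well. The site events repair this. If \<open>g\<close> is known to be touched, the most
  likely reason is its own event. Indeed, given the pair event of \<open>{f, g}\<close>, the trace on \<open>F\<close> is determined by
  the trace on \<open>F - {g}\<close>, which is independent of it, and replacing the pair event by the site event of \<open>g\<close>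
  produces the same trace with probability \<open>q\<close>. This costs a factor \<open>1 / q\<close>, and the bound remains summable
  over \<open>g\<close>.\<close>

lemma pair_prob_given_trace:
  assumes F: "finite F" "F \<subseteq> S" "f \<in> S - F" "g \<in> S - {f}" "B \<subseteq> F"
  shows "prob (Ev (Inr {f, g}) \<inter> {x\<in>space M. touched x \<inter> F = B})
    \<le> c f g / q * prob {x\<in>space M. touched x \<inter> F = B}"
proof -
  let ?E = "\<lambda>F B. {x\<in>space M. touched x \<inter> F = B}"
  have c: "0 \<le> c f g" using F by (intro c_nonneg) auto
  have E: "?E F B \<in> events" if "finite F" "F \<subseteq> S" for F B
    using random_subset_trace_sets[OF random_subset_touched that] .
  have touch: "g \<in> touched x" if "x \<in> Ev (Inr {f, g})" for x
    using that F by (auto simp: touched_def insert_commute intro!: bexI[of _ f])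
  consider "g \<notin> F" | "g \<in> F - B" | "g \<in> B" by blast
  then show ?thesis
  proof cases
    case 1
    then have "prob (Ev (Inr {f, g}) \<inter> ?E F B) \<le> c f g * prob (?E F B)"
      using F by (intro pair_indep_trace) auto
    also have "c f g \<le> c f g / q" using c q_pos by (simp add: pos_le_divide_eq mult_left_le)
    finally show ?thesis by (simp add: mult_right_mono)
  next
    case 2
    \<comment> \<open>The trace says that \<open>g\<close> is not touched, which excludes the pair event.\<close>
    then have "Ev (Inr {f, g}) \<inter> ?E F B = {}" using touch by blast
    then show ?thesis using c q_pos by simp
  next
    case 3
    let ?E' = "?E (F - {g}) (B - {g})"
    have F': "finite (F - {g})" "F - {g} \<subseteq> S" "f \<in> S - (F - {g})" "g \<in> S - (F - {g})" "f \<noteq> g"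
      using F by auto
    have "prob (Ev (Inr {f, g}) \<inter> ?E F B) \<le> prob (Ev (Inr {f, g}) \<inter> ?E')"
      using F F' by (intro finite_measure_mono sets.Int pair_events E) auto
    also have "\<dots> \<le> c f g * prob ?E'"
      by (rule pair_indep_trace[OF F'])
    also have "\<dots> = c f g / q * prob (Ev (Inl g) \<inter> ?E')"
      using site_indep_trace[OF F'(1,2,4), of "B - {g}"] q_pos by simp
    also have "\<dots> \<le> c f g / q * prob (?E F B)"
    proof (intro mult_left_mono finite_measure_mono)
      have "g \<in> touched x" if "x \<in> Ev (Inl g)" for x using that F by (auto simp: touched_def)
      then show "Ev (Inl g) \<inter> ?E' \<subseteq> ?E F B" using 3 F by blast
    qed (use F E c q_pos in auto)
    finally show ?thesis .
  qed
qed

lemma inclusion_prob_le_touched: "inclusion_prob_le M S touched (q + \<epsilon> / q)"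
  unfolding inclusion_prob_le_def
proof (intro allI impI)
  fix F f B assume F: "finite F" "F \<subseteq> S" "f \<in> S - F" "B \<subseteq> F"
  let ?E = "{x\<in>space M. touched x \<inter> F = B}"
  have E: "?E \<in> events" using random_subset_trace_sets[OF random_subset_touched F(1,2)] .
  have U: "(\<Union>g\<in>S - {f}. Ev (Inr {f, g}) \<inter> ?E) \<in> events"
    using F E countable_S by (intro sets.countable_UN'' sets.Int pair_events) auto
  have "prob (\<Union>g\<in>S - {f}. Ev (Inr {f, g}) \<inter> ?E) \<le> \<epsilon> / q * prob ?E"
  proof (rule measure_Union_le_finite_sums)
    fix G assume G: "finite G" "G \<subseteq> S - {f}"
    have "(\<Sum>g\<in>G. prob (Ev (Inr {f, g}) \<inter> ?E)) \<le> (\<Sum>g\<in>G. c f g / q * prob ?E)"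
      using F G by (intro sum_mono pair_prob_given_trace) auto
    also have "\<dots> = (\<Sum>g\<in>G. c f g) / q * prob ?E"
      by (simp add: sum_distrib_right sum_divide_distrib)
    also have "\<dots> \<le> \<epsilon> / q * prob ?E"
      using F G q_pos by (intro mult_right_mono divide_right_mono pair_sum) auto
    finally show "(\<Sum>g\<in>G. prob (Ev (Inr {f, g}) \<inter> ?E)) \<le> \<epsilon> / q * prob ?E" .
  qed (use F E countable_S pair_events in auto)
  moreover have "prob (Ev (Inl f) \<inter> ?E) = q * prob ?E" using F by (intro site_indep_trace) auto
  moreover have "{x\<in>space M. f \<in> touched x \<and> touched x \<inter> F = B}
      = (Ev (Inl f) \<inter> ?E) \<union> (\<Union>g\<in>S - {f}. Ev (Inr {f, g}) \<inter> ?E)"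
    using F by (auto simp: touched_def)
  moreover have "prob ((Ev (Inl f) \<inter> ?E) \<union> (\<Union>g\<in>S - {f}. Ev (Inr {f, g}) \<inter> ?E))
      \<le> prob (Ev (Inl f) \<inter> ?E) + prob (\<Union>g\<in>S - {f}. Ev (Inr {f, g}) \<inter> ?E)"
    using F E U by (intro measure_Un_le) auto
  ultimately show "prob {x\<in>space M. f \<in> touched x \<and> touched x \<inter> F = B} \<le> (q + \<epsilon> / q) * prob ?E"
    by (simp add: distrib_right)
qed

end

text \<open>Passing to complements turns upper bounds for the closed sites into lower bounds for the open ones,
  which is how the supercritical case is treated.\<close>

lemma inclusion_prob_ge_complement:
  assumes "prob_space M" and T: "random_subset M S T" and le: "inclusion_prob_le M S T r"
  shows "random_subset M S (\<lambda>x. S - T x)" and "inclusion_prob_ge M S (\<lambda>x. S - T x) (1 - r)"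
proof -
  interpret prob_space M by fact
  show "random_subset M S (\<lambda>x. S - T x)"
    unfolding random_subset_def
  proof (intro conjI ballI)
    fix f assume f: "f \<in> S"
    then have "{x\<in>space M. f \<in> S - T x} = space M - {x\<in>space M. f \<in> T x}" by auto
    then show "{x\<in>space M. f \<in> S - T x} \<in> events" using T f by (auto simp: random_subset_def)
  qed auto
  show "inclusion_prob_ge M S (\<lambda>x. S - T x) (1 - r)"
    unfolding inclusion_prob_ge_def
  proof (intro allI impI)
    fix F f B assume F: "finite F" "F \<subseteq> S" "f \<in> S - F" "B \<subseteq> F"
    let ?E = "{x\<in>space M. T x \<inter> F = F - B}" and ?E' = "{x\<in>space M. f \<in> T x \<and> T x \<inter> F = F - B}"
    have "?E \<in> events" using random_subset_trace_sets[OF T F(1,2)] .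
    moreover have "?E' \<in> events"
      using random_subset_member_cylinder_sets[OF T F(1,2), of f "\<lambda>X. X = F - B"] F by simp
    moreover have "?E' \<subseteq> ?E" by auto
    ultimately have "prob (?E - ?E') = prob ?E - prob ?E'" by (rule finite_measure_Diff)
    moreover have "prob ?E' \<le> r * prob ?E"
      using le[unfolded inclusion_prob_le_def, rule_format, OF F(1-3) Diff_subset] .
    moreover have "{x\<in>space M. (S - T x) \<inter> F = B} = ?E" using F by auto
    moreover have "{x\<in>space M. f \<in> S - T x \<and> (S - T x) \<inter> F = B} = ?E - ?E'" using F by auto
    ultimately show "(1 - r) * prob {x\<in>space M. (S - T x) \<inter> F = B}
        \<le> prob {x\<in>space M. f \<in> S - T x \<and> (S - T x) \<inter> F = B}"
      by (simp add: algebra_simps)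
  qed
qed

section \<open>Components of sparse random pairs\<close>

text \<open>\<open>self_avoiding G n f U\<close> says that there is a path with \<open>n\<close> steps from \<open>f\<close> that repeats no vertex and
  avoids \<open>U\<close> after its start. The set \<open>U\<close> accumulates the vertices already visited, so that the pairs used by
  the first step and by the rest of the path are visibly disjoint.\<close>

primrec self_avoiding :: "('i \<times> 'i) set \<Rightarrow> nat \<Rightarrow> 'i \<Rightarrow> 'i set \<Rightarrow> bool" where
  "self_avoiding G 0 f U \<longleftrightarrow> True"
| "self_avoiding G (Suc n) f U \<longleftrightarrow> (\<exists>g. (f, g) \<in> G \<and> g \<notin> insert f U \<and> self_avoiding G n g (insert f U))"

definition reach_avoiding :: "('i \<times> 'i) set \<Rightarrow> 'i set \<Rightarrow> 'i \<Rightarrow> 'i set" where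
  "reach_avoiding G U f = {(a, b). (a, b) \<in> G \<and> b \<notin> U}\<^sup>* `` {f}"

lemma reach_avoiding_first_step:
  "reach_avoiding G U f \<subseteq> insert f (\<Union>g\<in>{g. (f, g) \<in> G \<and> g \<notin> insert f U}. reach_avoiding G (insert f U) g)"
proof
  fix w assume "w \<in> reach_avoiding G U f"
  then have "(f, w) \<in> {(a, b). (a, b) \<in> G \<and> b \<notin> U}\<^sup>*" by (simp add: reach_avoiding_def)
  then show "w \<in> insert f (\<Union>g\<in>{g. (f, g) \<in> G \<and> g \<notin> insert f U}. reach_avoiding G (insert f U) g)"
  proof (induction rule: rtrancl_induct)
    case (step y z)
    consider "z = f" | "z \<noteq> f" "y = f" | g where "z \<noteq> f" "(f, g) \<in> G" "g \<notin> insert f U" "y \<in> reach_avoiding G (insert f U) g"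
      using step.IH by auto
    then show ?case
    proof cases
      case 2
      then show ?thesis using step(2) by (auto simp: reach_avoiding_def)
    next
      case (3 g)
      then have "(g, z) \<in> {(a, b). (a, b) \<in> G \<and> b \<notin> insert f U}\<^sup>*"
        using step(2) by (auto simp: reach_avoiding_def intro: rtrancl.rtrancl_into_rtrancl)
      then show ?thesis using 3 by (auto simp: reach_avoiding_def)
    qed simp
  qed simp
qed

text \<open>Every reachable vertex is reachable by a self-avoiding path. If these have bounded length, finite degrees
  leave only finitely many of them.\<close>

lemma finite_reach_avoiding:
  assumes "\<And>f. finite (G `` {f})" and "\<not> self_avoiding G n f U"
  shows "finite (reach_avoiding G U f)"
  using assms(2)
proof (induction n arbitrary: f U)
  case (Suc n)
  have "finite {g. (f, g) \<in> G \<and> g \<notin> insert f U}"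
    by (rule finite_subset[OF _ assms(1)[of f]]) auto
  then have "finite (insert f (\<Union>g\<in>{g. (f, g) \<in> G \<and> g \<notin> insert f U}. reach_avoiding G (insert f U) g))"
    using Suc by auto
  then show ?case by (rule finite_subset[OF reach_avoiding_first_step])
qed simp

locale independent_pairs = prob_space M for M :: "'m measure" +
  fixes S :: "'i set" and P :: "'i set set" and Ev :: "'i set \<Rightarrow> 'm set"
    and c :: "'i \<Rightarrow> 'i \<Rightarrow> real" and \<epsilon> :: real
  assumes countable_S: "countable S"
    and indep: "indep_events Ev P"
    and pair_empty: "\<And>f g. f \<in> S \<Longrightarrow> g \<in> S - {f} \<Longrightarrow> {f, g} \<notin> P \<Longrightarrow> Ev {f, g} = {}"
    and pair_prob: "\<And>f g. f \<in> S \<Longrightarrow> g \<in> S - {f} \<Longrightarrow> prob (Ev {f, g}) \<le> c f g"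
    and pair_sum: "\<And>f F. f \<in> S \<Longrightarrow> finite F \<Longrightarrow> F \<subseteq> S - {f} \<Longrightarrow> (\<Sum>g\<in>F. c f g) \<le> \<epsilon>"
begin

definition pair_graph :: "'m \<Rightarrow> ('i \<times> 'i) set" where
  "pair_graph x = {(f, g). f \<in> S \<and> g \<in> S - {f} \<and> x \<in> Ev {f, g}}"

lemma pair_events: "f \<in> S \<Longrightarrow> g \<in> S - {f} \<Longrightarrow> Ev {f, g} \<in> events"
  using indep pair_empty[of f g] by (cases "{f, g} \<in> P") (auto simp: indep_events_def)

lemma c_nonneg: "f \<in> S \<Longrightarrow> g \<in> S - {f} \<Longrightarrow> 0 \<le> c f g"
  using pair_prob[of f g] measure_nonneg[of M "Ev {f, g}"] by linarith

lemma eps_nonneg: "f \<in> S \<Longrightarrow> 0 \<le> \<epsilon>"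
  using pair_sum[of f "{}"] by simp

lemma self_avoiding_sigma:
  assumes "g \<in> S - U"
  shows "{x\<in>space M. self_avoiding (pair_graph x) n g U} \<in> sigma_sets (space M) (Ev ` {a\<in>P. a \<inter> U = {}})"
  using assms
proof (induction n arbitrary: g U)
  case 0
  then show ?case by (simp add: sigma_sets_top)
next
  case (Suc n)
  let ?A = "\<lambda>U. Ev ` {a\<in>P. a \<inter> U = {}}"
  have "?A U \<subseteq> events" using indep by (auto simp: indep_events_def)
  then have sub: "?A U \<subseteq> Pow (space M)" using sets.space_closed by (rule subset_trans)
  let ?N = "sigma (space M) (?A U)"
  have setsN: "sets ?N = sigma_sets (space M) (?A U)" using sub by (rule sets_measure_of)
  have "{x\<in>space M. self_avoiding (pair_graph x) (Suc n) g U}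
      = (\<Union>h\<in>S - insert g U. Ev {g, h} \<inter> {x\<in>space M. self_avoiding (pair_graph x) n h (insert g U)})"
    using Suc.prems by (auto simp: pair_graph_def)
  also have "\<dots> \<in> sets ?N"
  proof (intro sets.countable_UN'' sets.Int)
    fix h assume h: "h \<in> S - insert g U"
    show "Ev {g, h} \<in> sets ?N"
    proof (cases "{g, h} \<in> P")
      case True
      then show ?thesis unfolding setsN using h Suc.prems by (intro sigma_sets.Basic) auto
    next
      case False
      then have "Ev {g, h} = {}" using h Suc.prems by (intro pair_empty) auto
      then show ?thesis by simp
    qed
    have "sigma_sets (space M) (?A (insert g U)) \<subseteq> sigma_sets (space M) (?A U)"
      by (intro sigma_sets_mono') auto
    then show "{x\<in>space M. self_avoiding (pair_graph x) n h (insert g U)} \<in> sets ?N"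
      unfolding setsN using Suc.IH[of h "insert g U"] h by blast
  qed (use countable_S in auto)
  finally show ?case unfolding setsN .
qed

lemma self_avoiding_events:
  assumes "g \<in> S - U" shows "{x\<in>space M. self_avoiding (pair_graph x) n g U} \<in> events"
proof -
  have "sigma_sets (space M) (Ev ` {a\<in>P. a \<inter> U = {}}) \<subseteq> events"
    using indep by (intro sets.sigma_sets_subset) (auto simp: indep_events_def)
  then show ?thesis using self_avoiding_sigma[OF assms] by blast
qed

text \<open>A path of \<open>n + 1\<close> steps consists of a pair \<open>{f, g}\<close> and a path of \<open>n\<close> steps that avoids \<open>f\<close>, hence does not
  use any pair containing \<open>f\<close>; the two are independent.\<close>

lemma prob_self_avoiding_le:
  assumes "f \<in> S - U"
  shows "prob {x\<in>space M. self_avoiding (pair_graph x) n f U} \<le> \<epsilon> ^ n"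
  using assms
proof (induction n arbitrary: f U)
  case (Suc n)
  let ?B = "\<lambda>g. {x\<in>space M. self_avoiding (pair_graph x) n g (insert f U)}"
  have eq: "{x\<in>space M. self_avoiding (pair_graph x) (Suc n) f U} = (\<Union>g\<in>S - insert f U. Ev {f, g} \<inter> ?B g)"
    using Suc.prems by (auto simp: pair_graph_def)
  have "prob (\<Union>g\<in>S - insert f U. Ev {f, g} \<inter> ?B g) \<le> \<epsilon> ^ Suc n"
  proof (rule measure_Union_le_finite_sums)
    fix F assume F: "finite F" "F \<subseteq> S - insert f U"
    have "prob (Ev {f, g} \<inter> ?B g) \<le> c f g * \<epsilon> ^ n" if g: "g \<in> F" for g
    proof (cases "{f, g} \<in> P")
      case True
      have "prob (Ev {f, g} \<inter> ?B g) = prob (Ev {f, g}) * prob (?B g)"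
        using F g Suc.prems True
        by (intro indep_events_disjoint_sigma[OF indep, of "{{f, g}}" "{a\<in>P. a \<inter> insert f U = {}}"]
            self_avoiding_sigma) (auto intro: sigma_sets.Basic)
      also have "\<dots> \<le> c f g * \<epsilon> ^ n"
        using F g Suc.prems by (intro mult_mono Suc.IH pair_prob c_nonneg) auto
      finally show ?thesis .
    next
      case False
      then have "Ev {f, g} = {}" using F g Suc.prems by (intro pair_empty) auto
      moreover have "0 \<le> c f g" using F g Suc.prems by (intro c_nonneg) auto
      ultimately show ?thesis using eps_nonneg[of f] Suc.prems by simp
    qed
    then have "(\<Sum>g\<in>F. prob (Ev {f, g} \<inter> ?B g)) \<le> (\<Sum>g\<in>F. c f g) * \<epsilon> ^ n"
      by (auto simp: sum_distrib_right intro!: sum_mono)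
    also have "\<dots> \<le> \<epsilon> * \<epsilon> ^ n"
      using F Suc.prems eps_nonneg[of f] by (intro mult_right_mono pair_sum) auto
    finally show "(\<Sum>g\<in>F. prob (Ev {f, g} \<inter> ?B g)) \<le> \<epsilon> ^ Suc n" by simp
  qed (use Suc.prems countable_S self_avoiding_events pair_events in auto)
  then show ?case unfolding eq .
qed (simp add: prob_space)

lemma AE_finite_degree:
  assumes f: "f \<in> S"
  shows "AE x in M. finite (pair_graph x `` {f})"
proof -
  have "AE x in M. finite {g\<in>S - {f}. x \<in> Ev {f, g}}"
  proof (rule AE_finite_finite_sums)
    fix F assume F: "finite F" "F \<subseteq> S - {f}"
    have "(\<Sum>g\<in>F. prob (Ev {f, g})) \<le> (\<Sum>g\<in>F. c f g)"
      using F f by (intro sum_mono pair_prob) auto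
    then show "(\<Sum>g\<in>F. prob (Ev {f, g})) \<le> \<epsilon>" using pair_sum[OF f F] by simp
  qed (use f countable_S pair_events in auto)
  moreover have "pair_graph x `` {f} = {g\<in>S - {f}. x \<in> Ev {f, g}}" for x
    using f by (auto simp: pair_graph_def)
  ultimately show ?thesis by simp
qed

lemma AE_finite_component:
  assumes "\<epsilon> < 1"
  shows "AE x in M. \<forall>f\<in>S. finite (reach_avoiding (pair_graph x) {} f)"
proof -
  have "AE x in M. \<exists>n. \<not> self_avoiding (pair_graph x) n f {}" if f: "f \<in> S" for f
  proof -
    let ?A = "\<lambda>n. {x\<in>space M. self_avoiding (pair_graph x) n f {}}"
    have A: "?A n \<in> events" for n using f by (intro self_avoiding_events) auto
    let ?I = "{x\<in>space M. \<forall>n. self_avoiding (pair_graph x) n f {}}"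
    have I: "?I \<in> events" using A by (intro sets.sets_Collect_countable_All)
    have "prob ?I \<le> \<epsilon> ^ n" for n
    proof -
      have "prob ?I \<le> prob (?A n)" using A by (intro finite_measure_mono) auto
      also have "\<dots> \<le> \<epsilon> ^ n" using f by (intro prob_self_avoiding_le) auto
      finally show ?thesis .
    qed
    moreover have "(\<lambda>n. \<epsilon> ^ n) \<longlonglongrightarrow> 0" using eps_nonneg[OF f] assms by (intro LIMSEQ_power_zero) simp
    ultimately have "prob ?I \<le> 0" by (intro LIMSEQ_le_const[of "\<lambda>n. \<epsilon> ^ n" 0]) auto
    then have "prob ?I = 0" using measure_nonneg[of M "?I"] by linarith
    then have "AE x in M. x \<notin> ?I" using prob_eq_0[OF I] by simp
    then show ?thesis by (rule AE_mp) (auto intro!: AE_I2)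
  qed
  then have "AE x in M. \<forall>f\<in>S. (\<exists>n. \<not> self_avoiding (pair_graph x) n f {}) \<and> finite (pair_graph x `` {f})"
    using AE_finite_degree countable_S by (simp add: AE_ball_countable)
  then show ?thesis
  proof (rule AE_mp, intro AE_I2 impI ballI)
    fix x f assume *: "\<forall>f\<in>S. (\<exists>n. \<not> self_avoiding (pair_graph x) n f {}) \<and> finite (pair_graph x `` {f})"
      and f: "f \<in> S"
    have fin: "finite (pair_graph x `` {g})" for g
      using * by (cases "g \<in> S") (auto simp: pair_graph_def)
    obtain n where "\<not> self_avoiding (pair_graph x) n f {}" using * f by blast
    then show "finite (reach_avoiding (pair_graph x) {} f)" by (rule finite_reach_avoiding[OF fin])
  qed
qed

end


section \<open>Rings of the clocks\<close>

text \<open>The \<open>n\<close>-th ring time of a clock of rate \<open>l\<close> has an Erlang density, and these densities add up to the constant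
  \<open>l\<close>: up to the factor \<open>l\<close> they are the Poisson weights. Consequently the expected number of rings in an
  interval is at most \<open>l\<close> times its length, wherever the interval lies.\<close>

lemma sum_erlang_density_le:
  assumes "0 < l" "finite N"
  shows "(\<Sum>n\<in>N. erlang_density n l x) \<le> l"
proof (cases "x < 0")
  case True
  then show ?thesis using assms by (simp add: erlang_density_def)
next
  case False
  have "(\<Sum>n\<in>N. erlang_density n l x) = l * exp (- (l * x)) * (\<Sum>n\<in>N. (l * x) ^ n /\<^sub>R fact n)"
    using False by (simp add: erlang_density_def sum_distrib_left power_mult_distrib field_simps)
  also have "(\<Sum>n\<in>N. (l * x) ^ n /\<^sub>R fact n) \<le> (\<Sum>n. (l * x) ^ n /\<^sub>R fact n)"
    using assms False by (intro sum_le_suminf summable_exp_generic) auto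
  also have "(\<Sum>n. (l * x) ^ n /\<^sub>R fact n) = exp (l * x)"
    by (simp add: exp_def)
  finally show ?thesis using assms by (simp add: mult_left_mono exp_minus field_simps)
qed

lemma (in prob_space) AE_neq_indep_density:
  fixes X Y :: "'a \<Rightarrow> real"
  assumes X: "distributed M lborel X f" and ind: "indep_var borel X borel Y"
  shows "AE x in M. X x \<noteq> Y x"
proof -
  have rv [measurable]: "X \<in> borel_measurable M" "Y \<in> borel_measurable M"
    using indep_var_rv1[OF ind] indep_var_rv2[OF ind] .
  interpret DX: prob_space "distr M borel X" by (rule prob_space_distr) simp
  interpret DY: prob_space "distr M borel Y" by (rule prob_space_distr) simp
  interpret D: pair_prob_space "distr M borel X" "distr M borel Y" ..
  have eq: "distr M borel X \<Otimes>\<^sub>M distr M borel Y = distr M (borel \<Otimes>\<^sub>M borel) (\<lambda>x. (X x, Y x))"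
    using ind by (simp add: indep_var_distribution_eq)
  have diag: "{z::real \<times> real. fst z = snd z} \<in> sets (borel \<Otimes>\<^sub>M borel)"
  proof -
    have "{z\<in>space (borel \<Otimes>\<^sub>M borel). fst z = snd (z::real \<times> real)} \<in> sets (borel \<Otimes>\<^sub>M borel)"
      by measurable
    then show ?thesis by (simp add: space_pair_measure)
  qed
  have null: "emeasure (distr M borel X) {y} = 0" for y
  proof -
    have "emeasure (distr M borel X) {y} = emeasure M (X -` {y} \<inter> space M)"
      by (simp add: emeasure_distr)
    also have "\<dots> = (\<integral>\<^sup>+x. f x * indicator {y} x \<partial>lborel)"
      by (rule distributed_emeasure[OF X]) simp
    also have "\<dots> = 0"
      using AE_lborel_singleton[of y] by (intro nn_integral_zero') (auto elim!: AE_mp)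
    finally show ?thesis .
  qed
  have "emeasure M {x\<in>space M. X x = Y x} = emeasure (distr M (borel \<Otimes>\<^sub>M borel) (\<lambda>x. (X x, Y x))) {z. fst z = snd z}"
    using diag by (subst emeasure_distr) (auto intro!: arg_cong[where f="emeasure M"])
  also have "\<dots> = emeasure (distr M borel X \<Otimes>\<^sub>M distr M borel Y) {z. fst z = snd z}"
    by (simp add: eq)
  also have "\<dots> = (\<integral>\<^sup>+y. emeasure (distr M borel X) ((\<lambda>x. (x, y)) -` {z. fst z = snd z}) \<partial>distr M borel Y)"
    using diag by (intro D.emeasure_pair_measure_alt2) (simp cong: sets_pair_measure_cong)
  also have "\<dots> = (\<integral>\<^sup>+y. 0 \<partial>distr M borel Y)"
  proof -
    have "(\<lambda>x. (x, y)) -` {z::real \<times> real. fst z = snd z} = {y}" for y by auto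
    then show ?thesis using null by simp
  qed
  finally have "emeasure M {x\<in>space M. X x = Y x} = 0" by simp
  moreover have "{x\<in>space M. X x = Y x} \<in> sets M" by measurable
  ultimately show ?thesis
    by (intro AE_I[where N="{x\<in>space M. X x = Y x}"]) auto
qed

locale exclusion_percolation = exclusion_randomness M S K p X0 W
  for M :: "'m measure" and S :: "'i set" and K p X0 W +
  assumes countable_S: "countable S"
    and K: "symmetric_transition_matrix S K"
    and p: "p \<in> {0..1}"
begin

abbreviation pairs :: "'i set set" where "pairs \<equiv> clock_pairs S K"

abbreviation clock_space :: "('i set \<times> nat \<Rightarrow> real) measure" where
  "clock_space \<equiv> (\<Pi>\<^sub>M j\<in>pairs \<times> UNIV. borel)"

definition clocks :: "'m \<Rightarrow> 'i set \<times> nat \<Rightarrow> real" where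
  "clocks x = (\<lambda>(a, n)\<in>pairs \<times> UNIV. W a n x)"

text \<open>The clocks are treated as a function of the waiting times alone, in order to express which events
  depend on them only. The value \<open>0\<close> for pairs without a clock keeps the function measurable in all
  cases.\<close>

definition ring_time :: "('i set \<times> nat \<Rightarrow> real) \<Rightarrow> 'i set \<Rightarrow> nat \<Rightarrow> real" where
  "ring_time w a n = (if a \<in> pairs then \<Sum>i\<le>n. w (a, i) else 0)"

definition rings :: "('i set \<times> nat \<Rightarrow> real) \<Rightarrow> 'i set \<Rightarrow> real set" where
  "rings w a = (if a \<in> pairs then range (ring_time w a) else {})"

lemma rings_clocks: "rings (clocks x) = ring_times S K W x"
  by (auto simp: fun_eq_iff rings_def ring_times_def ring_time_def clocks_def)

lemma pairs_cases:
  assumes "a \<in> pairs" obtains e f where "a = {e, f}" "e \<in> S" "f \<in> S" "e \<noteq> f" "0 < K e f"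
  using assms by (auto simp: clock_pairs_def)

lemma pair_rate_pos: "f \<in> S \<Longrightarrow> g \<in> S - {f} \<Longrightarrow> {f, g} \<in> pairs \<Longrightarrow> 0 < K f g"
  using K by (auto simp: clock_pairs_def doubleton_eq_iff symmetric_transition_matrix_def)

lemma countable_pairs: "countable pairs"
proof (rule countable_subset)
  show "pairs \<subseteq> (\<lambda>(e, f). {e, f}) ` (S \<times> S)" by (auto simp: clock_pairs_def)
  show "countable ((\<lambda>(e, f). {e, f}) ` (S \<times> S))" using countable_S by auto
qed

lemma sum_rates_le:
  assumes "f \<in> S" "finite F" "F \<subseteq> S" shows "(\<Sum>g\<in>F. K f g) \<le> 1"
proof (rule has_sum_mono2[of "K f" F _ S])
  show "(K f has_sum (\<Sum>g\<in>F. K f g)) F" using assms by (intro has_sum_finiteI) auto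
  show "(K f has_sum 1) S" using K assms by (auto simp: symmetric_transition_matrix_def)
qed (use K assms in \<open>auto simp: symmetric_transition_matrix_def\<close>)

lemma waiting_measurable: "a \<in> pairs \<Longrightarrow> W a n \<in> borel_measurable M"
  using waiting_indep by (auto simp: indep_vars_def2)

lemma clocks_measurable [measurable]: "clocks \<in> measurable M clock_space"
proof -
  have "(\<lambda>x. \<lambda>j\<in>pairs \<times> UNIV. (case j of (a, n) \<Rightarrow> W a n) x) \<in> measurable M clock_space"
    using waiting_measurable by (intro measurable_restrict) auto
  moreover have "(\<lambda>x. \<lambda>j\<in>pairs \<times> UNIV. (case j of (a, n) \<Rightarrow> W a n) x) = clocks"
    by (auto simp: fun_eq_iff clocks_def)
  ultimately show ?thesis by simp
qed

text \<open>The only place where the independence of the initial configuration and the clocks enters.\<close>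

lemma initial_indep_clocks:
  assumes A: "A \<in> sets (bernoulli_percolation S p)" and H: "H \<in> sets clock_space"
  shows "prob {x\<in>space M. X0 x \<in> A \<and> clocks x \<in> H} = prob {x\<in>space M. X0 x \<in> A} * prob {x\<in>space M. clocks x \<in> H}"
proof -
  have "prob ((X0 -` A \<inter> space M) \<inter> (clocks -` H \<inter> space M))
      = prob (X0 -` A \<inter> space M) * prob (clocks -` H \<inter> space M)"
    using initial_indep_waiting
  proof (rule indep_setD)
    show "X0 -` A \<inter> space M \<in> sets (vimage_algebra (space M) X0 (bernoulli_percolation S p))"
      using A by (rule in_vimage_algebra)
    show "clocks -` H \<inter> space M \<in> sets (vimage_algebra (space M)
            (\<lambda>x. \<lambda>(a, n)\<in>pairs \<times> UNIV. W a n x) clock_space)"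
      using in_vimage_algebra[OF H, of clocks "space M"] by (simp add: clocks_def[abs_def])
  qed
  moreover have "(X0 -` A \<inter> space M) \<inter> (clocks -` H \<inter> space M) = {x\<in>space M. X0 x \<in> A \<and> clocks x \<in> H}"
    "X0 -` A \<inter> space M = {x\<in>space M. X0 x \<in> A}" "clocks -` H \<inter> space M = {x\<in>space M. clocks x \<in> H}" by auto
  ultimately show ?thesis by simp
qed

lemma ring_time_measurable [measurable]: "(\<lambda>w. ring_time w a n) \<in> borel_measurable clock_space"
proof (cases "a \<in> pairs")
  case True
  then have "(\<lambda>w. \<Sum>i\<le>n. w (a, i)) \<in> borel_measurable clock_space"
    by (intro borel_measurable_sum measurable_component_singleton) auto
  then show ?thesis using True by (simp add: ring_time_def)
qed (simp add: ring_time_def)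

lemma rings_meet_iff: "a \<in> pairs \<Longrightarrow> rings w a \<inter> I \<noteq> {} \<longleftrightarrow> (\<exists>n. ring_time w a n \<in> I)"
  by (auto simp: rings_def)

lemma sets_rings_meet:
  assumes "I \<in> sets borel"
  shows "{w\<in>space clock_space. rings w a \<inter> I \<noteq> {}} \<in> sets clock_space"
proof (cases "a \<in> pairs")
  case True
  have "{w\<in>space clock_space. \<exists>n. ring_time w a n \<in> I} \<in> sets clock_space"
    using assms by measurable
  then show ?thesis using True by (simp only: rings_meet_iff)
qed (simp add: rings_def)

lemma waiting_indep_single:
  assumes a: "a \<in> pairs"
  shows "indep_vars (\<lambda>_. borel) (W a) UNIV"
  unfolding indep_vars_def2
proof (intro conjI ballI)
  show "random_variable borel (W a n)" for n using waiting_measurable[OF a] .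
  have ind: "indep_sets (\<lambda>j. {(case j of (a, n) \<Rightarrow> W a n) -` A \<inter> space M |A. A \<in> sets borel}) (pairs \<times> UNIV)"
    using waiting_indep by (simp add: indep_vars_def2)
  show "indep_sets (\<lambda>i. {W a i -` A \<inter> space M |A. A \<in> sets borel}) UNIV"
  proof (rule indep_setsI)
    show "{W a i -` A \<inter> space M |A. A \<in> sets borel} \<subseteq> events" for i
      using waiting_measurable[OF a] by (auto simp: measurable_sets)
    fix A and J :: "nat set" assume J: "J \<noteq> {}" "finite J" "\<forall>j\<in>J. A j \<in> {W a j -` A \<inter> space M |A. A \<in> sets borel}"
    have "prob (\<Inter>j\<in>Pair a ` J. A (snd j)) = (\<Prod>j\<in>Pair a ` J. prob (A (snd j)))"
      using J a by (intro indep_setsD[OF ind]) auto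
    then show "prob (\<Inter>j\<in>J. A j) = (\<Prod>j\<in>J. prob (A j))"
      by (simp add: prod.reindex inj_on_def image_image)
  qed
qed

lemma ring_time_distributed:
  assumes "f \<in> S" "g \<in> S - {f}" "{f, g} \<in> pairs"
  shows "distributed M lborel (\<lambda>x. ring_time (clocks x) {f, g} n) (erlang_density n (K f g))"
proof -
  have "distributed M lborel (\<lambda>x. \<Sum>i\<le>n. W {f, g} i x) (erlang_density (card {..n} - 1) (K f g))"
    using assms pair_rate_pos[OF assms]
    by (intro exponential_distributed_sum waiting_distributed
        indep_vars_subset[OF waiting_indep_single]) auto
  then show ?thesis using assms by (simp add: ring_time_def clocks_def)
qed

lemma sum_ring_prob_le:
  assumes fg: "f \<in> S" "g \<in> S - {f}" "{f, g} \<in> pairs" and "finite N" "s \<le> t"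
  shows "(\<Sum>n\<in>N. prob {x\<in>space M. ring_time (clocks x) {f, g} n \<in> {s<..t}}) \<le> K f g * (t - s)"
proof -
  have pos: "0 < K f g" by (rule pair_rate_pos[OF fg])
  have eq: "{x\<in>space M. ring_time (clocks x) {f, g} n \<in> {s<..t}}
      = (\<lambda>x. ring_time (clocks x) {f, g} n) -` {s<..t} \<inter> space M" for n by blast
  have "ennreal (\<Sum>n\<in>N. prob {x\<in>space M. ring_time (clocks x) {f, g} n \<in> {s<..t}})
      = (\<Sum>n\<in>N. emeasure M ((\<lambda>x. ring_time (clocks x) {f, g} n) -` {s<..t} \<inter> space M))"
    unfolding emeasure_eq_measure eq by (rule sum_ennreal[symmetric]) simp
  also have "\<dots> = (\<Sum>n\<in>N. \<integral>\<^sup>+x. ennreal (erlang_density n (K f g) x) * indicator {s<..t} x \<partial>lborel)"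
    by (intro sum.cong distributed_emeasure[OF ring_time_distributed[OF fg]]) auto
  also have "\<dots> = (\<integral>\<^sup>+x. (\<Sum>n\<in>N. ennreal (erlang_density n (K f g) x) * indicator {s<..t} x) \<partial>lborel)"
    by (intro nn_integral_sum[symmetric]) auto
  also have "\<dots> \<le> (\<integral>\<^sup>+x. ennreal (K f g) * indicator {s<..t} x \<partial>lborel)"
  proof (intro nn_integral_mono)
    fix x
    have "(\<Sum>n\<in>N. ennreal (erlang_density n (K f g) x)) = ennreal (\<Sum>n\<in>N. erlang_density n (K f g) x)"
      using pos by (intro sum_ennreal) auto
    also have "\<dots> \<le> ennreal (K f g)" by (intro ennreal_leI sum_erlang_density_le pos assms)
    finally show "(\<Sum>n\<in>N. ennreal (erlang_density n (K f g) x) * indicator {s<..t} x)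
        \<le> ennreal (K f g) * indicator {s<..t} x"
      by (auto simp: sum_distrib_right[symmetric] intro!: mult_right_mono)
  qed
  also have "\<dots> = ennreal (K f g * (t - s))"
    using pos \<open>s \<le> t\<close> by (simp add: nn_integral_cmult_indicator ennreal_mult)
  finally show ?thesis using pos \<open>s \<le> t\<close> by (simp add: ennreal_le_iff)
qed

definition ring_event :: "real \<Rightarrow> real \<Rightarrow> 'i set \<Rightarrow> 'm set" where
  "ring_event s t a = {x\<in>space M. rings (clocks x) a \<inter> {s<..t} \<noteq> {}}"

lemma ring_event_clocks:
  "ring_event s t a = {x\<in>space M. clocks x \<in> {w\<in>space clock_space. rings w a \<inter> {s<..t} \<noteq> {}}}"
  using measurable_space[OF clocks_measurable] by (auto simp: ring_event_def)

lemma ring_event_sets: "ring_event s t a \<in> events"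
proof -
  have "{w\<in>space clock_space. rings w a \<inter> {s<..t} \<noteq> {}} \<in> sets clock_space"
    by (intro sets_rings_meet) simp
  from measurable_sets[OF clocks_measurable this] show ?thesis
    by (simp add: ring_event_clocks vimage_def Int_def conj_commute)
qed

lemma ring_event_empty: "a \<notin> pairs \<Longrightarrow> ring_event s t a = {}"
  by (simp add: ring_event_def rings_def)

lemma ring_time_event_sets: "{x\<in>space M. ring_time (clocks x) a n \<in> {s<..t}} \<in> events"
  by measurable

lemma prob_ring_event_le:
  assumes fg: "f \<in> S" "g \<in> S - {f}" and "s \<le> t"
  shows "prob (ring_event s t {f, g}) \<le> K f g * (t - s)"
proof (cases "{f, g} \<in> pairs")
  case True
  have "ring_event s t {f, g} = (\<Union>n. {x\<in>space M. ring_time (clocks x) {f, g} n \<in> {s<..t}})"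
    using True by (auto simp: ring_event_def rings_def)
  moreover have "prob (\<Union>n. {x\<in>space M. ring_time (clocks x) {f, g} n \<in> {s<..t}}) \<le> K f g * (t - s)"
    using sum_ring_prob_le[OF fg True _ \<open>s \<le> t\<close>] ring_time_event_sets
    by (intro measure_Union_le_finite_sums) auto
  ultimately show ?thesis by simp
next
  case False
  have "0 \<le> K f g" using K fg by (auto simp: symmetric_transition_matrix_def)
  then show ?thesis using False \<open>s \<le> t\<close> by (simp add: ring_event_empty)
qed

text \<open>The expected number of rings is finite, so the first Borel-Cantelli lemma applies.\<close>

lemma AE_finite_rings:
  assumes "s \<le> t"
  shows "AE x in M. \<forall>a\<in>pairs. finite (rings (clocks x) a \<inter> {s<..t})"
proof (subst AE_ball_countable[OF countable_pairs], intro ballI)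
  fix a assume a: "a \<in> pairs"
  then obtain f g where fg: "a = {f, g}" "f \<in> S" "g \<in> S - {f}" by (auto elim!: pairs_cases)
  have "AE x in M. finite {n\<in>UNIV. x \<in> {x\<in>space M. ring_time (clocks x) a n \<in> {s<..t}}}"
    using sum_ring_prob_le[OF fg(2,3) _ _ assms] a fg(1) ring_time_event_sets
    by (intro AE_finite_finite_sums[where c="K f g * (t - s)"]) auto
  then show "AE x in M. finite (rings (clocks x) a \<inter> {s<..t})"
  proof (rule AE_mp, intro AE_I2 impI)
    fix x assume x: "x \<in> space M" "finite {n\<in>UNIV. x \<in> {x\<in>space M. ring_time (clocks x) a n \<in> {s<..t}}}"
    have "rings (clocks x) a \<inter> {s<..t} \<subseteq> ring_time (clocks x) a `
        {n\<in>UNIV. x \<in> {x\<in>space M. ring_time (clocks x) a n \<in> {s<..t}}}"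
      using a x(1) by (auto simp: rings_def)
    then show "finite (rings (clocks x) a \<inter> {s<..t})" using x(2) finite_surj by blast
  qed
qed

lemma AE_rings_positive: "AE x in M. \<forall>a\<in>pairs. rings (clocks x) a \<subseteq> {0<..}"
proof -
  have "AE x in M. \<forall>n. 0 < W a n x" if a: "a \<in> pairs" for a
  proof (subst AE_all_countable, intro allI)
    fix n
    obtain e f where ef: "a = {e, f}" "e \<in> S" "f \<in> S" "e \<noteq> f" "0 < K e f" using a by (rule pairs_cases)
    have "prob {x\<in>space M. W a n x \<le> 0} = 0"
      using exponential_distributedD_le[OF waiting_distributed[OF ef(2-5), of n] order_refl ef(5)]
      unfolding ef(1) by simp
    moreover have sets: "{x\<in>space M. W a n x \<le> 0} \<in> events"
      by (rule borel_measurable_le[OF waiting_measurable[OF a] borel_measurable_const])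
    ultimately have "AE x in M. x \<notin> {x\<in>space M. W a n x \<le> 0}" using prob_eq_0[OF sets] by simp
    then show "AE x in M. 0 < W a n x" by (rule AE_mp) (intro AE_I2 impI, simp)
  qed
  then have "AE x in M. \<forall>a\<in>pairs. \<forall>n. 0 < W a n x" using countable_pairs by (simp add: AE_ball_countable)
  then show ?thesis
    by (rule AE_mp) (auto intro!: AE_I2 sum_pos simp: rings_def ring_time_def clocks_def)
qed

lemma AE_rings_distinct: "AE x in M. \<forall>a\<in>pairs. \<forall>b\<in>pairs. a \<noteq> b \<longrightarrow> rings (clocks x) a \<inter> rings (clocks x) b = {}"
proof -
  have "AE x in M. ring_time (clocks x) a n \<noteq> ring_time (clocks x) b m"
    if ab: "a \<in> pairs" "b \<in> pairs" "a \<noteq> b" for a b n m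
  proof -
    obtain f g where fg: "a = {f, g}" "f \<in> S" "g \<in> S - {f}" using ab(1) by (auto elim!: pairs_cases)
    let ?Z = "\<lambda>a x. restrict (\<lambda>j. (case j of (a, n) \<Rightarrow> W a n) x) ({a} \<times> UNIV)"
    let ?sum = "\<lambda>a n (w :: 'i set \<times> nat \<Rightarrow> real). \<Sum>i\<le>n. w (a, i)"
    have "indep_var (\<Pi>\<^sub>M j\<in>{a} \<times> UNIV. borel) (?Z a) (\<Pi>\<^sub>M j\<in>{b} \<times> UNIV. borel) (?Z b)"
      using ab by (intro indep_var_restrict[OF waiting_indep]) auto
    then have "indep_var borel (?sum a n \<circ> ?Z a) borel (?sum b m \<circ> ?Z b)"
      by (rule indep_var_compose) (auto intro!: borel_measurable_sum measurable_component_singleton)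
    moreover have "?sum a n \<circ> ?Z a = (\<lambda>x. ring_time (clocks x) a n)"
      "?sum b m \<circ> ?Z b = (\<lambda>x. ring_time (clocks x) b m)"
      using ab by (auto simp: fun_eq_iff ring_time_def clocks_def)
    ultimately have "indep_var borel (\<lambda>x. ring_time (clocks x) a n) borel (\<lambda>x. ring_time (clocks x) b m)"
      by simp
    then show ?thesis using AE_neq_indep_density ring_time_distributed[OF fg(2,3)] ab(1) fg(1) by blast
  qed
  then have "AE x in M. \<forall>a\<in>pairs. \<forall>b\<in>pairs. a \<noteq> b \<longrightarrow> (\<forall>n m. ring_time (clocks x) a n \<noteq> ring_time (clocks x) b m)"
    using countable_pairs by (simp add: AE_ball_countable AE_all_countable)
  then show ?thesis by (rule AE_mp) (auto intro!: AE_I2 simp: rings_def)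
qed

lemma indep_ring_events: "indep_events (ring_event s t) pairs"
proof -
  let ?Z = "\<lambda>a x. restrict (\<lambda>j. (case j of (a, n) \<Rightarrow> W a n) x) ({a} \<times> UNIV)"
  have "indep_vars (\<lambda>a. \<Pi>\<^sub>M j\<in>{a} \<times> UNIV. borel) (\<lambda>a x. ?Z a x) pairs"
    by (intro indep_vars_restrict[OF waiting_indep]) (auto simp: disjoint_family_on_def)
  then have ind: "indep_events (\<lambda>a. {x\<in>space M. (\<exists>n. (\<Sum>i\<le>n. ?Z a x (a, i)) \<in> {s<..t})}) pairs"
  proof (rule indep_eventsI_indep_vars)
    fix a
    let ?C = "\<Pi>\<^sub>M j\<in>{a} \<times> (UNIV :: nat set). (borel :: real measure)"
    have m: "(\<lambda>w. \<Sum>i\<le>n. w (a, i)) \<in> borel_measurable ?C" for n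
      by (intro borel_measurable_sum measurable_component_singleton) auto
    have "(\<Union>n. (\<lambda>w. \<Sum>i\<le>n. w (a, i)) -` {s<..t} \<inter> space ?C) \<in> sets ?C"
      by (intro sets.countable_UN'' measurable_sets[OF m]) auto
    moreover have "{w\<in>space ?C. \<exists>n. (\<Sum>i\<le>n. w (a, i)) \<in> {s<..t}}
        = (\<Union>n. (\<lambda>w. \<Sum>i\<le>n. w (a, i)) -` {s<..t} \<inter> space ?C)" by blast
    ultimately show "{w\<in>space ?C. \<exists>n. (\<Sum>i\<le>n. w (a, i)) \<in> {s<..t}} \<in> sets ?C" by simp
  qed
  have eq: "{x\<in>space M. (\<exists>n. (\<Sum>i\<le>n. ?Z a x (a, i)) \<in> {s<..t})} = ring_event s t a" if "a \<in> pairs" for a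
    unfolding ring_event_def rings_meet_iff[OF that] using that by (simp add: ring_time_def clocks_def)
  show ?thesis
    using ind unfolding indep_events_def_alt
    by (rule indep_sets_cong[OF refl, THEN iffD1, rotated]) (simp only: eq)
qed

lemma independent_pairs_rings:
  assumes "s \<le> t"
  shows "independent_pairs M S pairs (ring_event s t) (\<lambda>f g. K f g * (t - s)) (t - s)"
proof
  show "countable S" by (rule countable_S)
  show "indep_events (ring_event s t) pairs" by (rule indep_ring_events)
  show "ring_event s t {f, g} = {}" if "{f, g} \<notin> pairs" for f g using that by (rule ring_event_empty)
  show "prob (ring_event s t {f, g}) \<le> K f g * (t - s)" if "f \<in> S" "g \<in> S - {f}" for f g
    using that assms by (rule prob_ring_event_le)
  show "(\<Sum>g\<in>F. K f g * (t - s)) \<le> t - s" if "f \<in> S" "finite F" "F \<subseteq> S - {f}" for f F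
    using sum_rates_le[of f F] that assms mult_right_mono[of "sum (K f) F" 1 "t - s"]
    by (auto simp: sum_distrib_right[symmetric])
qed

text \<open>Each site takes part in a pair that rings during a slab with probability at most \<open>\<epsilon>\<close>. For \<open>\<epsilon> < 1\<close> the paths of such pairs die out and all components are finite.\<close>

lemma AE_exchange_flow:
  assumes eps: "0 < \<epsilon>" "\<epsilon> < 1"
  shows "AE x in M. exchange_flow S (rings (clocks x)) \<epsilon>"
proof -
  have comp: "AE x in M. \<forall>f\<in>S. \<exists>C. finite C \<and> C \<subseteq> S \<and> f \<in> C \<and>
      (\<forall>g\<in>C. \<forall>h\<in>S - {g}. rings (clocks x) {g, h} \<inter> {real k * \<epsilon><..real (Suc k) * \<epsilon>} \<noteq> {} \<longrightarrow> h \<in> C)" for k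
  proof -
    have step: "real (Suc k) * \<epsilon> - real k * \<epsilon> = \<epsilon>" by (simp add: algebra_simps)
    interpret R: independent_pairs M S pairs "ring_event (real k * \<epsilon>) (real (Suc k) * \<epsilon>)" "\<lambda>f g. K f g * \<epsilon>" \<epsilon>
      using independent_pairs_rings[of "real k * \<epsilon>" "real (Suc k) * \<epsilon>"] eps step by simp
    from R.AE_finite_component[OF eps(2)] show ?thesis
    proof (rule AE_mp, intro AE_I2 impI ballI)
      fix x f assume x: "x \<in> space M" "\<forall>f\<in>S. finite (reach_avoiding (R.pair_graph x) {} f)" and f: "f \<in> S"
      let ?C = "reach_avoiding (R.pair_graph x) {} f"
      have sub: "?C \<subseteq> S"
      proof
        fix w assume "w \<in> ?C"
        then have "(f, w) \<in> {(a, b). (a, b) \<in> R.pair_graph x \<and> b \<notin> {}}\<^sup>*" by (simp add: reach_avoiding_def)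
        then show "w \<in> S" by (induction rule: rtrancl_induct) (auto simp: R.pair_graph_def f simp del: of_nat_Suc)
      qed
      have "h \<in> ?C" if "g \<in> ?C" "h \<in> S - {g}"
        "rings (clocks x) {g, h} \<inter> {real k * \<epsilon><..real (Suc k) * \<epsilon>} \<noteq> {}" for g h
      proof -
        have "(g, h) \<in> R.pair_graph x"
          using that x(1) sub by (auto simp: R.pair_graph_def ring_event_def simp del: of_nat_Suc)
        then show ?thesis using that(1)
          by (auto simp: reach_avoiding_def intro: rtrancl.rtrancl_into_rtrancl)
      qed
      moreover have "f \<in> ?C" by (simp add: reach_avoiding_def)
      ultimately show "\<exists>C. finite C \<and> C \<subseteq> S \<and> f \<in> C \<and>
          (\<forall>g\<in>C. \<forall>h\<in>S - {g}. rings (clocks x) {g, h} \<inter> {real k * \<epsilon><..real (Suc k) * \<epsilon>} \<noteq> {} \<longrightarrow> h \<in> C)"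
        using x(2) f sub by (intro exI[of _ ?C]) simp
    qed
  qed
  have fin: "AE x in M. \<forall>a\<in>pairs. finite (rings (clocks x) a \<inter> {real k * \<epsilon><..real (Suc k) * \<epsilon>})" for k
    using eps by (intro AE_finite_rings) (simp add: algebra_simps)
  have "AE x in M. \<forall>k. \<forall>f\<in>S. \<exists>C. finite C \<and> C \<subseteq> S \<and> f \<in> C \<and>
      (\<forall>g\<in>C. \<forall>h\<in>S - {g}. rings (clocks x) {g, h} \<inter> {real k * \<epsilon><..real (Suc k) * \<epsilon>} \<noteq> {} \<longrightarrow> h \<in> C)"
    using comp by (subst AE_all_countable) (rule allI)
  moreover have "AE x in M. \<forall>k. \<forall>a\<in>pairs. finite (rings (clocks x) a \<inter> {real k * \<epsilon><..real (Suc k) * \<epsilon>})"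
    using fin by (subst AE_all_countable) (rule allI)
  ultimately show ?thesis using AE_rings_positive AE_rings_distinct
  proof eventually_elim
    case (elim x)
    show ?case
    proof
      show "0 < t" if "f \<in> S" "g \<in> S - {f}" "t \<in> rings (clocks x) {f, g}" for f g t
        using that elim(3) by (cases "{f, g} \<in> pairs") (auto simp: rings_def)
      show "g = h" if "f \<in> S" "g \<in> S - {f}" "h \<in> S - {f}" "t \<in> rings (clocks x) {f, g}"
        "t \<in> rings (clocks x) {f, h}" for f g h t
      proof (rule ccontr)
        assume "g \<noteq> h"
        then have "{f, g} \<noteq> {f, h}" by (auto simp: doubleton_eq_iff)
        moreover have "{f, g} \<in> pairs" "{f, h} \<in> pairs" using that(4,5) by (auto simp: rings_def split: if_splits)
        ultimately have "rings (clocks x) {f, g} \<inter> rings (clocks x) {f, h} = {}" using elim(4) by simp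
        then show False using that(4,5) by auto
      qed
      show "0 < \<epsilon>" by (rule eps)
      fix k :: nat and f assume f: "f \<in> S"
      have *: "finite (rings (clocks x) {g, h} \<inter> {real k * \<epsilon><..real (Suc k) * \<epsilon>})" for g h
        using elim(2) by (cases "{g, h} \<in> pairs") (auto simp: rings_def)
      show "\<exists>C. finite C \<and> C \<subseteq> S \<and> f \<in> C \<and>
          (\<forall>g\<in>C. \<forall>h\<in>S - {g}. rings (clocks x) {g, h} \<inter> {real k * \<epsilon><..real (Suc k) * \<epsilon>} \<noteq> {} \<longrightarrow> h \<in> C) \<and>
          (\<forall>g\<in>C. \<forall>h\<in>C - {g}. finite (rings (clocks x) {g, h} \<inter> {real k * \<epsilon><..real (Suc k) * \<epsilon>}))"
      proof -
        obtain C where "finite C" "C \<subseteq> S" "f \<in> C"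
          "\<forall>g\<in>C. \<forall>h\<in>S - {g}. rings (clocks x) {g, h} \<inter> {real k * \<epsilon><..real (Suc k) * \<epsilon>} \<noteq> {} \<longrightarrow> h \<in> C"
          using bspec[OF spec[OF elim(1), of k] f] by (elim exE conjE) (rule that)
        then show ?thesis using * by (intro exI[of _ C]) (simp del: of_nat_Suc)
      qed
    qed
  qed
qed

end


section \<open>Independence of the configuration and the clocks\<close>

context exclusion_percolation
begin

text \<open>An explicit form of \<open>carried\<close> as a countable disjunction. The finitely many exchanges are recorded, the
  latest first, as the new site together with the number of the ring that leads to it. The inductive
  definition quantifies over real times and does not show measurability; there are only countably many
  such lists, and for each of them the condition is a measurable one on the waiting times.\<close>

primrec jump_site :: "'i \<Rightarrow> ('i \<times> nat) list \<Rightarrow> 'i" where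
  "jump_site e [] = e"
| "jump_site e (j # L) = fst j"

primrec jump_time :: "('i set \<times> nat \<Rightarrow> real) \<Rightarrow> 'i \<Rightarrow> ('i \<times> nat) list \<Rightarrow> real" where
  "jump_time w e [] = 0"
| "jump_time w e (j # L) = ring_time w {jump_site e L, fst j} (snd j)"

primrec follows_rings :: "('i set \<times> nat \<Rightarrow> real) \<Rightarrow> 'i \<Rightarrow> ('i \<times> nat) list \<Rightarrow> bool" where
  "follows_rings w e [] \<longleftrightarrow> e \<in> S"
| "follows_rings w e (j # L) \<longleftrightarrow> follows_rings w e L \<and>
    fst j \<in> S - {jump_site e L} \<and> {jump_site e L, fst j} \<in> pairs \<and>
    jump_time w e L < ring_time w {jump_site e L, fst j} (snd j) \<and>
    (\<forall>h\<in>S - {jump_site e L}. rings w {jump_site e L, h} \<inter>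
       {jump_time w e L<..<ring_time w {jump_site e L, fst j} (snd j)} = {})"

lemma follows_rings_carried:
  "follows_rings w e L \<Longrightarrow> carried S (rings w) e (jump_time w e L) (jump_site e L)"
proof (induction L)
  case Nil
  then show ?case by (simp add: carried.start)
next
  case (Cons j L)
  then have c: "carried S (rings w) e (jump_time w e L) (jump_site e L)" by simp
  have "ring_time w {jump_site e L, fst j} (snd j) \<in> rings w {jump_site e L, fst j}"
    using Cons.prems by (simp add: rings_def)
  then show ?case using Cons.prems carried.exchange[OF c, of "ring_time w {jump_site e L, fst j} (snd j)" "fst j"]
    by simp
qed

lemma follows_rings_lists: "follows_rings w e L \<Longrightarrow> L \<in> lists (S \<times> UNIV)"
  by (induction L) (auto simp: mem_Times_iff)

lemma carried_iff_follows_rings: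
  "carried S (rings w) e t f \<longleftrightarrow> (\<exists>L\<in>lists (S \<times> UNIV). follows_rings w e L \<and> jump_site e L = f \<and>
     jump_time w e L \<le> t \<and> (\<forall>h\<in>S - {f}. rings w {f, h} \<inter> {jump_time w e L<..t} = {}))"
proof
  assume "carried S (rings w) e t f"
  then show "\<exists>L\<in>lists (S \<times> UNIV). follows_rings w e L \<and> jump_site e L = f \<and>
     jump_time w e L \<le> t \<and> (\<forall>h\<in>S - {f}. rings w {f, h} \<inter> {jump_time w e L<..t} = {})"
  proof induction
    case start
    then show ?case by (intro bexI[of _ "[]"]) auto
  next
    case (stay s f t)
    then obtain L where L: "L \<in> lists (S \<times> UNIV)" "follows_rings w e L" "jump_site e L = f"
      "jump_time w e L \<le> s" "\<forall>h\<in>S - {f}. rings w {f, h} \<inter> {jump_time w e L<..s} = {}" by blast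
    have "{jump_time w e L<..t} \<subseteq> {jump_time w e L<..s} \<union> {s<..t}" by auto
    then have "\<forall>h\<in>S - {f}. rings w {f, h} \<inter> {jump_time w e L<..t} = {}"
      using L(5) stay.hyps(3) by blast
    then show ?case using L stay.hyps(2) by (intro bexI[of _ L]) auto
  next
    case (exchange s f t g)
    then obtain L where L: "L \<in> lists (S \<times> UNIV)" "follows_rings w e L" "jump_site e L = f"
      "jump_time w e L \<le> s" "\<forall>h\<in>S - {f}. rings w {f, h} \<inter> {jump_time w e L<..s} = {}" by blast
    have fg: "{f, g} \<in> pairs" using exchange.hyps(5) by (auto simp: rings_def split: if_splits)
    then obtain n where n: "t = ring_time w {f, g} n" using exchange.hyps(5) by (auto simp: rings_def)
    have "{jump_time w e L<..<t} \<subseteq> {jump_time w e L<..s} \<union> {s<..<t}" by auto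
    then have q: "\<forall>h\<in>S - {f}. rings w {f, h} \<inter> {jump_time w e L<..<t} = {}"
      using L(5) exchange.hyps(3) by blast
    have "jump_time w e L < t" using L(4) exchange.hyps(2) by simp
    then have follows: "follows_rings w e ((g, n) # L)"
      using L(2,3) q n fg exchange.hyps(4) by simp
    show ?case
      by (rule bexI[OF _ follows_rings_lists[OF follows]], intro conjI follows) (simp_all add: n L(3))
  qed
next
  assume "\<exists>L\<in>lists (S \<times> UNIV). follows_rings w e L \<and> jump_site e L = f \<and>
     jump_time w e L \<le> t \<and> (\<forall>h\<in>S - {f}. rings w {f, h} \<inter> {jump_time w e L<..t} = {})"
  then obtain L where L: "follows_rings w e L" "jump_site e L = f"
      "jump_time w e L \<le> t" "\<forall>h\<in>S - {f}. rings w {f, h} \<inter> {jump_time w e L<..t} = {}" by blast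
  have "carried S (rings w) e (jump_time w e L) f" using follows_rings_carried[OF L(1)] L(2) by simp
  then show "carried S (rings w) e t f" using L(3,4) by (rule carried.stay)
qed

lemma sets_quiet:
  assumes "\<And>a n. {w\<in>space clock_space. ring_time w a n \<in> I w} \<in> sets clock_space"
  shows "{w\<in>space clock_space. \<forall>h\<in>S - {f}. rings w {f, h} \<inter> I w = {}} \<in> sets clock_space"
proof (rule sets.sets_Collect_countable_All')
  show "countable (S - {f})" using countable_S by simp
  fix h
  show "{w\<in>space clock_space. rings w {f, h} \<inter> I w = {}} \<in> sets clock_space"
  proof (cases "{f, h} \<in> pairs")
    case True
    have "{w\<in>space clock_space. \<exists>n. ring_time w {f, h} n \<in> I w} \<in> sets clock_space"
      by (rule sets.sets_Collect_countable_Ex) (rule assms)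
    then have "{w\<in>space clock_space. \<not> (\<exists>n. ring_time w {f, h} n \<in> I w)} \<in> sets clock_space"
      by (rule sets.sets_Collect_neg)
    moreover have "rings w {f, h} \<inter> I w = {} \<longleftrightarrow> \<not> (\<exists>n. ring_time w {f, h} n \<in> I w)" for w
      using rings_meet_iff[OF True, of w "I w"] by argo
    ultimately show ?thesis by (simp only:)
  qed (simp add: rings_def)
qed

lemma jump_time_measurable [measurable]: "(\<lambda>w. jump_time w e L) \<in> borel_measurable clock_space"
  by (cases L) simp_all

lemma sets_follows_rings: "{w\<in>space clock_space. follows_rings w e L} \<in> sets clock_space"
proof (induction L)
  case (Cons j L)
  let ?t = "\<lambda>w. ring_time w {jump_site e L, fst j} (snd j)"
  have "{w\<in>space clock_space. jump_time w e L < ?t w} \<in> sets clock_space" by measurable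
  moreover have "{w\<in>space clock_space. \<forall>h\<in>S - {jump_site e L}. rings w {jump_site e L, h} \<inter>
       {jump_time w e L<..<?t w} = {}} \<in> sets clock_space"
  proof (rule sets_quiet)
    fix a n
    have "{w\<in>space clock_space. jump_time w e L < ring_time w a n \<and> ring_time w a n < ?t w} \<in> sets clock_space"
      by measurable
    then show "{w\<in>space clock_space. ring_time w a n \<in> {jump_time w e L<..<?t w}} \<in> sets clock_space" by simp
  qed
  ultimately show ?case
    unfolding follows_rings.simps
    using Cons by (intro sets.sets_Collect_conj sets.sets_Collect_const)
qed (simp add: sets.sets_Collect_const)

lemma sets_carried: "{w\<in>space clock_space. carried S (rings w) e t f} \<in> sets clock_space"
  unfolding carried_iff_follows_rings
proof (intro sets.sets_Collect_countable_Ex' sets.sets_Collect_conj sets.sets_Collect_const sets_quiet sets_follows_rings)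
  show "countable (lists (S \<times> (UNIV :: nat set)))" using countable_S by auto
  fix L
  show "{w\<in>space clock_space. jump_time w e L \<le> t} \<in> sets clock_space" by measurable
  fix a n
  have "{w\<in>space clock_space. jump_time w e L < ring_time w a n \<and> ring_time w a n \<le> t} \<in> sets clock_space"
    by measurable
  then show "{w\<in>space clock_space. ring_time w a n \<in> {jump_time w e L<..t}} \<in> sets clock_space" by simp
qed

lemma sets_clocks:
  assumes "{w\<in>space clock_space. Q w} \<in> sets clock_space"
  shows "{x\<in>space M. Q (clocks x)} \<in> events"
proof -
  have "clocks -` {w\<in>space clock_space. Q w} \<inter> space M = {x\<in>space M. Q (clocks x)}"
    using measurable_space[OF clocks_measurable] by auto
  then show ?thesis using measurable_sets[OF clocks_measurable assms] by simp
qed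

lemma sets_initial: "e \<in> S \<Longrightarrow> {x\<in>space M. X0 x e = v} \<in> events"
proof -
  assume "e \<in> S"
  from measurable_sets[OF initial_measurable single_site_sets[OF this, of p v]]
  have "X0 -` {\<omega>\<in>space (bernoulli_percolation S p). \<omega> e = v} \<inter> space M \<in> events" .
  moreover have "X0 -` {\<omega>\<in>space (bernoulli_percolation S p). \<omega> e = v} \<inter> space M = {x\<in>space M. X0 x e = v}"
    using measurable_space[OF initial_measurable] by auto
  ultimately show ?thesis by simp
qed

definition state_event :: "real \<Rightarrow> int \<Rightarrow> 'i \<Rightarrow> 'm set" where
  "state_event s v f = {x\<in>space M. \<exists>e\<in>S. carried S (rings (clocks x)) e s f \<and> X0 x e = v}"

lemma state_event_sets: "state_event s v f \<in> events"
  unfolding state_event_def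
proof (rule sets.sets_Collect_countable_Ex'[OF _ countable_S])
  fix e assume "e \<in> S"
  then show "{x\<in>space M. carried S (rings (clocks x)) e s f \<and> X0 x e = v} \<in> events"
    by (intro sets.sets_Collect_conj sets_clocks[OF sets_carried] sets_initial)
qed

lemma prob_initial_and_clocks:
  assumes F: "finite F" "F \<subseteq> S" and v: "v \<in> {- 1, 1}" and H: "H \<in> sets clock_space"
  shows "prob {x\<in>space M. (\<forall>e\<in>F. X0 x e = v) \<and> clocks x \<in> H} = state_prob p v ^ card F * prob {x\<in>space M. clocks x \<in> H}"
proof -
  let ?N = "bernoulli_percolation S p"
  let ?A = "{\<omega>\<in>space ?N. \<forall>e\<in>F. \<omega> e = v}"
  have A: "?A \<in> sets ?N"
    using F by (intro sets.sets_Collect_finite_All single_site_sets) auto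
  have eq: "X0 x \<in> ?A \<longleftrightarrow> (\<forall>e\<in>F. X0 x e = v)" if "x \<in> space M" for x
    using measurable_space[OF initial_measurable that] by simp
  have "prob {x\<in>space M. X0 x \<in> ?A} = measure (distr M ?N X0) ?A"
    using A by (subst measure_distr[OF initial_measurable]) (auto intro!: arg_cong[where f=prob])
  also have "\<dots> = state_prob p v ^ card F"
    unfolding initial_distr using F v by (subst measure_bernoulli_cylinder[OF p]) auto
  finally have "prob {x\<in>space M. X0 x \<in> ?A} = state_prob p v ^ card F" .
  moreover have "{x\<in>space M. (\<forall>e\<in>F. X0 x e = v) \<and> clocks x \<in> H} = {x\<in>space M. X0 x \<in> ?A \<and> clocks x \<in> H}"
    using eq by blast
  ultimately show ?thesis using initial_indep_clocks[OF A H] by simp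
qed

text \<open>Given the clocks, the configuration at time \<open>s\<close> is the initial one moved by a fixed permutation, and
  the Bernoulli measure is invariant under permutations. Hence it is again Bernoulli and independent of
  all clocks, even of the rings before time \<open>s\<close>. The proof sums over the possible origins \<open>h\<close> of the sites in \<open>F\<close>, of which there are countably many.\<close>

lemma state_indep_clocks:
  assumes s: "0 \<le> s" and F: "finite F" "F \<subseteq> S" and v: "v \<in> {- 1, 1}" and H: "H \<in> sets clock_space"
  shows "prob {x\<in>space M. (\<forall>f\<in>F. x \<in> state_event s v f) \<and> clocks x \<in> H}
    = state_prob p v ^ card F * prob {x\<in>space M. clocks x \<in> H}"
proof -
  let ?q = "state_prob p v ^ card F"
  have q: "0 \<le> ?q" using p by simp
  obtain N where N: "{x\<in>space M. \<not> exchange_flow S (rings (clocks x)) (1/2)} \<subseteq> N" "N \<in> null_sets M"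
    using AE_exchange_flow[of "1/2"] by (auto simp: eventually_ae_filter)
  have flow: "exchange_flow S (rings (clocks x)) (1/2)" if "x \<in> space M" "x \<notin> N" for x
    using that N by blast
  \<comment> \<open>Outside \<open>N\<close>, the origins \<open>h\<close> are determined by the clocks and are different for different sites.\<close>
  define E where "E h = {x\<in>space M. (\<forall>f\<in>F. carried S (rings (clocks x)) (h f) s f) \<and> clocks x \<in> H}" for h
  define D where "D h = {x\<in>space M. (\<forall>f\<in>F. X0 x (h f) = v) \<and>
      (\<forall>f\<in>F. carried S (rings (clocks x)) (h f) s f) \<and> clocks x \<in> H}" for h
  let ?L = "{x\<in>space M. (\<forall>f\<in>F. x \<in> state_event s v f) \<and> clocks x \<in> H}"
  let ?R = "{x\<in>space M. clocks x \<in> H}"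
  let ?I = "F \<rightarrow>\<^sub>E S"
  have I: "countable ?I" using F countable_S by (intro countable_PiE)
  have Hsets: "{w\<in>space clock_space. w \<in> H} \<in> sets clock_space"
    using H sets.sets_into_space[OF H] by (simp add: Int_absorb1 flip: Int_def)
  have R: "?R \<in> events" by (rule sets_clocks[OF Hsets])
  have L: "?L \<in> events"
  proof (intro sets.sets_Collect_conj sets.sets_Collect_finite_All R)
    show "{x\<in>space M. x \<in> state_event s v f} \<in> events" for f
      using state_event_sets[of s v f] by (simp add: state_event_def)
  qed (use F in auto)
  have E'sets: "{w\<in>space clock_space. (\<forall>f\<in>F. carried S (rings w) (h f) s f) \<and> w \<in> H} \<in> sets clock_space" for h
    using F Hsets by (intro sets.sets_Collect_conj sets.sets_Collect_finite_All sets_carried)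
  have E: "E h \<in> events" for h unfolding E_def by (rule sets_clocks[OF E'sets])
  have D: "D h \<in> events" if "h \<in> ?I" for h
  proof -
    have "{x\<in>space M. \<forall>f\<in>F. X0 x (h f) = v} \<in> events"
      using F that by (intro sets.sets_Collect_finite_All sets_initial) (auto dest: PiE_mem)
    moreover have "D h = {x\<in>space M. \<forall>f\<in>F. X0 x (h f) = v} \<inter> E h" by (auto simp: D_def E_def)
    ultimately show ?thesis using E by auto
  qed
  have inj: "e = e'" if "x \<in> space M" "x \<notin> N" "carried S (rings (clocks x)) e s f" "carried S (rings (clocks x)) e' s f" for x e e' f
  proof -
    interpret exchange_flow S "rings (clocks x)" "1/2" by (rule flow[OF that(1,2)])
    show ?thesis using carried_inj[OF that(3,4)] .
  qed
  have uniq: "f = f'" if "x \<in> space M" "x \<notin> N" "carried S (rings (clocks x)) e s f" "carried S (rings (clocks x)) e s f'" for x e f f'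
  proof -
    interpret exchange_flow S "rings (clocks x)" "1/2" by (rule flow[OF that(1,2)])
    show ?thesis using carried_unique[OF that(4,3)] .
  qed
  have pre: "\<exists>e\<in>S. carried S (rings (clocks x)) e s f" if "x \<in> space M" "x \<notin> N" "f \<in> S" for x f
  proof -
    interpret exchange_flow S "rings (clocks x)" "1/2" by (rule flow[OF that(1,2)])
    show ?thesis using bijective_at_all[OF s] that(3) by (simp add: bijective_at_def)
  qed
  have choose: "\<exists>h\<in>?I. \<forall>f\<in>F. Q f (h f)" if Q: "\<forall>f\<in>F. \<exists>e\<in>S. Q f e" for Q
  proof -
    have "\<forall>f\<in>F. \<exists>e. e \<in> S \<and> Q f e" using Q by blast
    from bchoice[OF this] obtain h where "\<forall>f\<in>F. h f \<in> S \<and> Q f (h f)" ..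
    then show ?thesis by (intro bexI[of _ "restrict h F"]) auto
  qed
  have L_Un: "?L - N = (\<Union>h\<in>?I. D h - N)"
  proof (intro equalityI subsetI)
    fix x assume x: "x \<in> ?L - N"
    then have "\<forall>f\<in>F. \<exists>e\<in>S. carried S (rings (clocks x)) e s f \<and> X0 x e = v" by (auto simp: state_event_def)
    from choose[OF this] obtain h where "h \<in> ?I" "\<forall>f\<in>F. carried S (rings (clocks x)) (h f) s f \<and> X0 x (h f) = v"
      by blast
    then show "x \<in> (\<Union>h\<in>?I. D h - N)" using x by (intro UN_I[of h]) (auto simp: D_def)
  next
    fix x assume "x \<in> (\<Union>h\<in>?I. D h - N)"
    then obtain h where h: "h \<in> ?I" "x \<in> D h" "x \<notin> N" by blast
    have "x \<in> state_event s v f" if "f \<in> F" for f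
      using h that PiE_mem[OF h(1) that] by (auto simp: D_def state_event_def)
    then show "x \<in> ?L - N" using h by (simp add: D_def)
  qed
  have R_Un: "?R - N = (\<Union>h\<in>?I. E h - N)"
  proof (intro equalityI subsetI)
    fix x assume x: "x \<in> ?R - N"
    then have "\<forall>f\<in>F. \<exists>e\<in>S. carried S (rings (clocks x)) e s f" using pre F by blast
    from choose[OF this] obtain h where "h \<in> ?I" "\<forall>f\<in>F. carried S (rings (clocks x)) (h f) s f" by blast
    then show "x \<in> (\<Union>h\<in>?I. E h - N)" using x by (intro UN_I[of h]) (auto simp: E_def)
  qed (auto simp: E_def)
  have disjE: "disjoint_family_on (\<lambda>h. E h - N) ?I"
    unfolding disjoint_family_on_def
  proof (intro ballI impI, rule ccontr)
    fix h h' assume h: "h \<in> ?I" "h' \<in> ?I" "h \<noteq> h'" and "(E h - N) \<inter> (E h' - N) \<noteq> {}"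
    then obtain x where x: "x \<in> E h" "x \<in> E h'" "x \<notin> N" by blast
    have "h f = h' f" if "f \<in> F" for f
      using x that by (intro inj[of x "h f" f]) (auto simp: E_def)
    then show False using h PiE_ext by metis
  qed
  have "D h \<subseteq> E h" for h by (auto simp: D_def E_def)
  then have disjD: "disjoint_family_on (\<lambda>h. D h - N) ?I"
    using disjE unfolding disjoint_family_on_def by blast
  have eq: "emeasure M (D h - N) = ennreal ?q * emeasure M (E h - N)" if h: "h \<in> ?I" for h
  proof (cases "inj_on h F")
    case True
    have "prob (D h) = state_prob p v ^ card (h ` F) * prob (E h)"
    proof -
      have hF: "finite (h ` F)" "h ` F \<subseteq> S" using F h by (auto dest: PiE_mem)
      have eqD: "{x\<in>space M. (\<forall>e\<in>h ` F. X0 x e = v) \<and> clocks x \<in> {w\<in>space clock_space. (\<forall>f\<in>F. carried S (rings w) (h f) s f) \<and> w \<in> H}} = D h"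
        using measurable_space[OF clocks_measurable] by (auto simp: D_def)
      have eqE: "{x\<in>space M. clocks x \<in> {w\<in>space clock_space. (\<forall>f\<in>F. carried S (rings w) (h f) s f) \<and> w \<in> H}} = E h"
        using measurable_space[OF clocks_measurable] by (auto simp: E_def)
      show ?thesis using prob_initial_and_clocks[OF hF v E'sets[of h]] unfolding eqD eqE .
    qed
    then have "prob (D h) = ?q * prob (E h)" using True by (simp add: card_image)
    then have "emeasure M (D h) = ennreal ?q * emeasure M (E h)"
      using q by (simp add: emeasure_eq_measure ennreal_mult)
    then show ?thesis using N(2) D[OF h] E by (simp add: emeasure_Diff_null_set)
  next
    case False
    then obtain f f' where f: "f \<in> F" "f' \<in> F" "h f = h f'" "f \<noteq> f'" by (auto simp: inj_on_def)
    have "E h - N = {}"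
    proof (rule ccontr)
      assume "E h - N \<noteq> {}"
      then obtain x where "x \<in> E h" "x \<notin> N" by blast
      then have "f = f'" using f by (intro uniq[of x "h f" f f']) (auto simp: E_def)
      then show False using f by simp
    qed
    then have "D h - N = {}" using \<open>D h \<subseteq> E h\<close> by blast
    then show ?thesis using \<open>E h - N = {}\<close> by (simp only: emeasure_empty mult_zero_right)
  qed
  have "emeasure M ?L = emeasure M (?L - N)" using emeasure_Diff_null_set[OF N(2) L] by simp
  also have "\<dots> = (\<integral>\<^sup>+h. emeasure M (D h - N) \<partial>count_space ?I)"
    unfolding L_Un using D N(2) by (intro emeasure_UN_countable[OF _ I disjD]) auto
  also have "\<dots> = (\<integral>\<^sup>+h. ennreal ?q * emeasure M (E h - N) \<partial>count_space ?I)"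
    using eq by (intro nn_integral_cong) simp
  also have "\<dots> = ennreal ?q * (\<integral>\<^sup>+h. emeasure M (E h - N) \<partial>count_space ?I)"
    by (rule nn_integral_cmult) simp
  also have "(\<integral>\<^sup>+h. emeasure M (E h - N) \<partial>count_space ?I) = emeasure M (?R - N)"
    unfolding R_Un using E N(2) by (intro emeasure_UN_countable[OF _ I disjE, symmetric]) auto
  also have "\<dots> = emeasure M ?R" by (rule emeasure_Diff_null_set[OF N(2) R])
  finally show ?thesis using q by (simp add: emeasure_eq_measure ennreal_mult[symmetric])
qed

lemma prob_state_event:
  assumes "0 \<le> s" "f \<in> S" "v \<in> {- 1, 1}"
  shows "prob (state_event s v f) = state_prob p v"
proof -
  have "{x\<in>space M. (\<forall>f\<in>{f}. x \<in> state_event s v f) \<and> clocks x \<in> space clock_space} = state_event s v f"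
    "{x\<in>space M. clocks x \<in> space clock_space} = space M"
    using measurable_space[OF clocks_measurable] by (auto simp: state_event_def)
  then show ?thesis
    using state_indep_clocks[OF assms(1), of "{f}" v "space clock_space"] assms by (simp add: prob_space)
qed

lemma indep_state_and_ring_events:
  assumes s: "0 \<le> s" and v: "v \<in> {- 1, 1}"
  shows "indep_events (case_sum (state_event s v) (ring_event s t)) (Inl ` S \<union> Inr ` pairs)"
proof (rule indep_eventsI)
  let ?Ev = "case_sum (state_event s v) (ring_event s t)"
  show "?Ev i \<in> events" if "i \<in> Inl ` S \<union> Inr ` pairs" for i
    using that state_event_sets ring_event_sets by auto
  fix J :: "('i + 'i set) set" assume J: "J \<subseteq> Inl ` S \<union> Inr ` pairs" "finite J" "J \<noteq> {}"
  define F where "F = {f. Inl f \<in> J}"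
  define G where "G = {a. Inr a \<in> J}"
  have JFG: "J = Inl ` F \<union> Inr ` G"
  proof (intro equalityI subsetI)
    fix j assume "j \<in> J" then show "j \<in> Inl ` F \<union> Inr ` G" by (cases j) (auto simp: F_def G_def)
  qed (auto simp: F_def G_def)
  have F: "finite F" "F \<subseteq> S" and G: "finite G" "G \<subseteq> pairs"
    using J finite_imageD[of Inl F] finite_imageD[of Inr G] by (auto simp: JFG)
  let ?H = "{w\<in>space clock_space. \<forall>a\<in>G. rings w a \<inter> {s<..t} \<noteq> {}}"
  have H: "?H \<in> sets clock_space"
    using G by (intro sets.sets_Collect_finite_All sets_rings_meet) auto
  have cl: "clocks x \<in> ?H \<longleftrightarrow> (\<forall>a\<in>G. x \<in> ring_event s t a)" if "x \<in> space M" for x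
    using that measurable_space[OF clocks_measurable that] by (simp add: ring_event_def)
  have PH: "prob {x\<in>space M. clocks x \<in> ?H} = (\<Prod>a\<in>G. prob (ring_event s t a))"
  proof (cases "G = {}")
    case True
    then show ?thesis using cl by (simp add: prob_space cong: conj_cong)
  next
    case False
    have "{x\<in>space M. clocks x \<in> ?H} = (\<Inter>a\<in>G. ring_event s t a)"
      using cl False by (auto simp: ring_event_def)
    then show ?thesis using indep_ring_events[of s t] G False by (simp add: indep_events_def)
  qed
  have "(\<Inter>j\<in>J. ?Ev j) = {x\<in>space M. (\<forall>f\<in>F. x \<in> state_event s v f) \<and> clocks x \<in> ?H}"
  proof -
    have sub: "(\<Inter>j\<in>J. ?Ev j) \<subseteq> space M"
    proof -
      obtain j where "j \<in> J" using J(3) by auto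
      moreover have "?Ev j \<subseteq> space M" by (cases j) (auto simp: state_event_def ring_event_def)
      ultimately show ?thesis by blast
    qed
    have mem_iff: "x \<in> (\<Inter>j\<in>J. ?Ev j) \<longleftrightarrow> (\<forall>f\<in>F. x \<in> state_event s v f) \<and> (\<forall>a\<in>G. x \<in> ring_event s t a)" for x
      by (simp add: JFG ball_Un)
    show ?thesis
    proof (rule set_eqI)
      fix x
      show "x \<in> (\<Inter>j\<in>J. ?Ev j) \<longleftrightarrow> x \<in> {x\<in>space M. (\<forall>f\<in>F. x \<in> state_event s v f) \<and> clocks x \<in> ?H}"
      proof (cases "x \<in> space M")
        case True
        then show ?thesis unfolding mem_iff using cl[OF True] by simp
      next
        case False
        then have "x \<notin> (\<Inter>j\<in>J. ?Ev j)" using sub by (rule contra_subsetD[rotated])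
        then show ?thesis using False by simp
      qed
    qed
  qed
  then have "prob (\<Inter>j\<in>J. ?Ev j) = state_prob p v ^ card F * (\<Prod>a\<in>G. prob (ring_event s t a))"
    using state_indep_clocks[OF s F v H] PH by simp
  also have "state_prob p v ^ card F = (\<Prod>f\<in>F. prob (state_event s v f))"
    using F s v prob_state_event by (simp add: subset_iff)
  also have "\<dots> * (\<Prod>a\<in>G. prob (ring_event s t a)) = (\<Prod>j\<in>J. prob (?Ev j))"
    unfolding JFG using F G by (subst prod.union_disjoint) (auto simp: prod.reindex)
  finally show "prob (\<Inter>j\<in>J. ?Ev j) = (\<Prod>j\<in>J. prob (?Ev j))" .
qed

end


section \<open>Absence of exceptional times\<close>

context exclusion_percolation
begin

text \<open>The sites which are in state \<open>v\<close> at time \<open>s\<close> or are involved in a ring between \<open>s\<close> and \<open>t\<close>. No other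
  site can be in state \<open>v\<close> at any time between \<open>s\<close> and \<open>t\<close>.\<close>

definition disturbed :: "real \<Rightarrow> real \<Rightarrow> int \<Rightarrow> 'm \<Rightarrow> 'i set" where
  "disturbed s t v x = {f\<in>S. x \<in> state_event s v f \<or> (\<exists>g\<in>S - {f}. x \<in> ring_event s t {f, g})}"

lemma disturbed_dominated:
  assumes s: "0 \<le> s" "s \<le> t" and v: "v \<in> {- 1, 1}" and q: "0 < state_prob p v"
  shows "random_subset M S (disturbed s t v)"
    and "inclusion_prob_le M S (disturbed s t v) (state_prob p v + (t - s) / state_prob p v)"
proof -
  interpret R: independent_pairs M S pairs "ring_event s t" "\<lambda>f g. K f g * (t - s)" "t - s"
    by (rule independent_pairs_rings[OF s(2)])
  interpret T: site_and_pair_events M S pairs "case_sum (state_event s v) (ring_event s t)"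
    "state_prob p v" "\<lambda>f g. K f g * (t - s)" "t - s"
  proof
    show "countable S" by (rule countable_S)
    show "indep_events (case_sum (state_event s v) (ring_event s t)) (Inl ` S \<union> Inr ` pairs)"
      by (rule indep_state_and_ring_events[OF s(1) v])
    show "prob (case_sum (state_event s v) (ring_event s t) (Inl f)) = state_prob p v" if "f \<in> S" for f
      using prob_state_event[OF s(1) that v] by simp
    show "0 < state_prob p v" by (rule q)
    show "state_prob p v \<le> 1" using p by simp
  qed (use R.pair_empty R.pair_prob R.pair_sum in simp_all)
  have "T.touched = disturbed s t v" by (auto simp: fun_eq_iff T.touched_def disturbed_def)
  then show "random_subset M S (disturbed s t v)"
    and "inclusion_prob_le M S (disturbed s t v) (state_prob p v + (t - s) / state_prob p v)"
    using T.random_subset_touched T.inclusion_prob_le_touched by simp_all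
qed

lemma process_at_site:
  assumes flow: "exchange_flow S (rings (clocks x)) \<epsilon>" and t: "0 \<le> t" and f: "f \<in> S"
  obtains e where "e \<in> S" "carried S (rings (clocks x)) e t f" "exclusion_process S K X0 W x t f = X0 x e"
proof -
  interpret exchange_flow S "rings (clocks x)" \<epsilon> by (rule flow)
  obtain e where e: "e \<in> S" "carried S (rings (clocks x)) e t f"
    using bijective_at_all[OF t] f by (auto simp: bijective_at_def)
  show thesis
    using inv_exchange_perm[OF e(2)] f
    by (intro that[OF e]) (simp add: exclusion_process_def rings_clocks)
qed

lemma sites_in_state_subset_disturbed:
  assumes x: "x \<in> space M" and flow: "exchange_flow S (rings (clocks x)) \<epsilon>"
    and s: "0 \<le> s" "s \<le> t" "t \<le> u"
  shows "sites_in_state S v (exclusion_process S K X0 W x t) \<subseteq> disturbed s u v x"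
proof
  fix f assume "f \<in> sites_in_state S v (exclusion_process S K X0 W x t)"
  then have f: "f \<in> S" "exclusion_process S K X0 W x t f = v" by auto
  interpret exchange_flow S "rings (clocks x)" \<epsilon> by (rule flow)
  show "f \<in> disturbed s u v x"
  proof (cases "\<exists>g\<in>S - {f}. x \<in> ring_event s u {f, g}")
    case True
    then show ?thesis using f by (simp add: disturbed_def)
  next
    case False
    then have quiet_u: "quiet f {s<..u}" using x by (auto simp: ring_event_def)
    have quiet_t: "quiet f {s<..t}" by (rule quiet_subset[OF quiet_u]) (use s in auto)
    obtain e where e: "e \<in> S" "carried S (rings (clocks x)) e s f"
      using bijective_at_all[OF s(1)] f by (auto simp: bijective_at_def)
    have "carried S (rings (clocks x)) e t f" using e(2) s(2) quiet_t by (rule carried_stay)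
    moreover obtain e' where "carried S (rings (clocks x)) e' t f" "exclusion_process S K X0 W x t f = X0 x e'"
      using process_at_site[OF flow _ f(1), of t] s by auto
    ultimately have "X0 x e = v" using carried_inj f(2) by metis
    then show ?thesis using e f x by (auto simp: disturbed_def state_event_def)
  qed
qed

text \<open>The domination argument divides by the probability of the state \<open>v\<close>. If this probability is \<open>0\<close>, the state
  occurs nowhere initially, hence never.\<close>

lemma AE_no_site_in_null_state:
  assumes v: "v \<in> {- 1, 1}" and 0: "state_prob p v = 0"
  shows "AE x in M. \<forall>t\<ge>0. sites_in_state S v (exclusion_process S K X0 W x t) = {}"
proof -
  have "AE x in M. \<forall>e\<in>S. X0 x e \<noteq> v"
  proof (subst AE_ball_countable[OF countable_S], intro ballI)
    fix e assume e: "e \<in> S"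
    have "{x\<in>space M. (\<forall>f\<in>{e}. X0 x f = v) \<and> clocks x \<in> space clock_space} = {x\<in>space M. X0 x e = v}"
      using measurable_space[OF clocks_measurable] by auto
    then have "prob {x\<in>space M. X0 x e = v} = 0"
      using prob_initial_and_clocks[of "{e}" v "space clock_space"] e v 0 by simp
    then have "AE x in M. x \<notin> {x\<in>space M. X0 x e = v}" using prob_eq_0[OF sets_initial[OF e]] by simp
    then show "AE x in M. X0 x e \<noteq> v" by (rule AE_mp) (intro AE_I2 impI, simp)
  qed
  moreover have "AE x in M. exchange_flow S (rings (clocks x)) (1/2)" by (rule AE_exchange_flow) simp_all
  ultimately show ?thesis
  proof eventually_elim
    case (elim x)
    have "exclusion_process S K X0 W x t f \<noteq> v" if tf: "0 \<le> t" "f \<in> S" for t f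
    proof -
      obtain e where "e \<in> S" "carried S (rings (clocks x)) e t f" "exclusion_process S K X0 W x t f = X0 x e"
        using process_at_site[OF elim(2) tf] .
      then show ?thesis using elim(1) by simp
    qed
    then show ?case by simp
  qed
qed

text \<open>The common part of the subcritical case (\<open>v = 1\<close>) and the supercritical case (\<open>v = - 1\<close>). In each slab
  all the sets of sites in state \<open>v\<close> lie in one random set, whose conditional inclusion
  probabilities exceed the density of the state by an arbitrarily small amount. Countably many slabs
  cover all times.\<close>

lemma AE_state_sets_controlled:
  assumes v: "v \<in> {- 1, 1}" and q: "0 < state_prob p v" and \<delta>: "0 < \<delta>"
    and null: "\<And>T r. random_subset M S T \<Longrightarrow> inclusion_prob_le M S T r \<Longrightarrow> 0 \<le> r \<Longrightarrow> r \<le> state_prob p v + \<delta> \<Longrightarrow>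
      AE x in M. Q (T x)"
    and decr: "\<And>T T'. T \<subseteq> T' \<Longrightarrow> Q T' \<Longrightarrow> Q T"
  shows "AE x in M. \<forall>t\<ge>0. Q (sites_in_state S v (exclusion_process S K X0 W x t))"
proof -
  let ?q = "state_prob p v"
  \<comment> \<open>Domination needs \<open>\<epsilon> / ?q \<le> \<delta>\<close>, the finiteness of the components needs \<open>\<epsilon> < 1\<close>.\<close>
  define \<epsilon> where "\<epsilon> = min (1/2) (?q * \<delta>)"
  have eps: "0 < \<epsilon>" "\<epsilon> < 1" "\<epsilon> / ?q \<le> \<delta>"
    using q \<delta> by (auto simp: \<epsilon>_def pos_divide_le_eq mult.commute)
  have "AE x in M. Q (disturbed (real k * \<epsilon>) (real (Suc k) * \<epsilon>) v x)" for k
  proof -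
    have len: "real (Suc k) * \<epsilon> - real k * \<epsilon> = \<epsilon>" by (simp add: algebra_simps)
    have k: "0 \<le> real k * \<epsilon>" "real k * \<epsilon> \<le> real (Suc k) * \<epsilon>" using eps by (simp_all add: algebra_simps)
    show ?thesis
    proof (rule null)
      show "random_subset M S (disturbed (real k * \<epsilon>) (real (Suc k) * \<epsilon>) v)"
        by (rule disturbed_dominated(1)[OF k v q])
      show "inclusion_prob_le M S (disturbed (real k * \<epsilon>) (real (Suc k) * \<epsilon>) v) (?q + \<epsilon> / ?q)"
        using disturbed_dominated(2)[OF k v q] unfolding len .
      show "0 \<le> ?q + \<epsilon> / ?q" using q eps by (intro add_nonneg_nonneg divide_nonneg_pos) auto
      show "?q + \<epsilon> / ?q \<le> ?q + \<delta>" using eps by simp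
    qed
  qed
  then have "AE x in M. \<forall>k. Q (disturbed (real k * \<epsilon>) (real (Suc k) * \<epsilon>) v x)"
    by (subst AE_all_countable) (rule allI)
  moreover have "AE x in M. exchange_flow S (rings (clocks x)) \<epsilon>" by (rule AE_exchange_flow[OF eps(1,2)])
  moreover have "AE x in M. x \<in> space M" by (rule AE_space)
  ultimately show ?thesis
  proof eventually_elim
    case (elim x)
    show ?case
    proof (intro allI impI)
      fix t :: real assume t: "0 \<le> t"
      interpret exchange_flow S "rings (clocks x)" \<epsilon> by (rule elim(2))
      obtain k :: nat where k: "real k * \<epsilon> \<le> t" "t \<le> real (Suc k) * \<epsilon>" using slab_of_time[OF t] .
      have "sites_in_state S v (exclusion_process S K X0 W x t) \<subseteq> disturbed (real k * \<epsilon>) (real (Suc k) * \<epsilon>) v x"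
        using eps by (intro sites_in_state_subset_disturbed[OF elim(3,2) _ k]) simp
      then show "Q (sites_in_state S v (exclusion_process S K X0 W x t))"
        using elim(1) by (rule_tac decr) auto
    qed
  qed
qed

lemma AE_process_states:
  "AE x in M. \<forall>t\<ge>0. sites_in_state S 1 (exclusion_process S K X0 W x t)
     = S - sites_in_state S (- 1) (exclusion_process S K X0 W x t)"
proof -
  have "AE x in M. exchange_flow S (rings (clocks x)) (1/2)" by (rule AE_exchange_flow) simp_all
  moreover have "AE x in M. x \<in> space M" by (rule AE_space)
  ultimately show ?thesis
  proof eventually_elim
    case (elim x)
    have "exclusion_process S K X0 W x t f \<in> {- 1, 1}" if tf: "0 \<le> t" "f \<in> S" for t f
    proof -
      obtain e where e: "e \<in> S" "carried S (rings (clocks x)) e t f" "exclusion_process S K X0 W x t f = X0 x e"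
        using process_at_site[OF elim(1) tf] .
      have "X0 x \<in> S \<rightarrow>\<^sub>E {- 1, 1}" using measurable_space[OF initial_measurable elim(2)] by (simp add: space_bernoulli)
      then show ?thesis using PiE_mem[of "X0 x" S "\<lambda>_. {- 1, 1}" e] e by simp
    qed
    then have pm: "exclusion_process S K X0 W x t f = - 1 \<or> exclusion_process S K X0 W x t f = 1"
      if "0 \<le> t" "f \<in> S" for t f
      using that by blast
    show ?case
    proof (intro allI impI set_eqI)
      fix t :: real and f assume "0 \<le> t"
      then show "f \<in> sites_in_state S 1 (exclusion_process S K X0 W x t) \<longleftrightarrow>
          f \<in> S - sites_in_state S (- 1) (exclusion_process S K X0 W x t)"
        using pm[of t f] by (cases "f \<in> S") auto
    qed
  qed
qed

end

locale exclusion_percolation_event = exclusion_percolation M S K p X0 W + percolation_event S A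
  for M :: "'m measure" and S :: "'i set" and K p X0 W A
begin

text \<open>If \<open>p > 0\<close>, the set of sites open at some time of a slab is dominated by Bernoulli percolation of a parameter
  \<open>p' > p\<close> at which there is no infinite cluster.\<close>

lemma no_exceptional_time_subcritical:
  assumes "p \<noteq> critical_point S occurs" and 0: "percolation_prob S occurs p = 0"
  shows "AE x in M. \<forall>t\<ge>0. \<not> occurs (exclusion_process S K X0 W x t)"
proof (cases "p = 0")
  case True
  have "AE x in M. \<forall>t\<ge>0. sites_in_state S 1 (exclusion_process S K X0 W x t) = {}"
    using True by (intro AE_no_site_in_null_state) auto
  then show ?thesis
  proof eventually_elim
    case (elim x)
    show ?case
    proof (intro allI impI)
      fix t :: real assume "0 \<le> t"
      then have "sites_in_state S 1 (exclusion_process S K X0 W x t) = {}" using elim by blast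
      then show "\<not> occurs (exclusion_process S K X0 W x t)" using empty_fails by (simp only: not_False_eq_True)
    qed
  qed
next
  case False
  obtain p' where p': "p < p'" "p' \<le> 1" "percolation_prob S occurs p' = 0"
    using subcritical_margin[OF p assms] .
  then have p'01: "p' \<in> {0..1}" using p by auto
  show ?thesis
  proof (rule AE_state_sets_controlled[where \<delta>="p' - p" and Q="\<lambda>T. \<not> A T"])
    fix T r assume T: "random_subset M S T" "inclusion_prob_le M S T r" "0 \<le> r" "r \<le> state_prob p 1 + (p' - p)"
    have "prob {x\<in>space M. A (T x)} \<le> measure (bernoulli_percolation S p') {\<omega>\<in>space (bernoulli_percolation S p'). occurs \<omega>}"
      using T p'01 prob_space_axioms
      by (intro domination[where r=r, OF _ _ _ _ _ _ _ _ increasing] prob_space_bernoulli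
          random_subset_bernoulli inclusion_prob_ge_bernoulli) auto
    then have "prob {x\<in>space M. A (T x)} = 0"
      using p'(3) by (simp add: percolation_prob_def measure_le_0_iff)
    then have "AE x in M. x \<notin> {x\<in>space M. A (T x)}"
      using prob_eq_0[OF increasing_event_sets[OF increasing T(1)]] by simp
    then show "AE x in M. \<not> A (T x)" by (rule AE_mp) (intro AE_I2 impI, simp)
  next
    show "\<not> A T" if "T \<subseteq> T'" "\<not> A T'" for T T' using that increasing_event_mono[OF increasing] by blast
  qed (use p False p' in auto)
qed

text \<open>Dually, if \<open>p < 1\<close>, the sites closed at some time of a slab are so few that the remaining ones dominate Bernoulli
  percolation of a parameter \<open>p' < p\<close> at which there is an infinite cluster.\<close>

lemma no_exceptional_time_supercritical:
  assumes "p \<noteq> critical_point S occurs" and 1: "percolation_prob S occurs p = 1"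
  shows "AE x in M. \<forall>t\<ge>0. occurs (exclusion_process S K X0 W x t)"
proof -
  obtain p' where p': "0 \<le> p'" "p' < p" "percolation_prob S occurs p' = 1"
    using supercritical_margin[OF p assms] .
  then have p'01: "p' \<in> {0..1}" using p by auto
  have "AE x in M. \<forall>t\<ge>0. A (S - sites_in_state S (- 1) (exclusion_process S K X0 W x t))"
  proof (cases "p = 1")
    case True
    \<comment> \<open>No site is ever closed, and the event holds for the fully open configuration since it holds for some configuration.\<close>
    have "{\<omega> \<in> space (bernoulli_percolation S p). occurs \<omega>} \<noteq> {}"
    proof
      assume "{\<omega> \<in> space (bernoulli_percolation S p). occurs \<omega>} = {}"
      then have "percolation_prob S occurs p = 0" by (simp only: percolation_prob_def measure_empty)
      then show False using 1 by simp
    qed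
    then obtain \<omega> where "occurs \<omega>" by auto
    then have "A S" using increasing_event_mono[OF increasing, of "sites_in_state S 1 \<omega>" S] by auto
    moreover have "AE x in M. \<forall>t\<ge>0. sites_in_state S (- 1) (exclusion_process S K X0 W x t) = {}"
      using True by (intro AE_no_site_in_null_state) auto
    ultimately show ?thesis
    proof (elim eventually_mono, intro allI impI)
      fix x and t :: real
      assume "A S" "0 \<le> t"
        and "\<forall>t\<ge>0. sites_in_state S (- 1) (exclusion_process S K X0 W x t) = {}"
      then have "sites_in_state S (- 1) (exclusion_process S K X0 W x t) = {}" by blast
      then show "A (S - sites_in_state S (- 1) (exclusion_process S K X0 W x t))"
        using \<open>A S\<close> by (simp only: Diff_empty)
    qed
  next
    case False
    show ?thesis
    proof (rule AE_state_sets_controlled[where \<delta>="p - p'" and Q="\<lambda>T. A (S - T)"])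
      fix T r assume T: "random_subset M S T" "inclusion_prob_le M S T r" "0 \<le> r" "r \<le> state_prob p (- 1) + (p - p')"
      have "measure (bernoulli_percolation S p') {\<omega>\<in>space (bernoulli_percolation S p'). occurs \<omega>} \<le> prob {x\<in>space M. A (S - T x)}"
        using T p'01 prob_space_axioms inclusion_prob_ge_complement[OF prob_space_axioms T(1,2)]
        by (intro domination[where r="1 - r", OF _ _ _ _ _ _ _ _ increasing] prob_space_bernoulli
          random_subset_bernoulli inclusion_prob_le_bernoulli) auto
      then have one: "prob {x\<in>space M. A (S - T x)} = 1"
        using p'(3) by (intro order_antisym prob_le_1) (simp add: percolation_prob_def)
      have sets: "{x\<in>space M. A (S - T x)} \<in> events"
        using increasing_event_sets[OF increasing inclusion_prob_ge_complement(1)[OF prob_space_axioms T(1,2)]] .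
      have "AE x in M. x \<in> {x\<in>space M. A (S - T x)}" using prob_eq_1[OF sets] one by simp
      then show "AE x in M. A (S - T x)" by (rule AE_mp) (intro AE_I2 impI, simp)
    next
      show "A (S - T)" if "T \<subseteq> T'" "A (S - T')" for T T'
        using that increasing_event_mono[OF increasing, of "S - T'" "S - T"] by auto
    qed (use p False p' in auto)
  qed
  with AE_process_states show ?thesis
    by eventually_elim simp
qed

theorem AE_no_exceptional_time:
  assumes "p \<noteq> critical_point S occurs"
  shows "AE x in M. \<nexists>t. exceptional_time S occurs p (exclusion_process S K X0 W x) t"
proof -
  consider "percolation_prob S occurs p = 0" | "percolation_prob S occurs p = 1"
    using zero_one_law[OF p] by blast
  then show ?thesis
  proof cases
    case 1
    show ?thesis
      using no_exceptional_time_subcritical[OF assms 1] by eventually_elim (simp add: exceptional_time_def 1)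
  next
    case 2
    show ?thesis
      using no_exceptional_time_supercritical[OF assms 2] by eventually_elim (simp add: exceptional_time_def 2)
  qed
qed

end

theorem proposition1p3:
  fixes V :: "'v set" and E :: "'v set set" and p :: real
  assumes "simple_graph V E" and "infinite V" and "countable V"
    and "connected_graph V E" and "locally_finite V E"
    and "p \<in> {0..1}"
  shows
    "(\<forall>(K :: 'v set \<Rightarrow> 'v set \<Rightarrow> real) (M :: 'm measure) X0 W.
        p \<noteq> bond_critical_point V E \<longrightarrow>
        symmetric_transition_matrix E K \<longrightarrow>
        exclusion_randomness M E K p X0 W \<longrightarrow>
        (AE x in M. \<nexists>t. exceptional_time E (bond_percolates V E) p
                          (exclusion_process E K X0 W x) t)) \<and>
     (\<forall>(K :: 'v \<Rightarrow> 'v \<Rightarrow> real) (M :: 'm measure) X0 W.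
        p \<noteq> site_critical_point V E \<longrightarrow>
        symmetric_transition_matrix V K \<longrightarrow>
        exclusion_randomness M V K p X0 W \<longrightarrow>
        (AE x in M. \<nexists>t. exceptional_time V (site_percolates V E) p
                          (exclusion_process V K X0 W x) t))"
proof (intro conjI allI impI)
  fix K :: "'v set \<Rightarrow> 'v set \<Rightarrow> real" and M :: "'m measure" and X0 W
  assume *: "p \<noteq> bond_critical_point V E" "symmetric_transition_matrix E K" "exclusion_randomness M E K p X0 W"
  interpret C: cluster_system E V "bond_cluster V E"
    using assms by (intro cluster_system_bond)
  have eq: "bond_percolates V E = C.occurs"
    by (rule ext) (simp add: bond_percolates_iff C.has_infinite_cluster_def)
  interpret exclusion_percolation_event M E K p X0 W C.has_infinite_cluster
    using * assms(6) C.countable_S C.percolation_event_axioms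
    by (intro exclusion_percolation_event.intro exclusion_percolation.intro exclusion_percolation_axioms.intro)
  show "AE x in M. \<nexists>t. exceptional_time E (bond_percolates V E) p (exclusion_process E K X0 W x) t"
    using AE_no_exceptional_time *(1) unfolding bond_critical_point_def eq by blast
next
  fix K :: "'v \<Rightarrow> 'v \<Rightarrow> real" and M :: "'m measure" and X0 W
  assume *: "p \<noteq> site_critical_point V E" "symmetric_transition_matrix V K" "exclusion_randomness M V K p X0 W"
  interpret C: cluster_system V V "site_cluster V E"
    using assms by (intro cluster_system_site)
  have eq: "site_percolates V E = C.occurs"
    by (rule ext) (simp add: site_percolates_iff[OF assms(1)] C.has_infinite_cluster_def)
  interpret exclusion_percolation_event M V K p X0 W C.has_infinite_cluster
    using * assms(6) C.countable_S C.percolation_event_axioms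
    by (intro exclusion_percolation_event.intro exclusion_percolation.intro exclusion_percolation_axioms.intro)
  show "AE x in M. \<nexists>t. exceptional_time V (site_percolates V E) p (exclusion_process V K X0 W x) t"
    using AE_no_exceptional_time *(1) unfolding site_critical_point_def eq by blast
qed

end
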